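(* Let $G$ be a finite group, let $P$ be an intersection operad whose underlying intersection monoid $P(1)$ is non-trivial, and let $\tau$ be a transfer system of $G$. Then there exists a $G$-suboperad $\underline{\mathrm N}_e^{\tau}P$ of the coinduced operad $\mathrm N_e^G P$, namely $\underline{\mathrm N}_e^{\tau}P=\mathcal R^{\tau}(P(1))$, that realizes the transfer system $\tau$.
   Context: $G$ is a finite group; $\mathscr C$ denotes either the category of sets or the category of compactly generated weak Hausdorff spaces; $\underline n=\{1,\dots,n\}$, $\underline 0=\emptyset$. Operads are symmetric operads with left $\Sigma_n$-actions; a $G$-operad is an operad in $G$-objects of $\mathscr C$, so $P(n)$ has a left $G\times\Sigma_n$-action. An intersection monoid $(M,\wedge)$ is a monoid $M$ in $\mathscr C$ with a symmetric reflexive relation $\wedge$ such that for all elements: (1) if $x_1y_1\wedge x_2y_2$ then $x_1\wedge x_2$; (2) if $xy_1\wedge xy_2$ then $y_1\wedge y_2$. Write $\vee$ for the complement of $\wedge$ ("disjoint"). $M$ is trivial if $x_1\wedge x_2$ for all $x_1,x_2\in M$. For a monoid $M$, the $G$-operad $\mathcal O^G(M)$ has $\mathcal O^G(M)(n)=\mathrm{Map}(G\times\underline n,M)$ (a point for $n=0$), action $((g,\sigma)\cdot x)(k,i)=x(g^{-1}k,\sigma^{-1}i)$, unit the constant map $1$ on $G\times\underline 1$, and for $x$ of arity $n$, $y$ of arity $m$, $i\in\underline n$: $(x\circ_i y)(g,k)=x(g,i)\,y(g,k-i+1)$ if $i\le k\le i+m-1$, $=x(g,k)$ if $k<i$, and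 $=x(g,k-m+1)$ if $k>i+m-1$. For an intersection monoid $M$, $\mathcal R^G(M)(n)\subseteq\mathcal O^G(M)(n)$ consists of those $x$ that are $\Sigma$-disjoint ($x(g,i)\vee x(g,j)$ for all $g\in G$, $i\ne j$) and have strict columns (for all $i\in\underline n$, $g_1,g_2\in G$, either $x(g_1,i)=x(g_2,i)$ or $x(g_1,i)\vee x(g_2,i)$); $\mathcal R^G(M)$ is a $G$-suboperad of $\mathcal O^G(M)$. An intersection operad is a (non-equivariant) operad of the form $P=\mathcal R^{\{1\}}(M)$ for an intersection monoid $M$ (here $G$ is replaced by the trivial group); then $P(1)=M$, regarded as an intersection monoid. For a non-equivariant operad $P$, the coinduced operad $\mathrm N_e^GP$ has $\mathrm N_e^GP(n)=\mathrm{Map}(G,P(n))$, with action $[(g,\sigma)f](h)=\sigma f(g^{-1}h)$ and operad structure induced pointwise from $P$. For $P=\mathcal R^{\{1\}}(M)$, $\mathrm N_e^GP(n)$ is identified with the $\Sigma$-disjoint elements of $\mathrm{Map}(G\times\underline n,M)$, so $\mathcal R^G(M)\subseteq \mathrm N_e^GP$. A transfer system $\tau$ of $G$ is a partial order $\to_\tau$ on the subgroups of $G$ refining inclusion (so $K\to_\tau H$ implies $K\le H$, $\to_\tau$ reflexive and transitive), closed under conjugation ($K\to_\tau H$ implies $K^g\to_\tau H^g$ for all $g\in G$) and under restriction ($K\to_\tau H$ and $H'\le H$ imply $K\cap H'\to_\tau H'$). A twist map for $G\times\underline n$ is a map $\alpha:S\to\underline n$ with $S\subseteq G$ such that $Sg_0$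 is a subgroup of $G$ for some $g_0\in G$. It structures a transfer $K\to H$ at position $i\in\mathrm{im}(\alpha)$ if there is $g_0\in G$ with $Sg_0=H$ and $K$ is a subgroup contained in $\alpha^{-1}(i)g_0$, maximal among the subgroups contained in $\alpha^{-1}(i)g_0$. An element $x\in\mathcal R^G(M)(n)$ supports a transfer $K\to H$ if there is a twist map $\alpha$ structuring $K\to H$ at some position with $x(g_1,\alpha(g_1))\wedge x(g_2,\alpha(g_2))$ for all $g_1,g_2$ in the domain of $\alpha$. Define $\mathcal R^\tau(M)(n)=\{x\in\mathcal R^G(M)(n) : \text{if } x \text{ supports a transfer } K\to H \text{ then } K\to_\tau H\}$, with structure inherited from $\mathcal R^G(M)$. For $H\le G$ and a finite $H$-set $T$ with $|T|=n$ and a chosen ordering $T\cong\underline n$, let $\Gamma_T=\{(h,\phi_T(h)):h\in H\}\le G\times\Sigma_n$ where $\phi_T:H\to\Sigma_n$ is the action homomorphism. $T$ is admissible for a $G$-operad $Q$ if $Q(n)^{\Gamma_T}\neq\emptyset$. A $G$-operad $Q$ realizes $\tau$ if (i) $\Sigma_n$ acts freely on $Q(n)$ for every $n$; (ii) $Q(2)^{H\times\{\mathrm{id}\}}\ne\emptyset$ for every $H\le G$; and (iii) for all $K\le H\le G$, the $H$-set $H/K$ is admissible for $Q$ if and only if $K\to_\tau H$. *)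

theory Defs
  imports "HOL-Analysis.Analysis" "HOL-Algebra.Elementary_Groups"
begin

section \<open>The ground category\<close>

text \<open>Tests by arbitrary compact Hausdorff spaces reduce to tests by spaces carried by subsets of
  \<^typ>\<open>'a set set\<close>: given \<open>u : K \<rightarrow> X\<close>, let \<open>s\<close> be a section of \<open>u\<close> over its image. The
  closure of the range of \<open>s\<close> in \<open>K\<close> has the same image as \<open>K\<close>, and a Hausdorff space with a dense
  subset \<open>D\<close> embeds as a set into the double power set of \<open>D\<close>.\<close>

definition weak_hausdorff :: "'a topology \<Rightarrow> bool" where
  "weak_hausdorff X \<longleftrightarrow>
     (\<forall>(K :: 'a set set topology) u.
        compact_space K \<and> Hausdorff_space K \<and> continuous_map K X u
          \<longrightarrow> closedin X (u ` topspace K))"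

text \<open>The compactly generated refinement of a weak Hausdorff space. In such a space the image of
  a compact Hausdorff space is again a compact Hausdorff subspace, so testing on these subspaces
  is the same as testing on all maps from compact Hausdorff spaces. Below, it is only applied to
  weak Hausdorff spaces.\<close>

definition kify :: "'a topology \<Rightarrow> 'a topology" where
  "kify X = topology (\<lambda>U. U \<subseteq> topspace X \<and>
     (\<forall>L. compactin X L \<and> Hausdorff_space (subtopology X L)
        \<longrightarrow> openin (subtopology X L) (L \<inter> U)))"

lemma openin_kify:
  "openin (kify X) U \<longleftrightarrow> U \<subseteq> topspace X \<and>
     (\<forall>L. compactin X L \<and> Hausdorff_space (subtopology X L)
        \<longrightarrow> openin (subtopology X L) (L \<inter> U))"
proof -
  let ?P = "\<lambda>U. U \<subseteq> topspace X \<and>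
     (\<forall>L. compactin X L \<and> Hausdorff_space (subtopology X L)
        \<longrightarrow> openin (subtopology X L) (L \<inter> U))"
  have "istopology ?P"
    unfolding istopology_def
  proof (rule conjI; intro allI impI conjI)
    fix S T L
    assume S: "?P S" and T: "?P T"
    show "S \<inter> T \<subseteq> topspace X"
      using S by blast
    assume L: "compactin X L \<and> Hausdorff_space (subtopology X L)"
    have "openin (subtopology X L) ((L \<inter> S) \<inter> (L \<inter> T))"
      by (rule openin_Int) (use S T L in blast)+
    moreover have "(L \<inter> S) \<inter> (L \<inter> T) = L \<inter> (S \<inter> T)"
      by blast
    ultimately show "openin (subtopology X L) (L \<inter> (S \<inter> T))"
      by simp
  next
    fix \<K> L
    assume K: "\<forall>S\<in>\<K>. ?P S"
    show "\<Union>\<K> \<subseteq> topspace X"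
      using K by blast
    assume L: "compactin X L \<and> Hausdorff_space (subtopology X L)"
    have "openin (subtopology X L) (\<Union>S\<in>\<K>. L \<inter> S)"
    proof (rule openin_Union)
      fix U assume "U \<in> (\<lambda>S. L \<inter> S) ` \<K>"
      then show "openin (subtopology X L) U"
        using K L by auto
    qed
    moreover have "(\<Union>S\<in>\<K>. L \<inter> S) = L \<inter> \<Union>\<K>"
      by blast
    ultimately show "openin (subtopology X L) (L \<inter> \<Union>\<K>)"
      by simp
  qed
  then show ?thesis
    by (simp add: kify_def topology_inverse')
qed

text \<open>Sets are treated as discrete spaces, on which all maps are continuous and on which finite
  products, subspaces and \<^const>\<open>kify\<close> are again discrete. In both cases the categorical product is
  the compactly generated refinement of the product topology.\<close>

datatype ground = Set_cat | CGWH_cat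

fun is_object :: "ground \<Rightarrow> 'a topology \<Rightarrow> bool" where
  "is_object Set_cat X \<longleftrightarrow> X = discrete_topology (topspace X)"
| "is_object CGWH_cat X \<longleftrightarrow> weak_hausdorff X \<and> kify X = X"


section \<open>Operads\<close>

text \<open>Operads are given by partial compositions; \<open>op_comp P n m i x y\<close> is \<open>x \<circ>\<^sub>i y\<close> for \<open>x\<close> of
  arity \<open>n\<close> and \<open>y\<close> of arity \<open>m\<close>. The symmetric group on \<open>n\<close> letters consists of the functions that
  permute \<open>{1..n}\<close>. The action of \<open>(g, \<sigma>)\<close> in the product of the group with the
  symmetric group is \<open>op_grp P n g \<circ> op_perm P n \<sigma>\<close>.\<close>

record 'x operad_data =
  op_lev  :: "nat \<Rightarrow> 'x topology"
  op_perm :: "nat \<Rightarrow> (nat \<Rightarrow> nat) \<Rightarrow> 'x \<Rightarrow> 'x"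
  op_unit :: 'x
  op_comp :: "nat \<Rightarrow> nat \<Rightarrow> nat \<Rightarrow> 'x \<Rightarrow> 'x \<Rightarrow> 'x"

record ('x, 'g) g_operad_data = "'x operad_data" +
  op_grp :: "nat \<Rightarrow> 'g \<Rightarrow> 'x \<Rightarrow> 'x"

abbreviation op_set :: "('x, 'z) operad_data_scheme \<Rightarrow> nat \<Rightarrow> 'x set" where
  "op_set P n \<equiv> topspace (op_lev P n)"

text \<open>The permutation \<open>\<sigma> \<circ>\<^sub>i \<tau>\<close>: it permutes the \<open>n\<close> blocks (the \<open>i\<close>-th one of size \<open>m\<close>, all others
  of size 1) by \<open>\<sigma>\<close>, and acts by \<open>\<tau>\<close> inside the \<open>i\<close>-th block.\<close>

definition block_perm ::
    "nat \<Rightarrow> nat \<Rightarrow> nat \<Rightarrow> (nat \<Rightarrow> nat) \<Rightarrow> (nat \<Rightarrow> nat) \<Rightarrow> nat \<Rightarrow> nat" where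
  "block_perm n m i \<sigma> \<tau> k =
     (let shift = (\<lambda>j. if j < \<sigma> i then j else j + m - 1) in
      if k \<notin> {1..n + m - 1} then k
      else if k < i then shift (\<sigma> k)
      else if k < i + m then \<sigma> i + \<tau> (k + 1 - i) - 1
      else shift (\<sigma> (k + 1 - m)))"

locale operad =
  fixes C :: ground and P :: "('x, 'z) operad_data_scheme"
  assumes lev_object: "is_object C (op_lev P n)"
    and perm_continuous:
      "\<sigma> permutes {1..n} \<Longrightarrow> continuous_map (op_lev P n) (op_lev P n) (op_perm P n \<sigma>)"
    and perm_id: "x \<in> op_set P n \<Longrightarrow> op_perm P n id x = x"
    and perm_comp:
      "\<lbrakk>\<sigma> permutes {1..n}; \<tau> permutes {1..n}; x \<in> op_set P n\<rbrakk>
        \<Longrightarrow> op_perm P n (\<sigma> \<circ> \<tau>) x = op_perm P n \<sigma> (op_perm P n \<tau> x)"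
    and unit_closed: "op_unit P \<in> op_set P 1"
    and comp_continuous:
      "i \<in> {1..n} \<Longrightarrow>
        continuous_map (kify (prod_topology (op_lev P n) (op_lev P m))) (op_lev P (n + m - 1))
          (\<lambda>(x, y). op_comp P n m i x y)"
    and comp_unit_left: "y \<in> op_set P m \<Longrightarrow> op_comp P 1 m 1 (op_unit P) y = y"
    and comp_unit_right:
      "\<lbrakk>i \<in> {1..n}; x \<in> op_set P n\<rbrakk> \<Longrightarrow> op_comp P n 1 i x (op_unit P) = x"
    and comp_assoc_sequential:
      "\<lbrakk>i \<in> {1..n}; j \<in> {1..m}; x \<in> op_set P n; y \<in> op_set P m; z \<in> op_set P p\<rbrakk>
        \<Longrightarrow> op_comp P (n + m - 1) p (i - 1 + j) (op_comp P n m i x y) z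
          = op_comp P n (m + p - 1) i x (op_comp P m p j y z)"
    and comp_assoc_parallel:
      "\<lbrakk>i \<in> {1..n}; k \<in> {1..n}; i < k; x \<in> op_set P n; y \<in> op_set P m; z \<in> op_set P p\<rbrakk>
        \<Longrightarrow> op_comp P (n + m - 1) p (k - 1 + m) (op_comp P n m i x y) z
          = op_comp P (n + p - 1) m i (op_comp P n p k x z) y"
    and comp_equivariant:
      "\<lbrakk>i \<in> {1..n}; \<sigma> permutes {1..n}; \<tau> permutes {1..m}; x \<in> op_set P n; y \<in> op_set P m\<rbrakk>
        \<Longrightarrow> op_perm P (n + m - 1) (block_perm n m i \<sigma> \<tau>) (op_comp P n m i x y)
          = op_comp P n m (\<sigma> i) (op_perm P n \<sigma> x) (op_perm P m \<tau> y)"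

locale g_operad = operad C P + group G
  for C :: ground and G :: "('g, 'b) monoid_scheme" (structure)
    and P :: "('x, 'g, 'z) g_operad_data_scheme" +
  assumes grp_continuous:
      "g \<in> carrier G \<Longrightarrow> continuous_map (op_lev P n) (op_lev P n) (op_grp P n g)"
    and grp_one: "x \<in> op_set P n \<Longrightarrow> op_grp P n \<one> x = x"
    and grp_mult:
      "\<lbrakk>g \<in> carrier G; h \<in> carrier G; x \<in> op_set P n\<rbrakk>
        \<Longrightarrow> op_grp P n (g \<otimes> h) x = op_grp P n g (op_grp P n h x)"
    and grp_perm:
      "\<lbrakk>g \<in> carrier G; \<sigma> permutes {1..n}; x \<in> op_set P n\<rbrakk>
        \<Longrightarrow> op_grp P n g (op_perm P n \<sigma> x) = op_perm P n \<sigma> (op_grp P n g x)"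
    and grp_unit: "g \<in> carrier G \<Longrightarrow> op_grp P 1 g (op_unit P) = op_unit P"
    and grp_comp:
      "\<lbrakk>g \<in> carrier G; i \<in> {1..n}; x \<in> op_set P n; y \<in> op_set P m\<rbrakk>
        \<Longrightarrow> op_grp P (n + m - 1) g (op_comp P n m i x y)
          = op_comp P n m i (op_grp P n g x) (op_grp P m g y)"

definition g_suboperad ::
    "ground \<Rightarrow> ('g, 'b) monoid_scheme \<Rightarrow> ('x, 'g) g_operad_data \<Rightarrow> ('x, 'g) g_operad_data \<Rightarrow> bool"
  where
  "g_suboperad C G Q P \<longleftrightarrow>
     g_operad C G P \<and> g_operad C G Q \<and>
     (\<forall>n. op_set Q n \<subseteq> op_set P n \<and> op_lev Q n = kify (subtopology (op_lev P n) (op_set Q n))) \<and>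
     op_unit Q = op_unit P \<and>
     (\<forall>n \<sigma>. \<forall>x\<in>op_set Q n. \<sigma> permutes {1..n} \<longrightarrow> op_perm Q n \<sigma> x = op_perm P n \<sigma> x) \<and>
     (\<forall>n. \<forall>g\<in>carrier G. \<forall>x\<in>op_set Q n. op_grp Q n g x = op_grp P n g x) \<and>
     (\<forall>n m. \<forall>i\<in>{1..n}. \<forall>x\<in>op_set Q n. \<forall>y\<in>op_set Q m.
        op_comp Q n m i x y = op_comp P n m i x y)"

definition g_operad_iso ::
    "('g, 'b) monoid_scheme \<Rightarrow> (nat \<Rightarrow> 'x \<Rightarrow> 'y)
      \<Rightarrow> ('x, 'g) g_operad_data \<Rightarrow> ('y, 'g) g_operad_data \<Rightarrow> bool" where
  "g_operad_iso G \<phi> P Q \<longleftrightarrow>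
     (\<forall>n. homeomorphic_map (op_lev P n) (op_lev Q n) (\<phi> n)) \<and>
     \<phi> 1 (op_unit P) = op_unit Q \<and>
     (\<forall>n \<sigma>. \<forall>x\<in>op_set P n. \<sigma> permutes {1..n}
        \<longrightarrow> \<phi> n (op_perm P n \<sigma> x) = op_perm Q n \<sigma> (\<phi> n x)) \<and>
     (\<forall>n. \<forall>g\<in>carrier G. \<forall>x\<in>op_set P n. \<phi> n (op_grp P n g x) = op_grp Q n g (\<phi> n x)) \<and>
     (\<forall>n m. \<forall>i\<in>{1..n}. \<forall>x\<in>op_set P n. \<forall>y\<in>op_set P m.
        \<phi> (n + m - 1) (op_comp P n m i x y) = op_comp Q n m i (\<phi> n x) (\<phi> m y))"

definition coinduced ::
    "('g, 'b) monoid_scheme \<Rightarrow> ('x, 'z) operad_data_scheme \<Rightarrow> ('g \<Rightarrow> 'x, 'g) g_operad_data" where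
  "coinduced G P =
     \<lparr> op_lev = (\<lambda>n. kify (product_topology (\<lambda>_. op_lev P n) (carrier G))),
       op_perm = (\<lambda>n \<sigma> f. \<lambda>h\<in>carrier G. op_perm P n \<sigma> (f h)),
       op_unit = (\<lambda>h\<in>carrier G. op_unit P),
       op_comp = (\<lambda>n m i f f'. \<lambda>h\<in>carrier G. op_comp P n m i (f h) (f' h)),
       op_grp = (\<lambda>n g f. \<lambda>h\<in>carrier G. f (inv\<^bsub>G\<^esub> g \<otimes>\<^bsub>G\<^esub> h)) \<rparr>"

definition restrict_levels ::
    "('x, 'g) g_operad_data \<Rightarrow> (nat \<Rightarrow> 'x set) \<Rightarrow> ('x, 'g) g_operad_data" where
  "restrict_levels P S = P \<lparr> op_lev := \<lambda>n. kify (subtopology (op_lev P n) (S n)) \<rparr>"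


section \<open>Intersection monoids and their operads\<close>

record 'm imonoid = "'m monoid" +
  mtop  :: "'m topology"
  meets :: "'m \<Rightarrow> 'm \<Rightarrow> bool"

locale intersection_monoid = monoid M
  for C :: ground and M :: "('m, 'z) imonoid_scheme" (structure) +
  assumes mtop_object: "is_object C (mtop M)"
    and topspace_mtop: "topspace (mtop M) = carrier M"
    and mult_continuous:
      "continuous_map (kify (prod_topology (mtop M) (mtop M))) (mtop M) (\<lambda>(x, y). x \<otimes> y)"
    and meets_refl: "x \<in> carrier M \<Longrightarrow> meets M x x"
    and meets_sym: "\<lbrakk>x \<in> carrier M; y \<in> carrier M; meets M x y\<rbrakk> \<Longrightarrow> meets M y x"
    and meets_prefix:
      "\<lbrakk>x1 \<in> carrier M; x2 \<in> carrier M; y1 \<in> carrier M; y2 \<in> carrier M;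
        meets M (x1 \<otimes> y1) (x2 \<otimes> y2)\<rbrakk> \<Longrightarrow> meets M x1 x2"
    and meets_cancel:
      "\<lbrakk>x \<in> carrier M; y1 \<in> carrier M; y2 \<in> carrier M; meets M (x \<otimes> y1) (x \<otimes> y2)\<rbrakk>
        \<Longrightarrow> meets M y1 y2"

definition trivial_imonoid :: "('m, 'z) imonoid_scheme \<Rightarrow> bool" where
  "trivial_imonoid M \<longleftrightarrow> (\<forall>x1\<in>carrier M. \<forall>x2\<in>carrier M. meets M x1 x2)"

definition O_operad ::
    "('g, 'b) monoid_scheme \<Rightarrow> ('m, 'z) imonoid_scheme \<Rightarrow> ('g \<times> nat \<Rightarrow> 'm, 'g) g_operad_data" where
  "O_operad G M =
     \<lparr> op_lev = (\<lambda>n. kify (product_topology (\<lambda>_. mtop M) (carrier G \<times> {1..n}))),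
       op_perm = (\<lambda>n \<sigma> x. \<lambda>(k, i)\<in>carrier G \<times> {1..n}. x (k, inv_into UNIV \<sigma> i)),
       op_unit = (\<lambda>_\<in>carrier G \<times> {1..1}. \<one>\<^bsub>M\<^esub>),
       op_comp = (\<lambda>n m i x y. \<lambda>(g, k)\<in>carrier G \<times> {1..n + m - 1}.
          if k < i then x (g, k)
          else if k < i + m then x (g, i) \<otimes>\<^bsub>M\<^esub> y (g, k + 1 - i)
          else x (g, k + 1 - m)),
       op_grp = (\<lambda>n g x. \<lambda>(k, i)\<in>carrier G \<times> {1..n}. x (inv\<^bsub>G\<^esub> g \<otimes>\<^bsub>G\<^esub> k, i)) \<rparr>"

definition sigma_disjoint ::
    "('g, 'b) monoid_scheme \<Rightarrow> ('m, 'z) imonoid_scheme \<Rightarrow> nat \<Rightarrow> ('g \<times> nat \<Rightarrow> 'm) \<Rightarrow> bool" where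
  "sigma_disjoint G M n x \<longleftrightarrow>
     (\<forall>g\<in>carrier G. \<forall>i\<in>{1..n}. \<forall>j\<in>{1..n}. i \<noteq> j \<longrightarrow> \<not> meets M (x (g, i)) (x (g, j)))"

definition strict_columns ::
    "('g, 'b) monoid_scheme \<Rightarrow> ('m, 'z) imonoid_scheme \<Rightarrow> nat \<Rightarrow> ('g \<times> nat \<Rightarrow> 'm) \<Rightarrow> bool" where
  "strict_columns G M n x \<longleftrightarrow>
     (\<forall>i\<in>{1..n}. \<forall>g1\<in>carrier G. \<forall>g2\<in>carrier G.
        x (g1, i) = x (g2, i) \<or> \<not> meets M (x (g1, i)) (x (g2, i)))"

definition R_operad ::
    "('g, 'b) monoid_scheme \<Rightarrow> ('m, 'z) imonoid_scheme \<Rightarrow> ('g \<times> nat \<Rightarrow> 'm, 'g) g_operad_data" where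
  "R_operad G M = restrict_levels (O_operad G M)
     (\<lambda>n. {x \<in> op_set (O_operad G M) n. sigma_disjoint G M n x \<and> strict_columns G M n x})"

text \<open>\<open>P\<close> is the intersection operad of \<open>M\<close>. Its arity 1 part is \<open>M\<close>, under the identification of
  maps from a one-point set to \<open>M\<close> with elements of \<open>M\<close>.\<close>

definition intersection_operad ::
    "ground \<Rightarrow> (unit \<times> nat \<Rightarrow> 'm, unit) g_operad_data \<Rightarrow> ('m, 'z) imonoid_scheme \<Rightarrow> bool" where
  "intersection_operad C P M \<longleftrightarrow> intersection_monoid C M \<and> P = R_operad (singleton_group ()) M"

definition coinduced_ident ::
    "('g, 'b) monoid_scheme \<Rightarrow> nat \<Rightarrow> ('g \<times> nat \<Rightarrow> 'm) \<Rightarrow> 'g \<Rightarrow> unit \<times> nat \<Rightarrow> 'm" where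
  "coinduced_ident G n x =
     (\<lambda>h\<in>carrier G. \<lambda>(_, i)\<in>carrier (singleton_group ()) \<times> {1..n}. x (h, i))"


section \<open>Transfer systems\<close>

definition transfer_system ::
    "('g, 'b) monoid_scheme \<Rightarrow> ('g set \<Rightarrow> 'g set \<Rightarrow> bool) \<Rightarrow> bool" where
  "transfer_system G \<tau> \<longleftrightarrow>
     (\<forall>K H. \<tau> K H \<longrightarrow> subgroup K G \<and> subgroup H G \<and> K \<subseteq> H) \<and>
     (\<forall>H. subgroup H G \<longrightarrow> \<tau> H H) \<and>
     (\<forall>L K H. \<tau> L K \<and> \<tau> K H \<longrightarrow> \<tau> L H) \<and>
     (\<forall>K H. \<forall>g\<in>carrier G. \<tau> K H \<longrightarrow>
        \<tau> ((\<lambda>k. inv\<^bsub>G\<^esub> g \<otimes>\<^bsub>G\<^esub> k \<otimes>\<^bsub>G\<^esub> g) ` K) ((\<lambda>h. inv\<^bsub>G\<^esub> g \<otimes>\<^bsub>G\<^esub> h \<otimes>\<^bsub>G\<^esub> g) ` H)) \<and>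
     (\<forall>K H H'. \<tau> K H \<and> subgroup H' G \<and> H' \<subseteq> H \<longrightarrow> \<tau> (K \<inter> H') H')"

definition twist_map ::
    "('g, 'b) monoid_scheme \<Rightarrow> nat \<Rightarrow> 'g set \<Rightarrow> ('g \<Rightarrow> nat) \<Rightarrow> bool" where
  "twist_map G n S \<alpha> \<longleftrightarrow>
     S \<subseteq> carrier G \<and> \<alpha> ` S \<subseteq> {1..n} \<and> (\<exists>g0\<in>carrier G. subgroup (S #>\<^bsub>G\<^esub> g0) G)"

definition structures_transfer ::
    "('g, 'b) monoid_scheme \<Rightarrow> 'g set \<Rightarrow> ('g \<Rightarrow> nat) \<Rightarrow> nat \<Rightarrow> 'g set \<Rightarrow> 'g set \<Rightarrow> bool" where
  "structures_transfer G S \<alpha> i K H \<longleftrightarrow>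
     i \<in> \<alpha> ` S \<and> subgroup H G \<and>
     (\<exists>g0\<in>carrier G. S #>\<^bsub>G\<^esub> g0 = H \<and>
        (let A = {s \<in> S. \<alpha> s = i} #>\<^bsub>G\<^esub> g0 in
           subgroup K G \<and> K \<subseteq> A \<and> (\<forall>L. subgroup L G \<and> L \<subseteq> A \<and> K \<subseteq> L \<longrightarrow> L = K)))"

definition supports_transfer ::
    "('g, 'b) monoid_scheme \<Rightarrow> ('m, 'z) imonoid_scheme \<Rightarrow> nat \<Rightarrow> ('g \<times> nat \<Rightarrow> 'm)
      \<Rightarrow> 'g set \<Rightarrow> 'g set \<Rightarrow> bool" where
  "supports_transfer G M n x K H \<longleftrightarrow>
     (\<exists>S \<alpha> i. twist_map G n S \<alpha> \<and> structures_transfer G S \<alpha> i K H \<and>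
        (\<forall>g1\<in>S. \<forall>g2\<in>S. meets M (x (g1, \<alpha> g1)) (x (g2, \<alpha> g2))))"

definition R_tau_operad ::
    "('g, 'b) monoid_scheme \<Rightarrow> ('m, 'z) imonoid_scheme \<Rightarrow> ('g set \<Rightarrow> 'g set \<Rightarrow> bool)
      \<Rightarrow> ('g \<times> nat \<Rightarrow> 'm, 'g) g_operad_data" where
  "R_tau_operad G M \<tau> = restrict_levels (R_operad G M)
     (\<lambda>n. {x \<in> op_set (R_operad G M) n. \<forall>K H. supports_transfer G M n x K H \<longrightarrow> \<tau> K H})"

text \<open>The permutation of \<open>{1..n}\<close> by which \<open>h\<close> acts on a set \<open>T\<close> (with action \<open>a\<close>) of cardinality \<open>n\<close>
  ordered by \<open>e\<close>.\<close>

definition action_perm ::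
    "'t set \<Rightarrow> ('g \<Rightarrow> 't \<Rightarrow> 't) \<Rightarrow> ('t \<Rightarrow> nat) \<Rightarrow> 'g \<Rightarrow> nat \<Rightarrow> nat" where
  "action_perm T a e h i = (if i \<in> {1..card T} then e (a h (inv_into T e i)) else i)"

definition admissible ::
    "('x, 'g) g_operad_data \<Rightarrow> 'g set \<Rightarrow> 't set \<Rightarrow> ('g \<Rightarrow> 't \<Rightarrow> 't) \<Rightarrow> bool" where
  "admissible Q H T a \<longleftrightarrow>
     (\<exists>e. bij_betw e T {1..card T} \<and>
        (\<exists>x\<in>op_set Q (card T). \<forall>h\<in>H.
           op_grp Q (card T) h (op_perm Q (card T) (action_perm T a e h) x) = x))"

definition realizes ::
    "('g, 'b) monoid_scheme \<Rightarrow> ('x, 'g) g_operad_data \<Rightarrow> ('g set \<Rightarrow> 'g set \<Rightarrow> bool) \<Rightarrow> bool" where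
  "realizes G Q \<tau> \<longleftrightarrow>
     (\<forall>n \<sigma>. \<forall>x\<in>op_set Q n. \<sigma> permutes {1..n} \<and> op_perm Q n \<sigma> x = x \<longrightarrow> \<sigma> = id) \<and>
     (\<forall>H. subgroup H G \<longrightarrow> (\<exists>x\<in>op_set Q 2. \<forall>h\<in>H. op_grp Q 2 h (op_perm Q 2 id x) = x)) \<and>
     (\<forall>K H. subgroup K G \<and> subgroup H G \<and> K \<subseteq> H \<longrightarrow>
        (admissible Q H {h <#\<^bsub>G\<^esub> K | h. h \<in> H} (\<lambda>h c. h <#\<^bsub>G\<^esub> c) \<longleftrightarrow> \<tau> K H))"

end

theory Submission
  imports Defs
begin

text \<open>
  An element \<open>x\<close> supports a transfer \<open>K \<rightarrow> H\<close> if some function \<open>a\<close> on \<open>H\<close> picks, in the rows of a right coset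
  of \<open>H\<close>, entries of \<open>x\<close> that all meet each other, and \<open>K\<close> is maximal among the subgroups
  on which \<open>a\<close> has one fixed value (\<open>supports_transfer_iff\<close>). The elements whose supported transfers
  lie in \<open>\<tau>\<close> form a suboperad because the closure properties of a transfer system match the operations. The group
  action conjugates supported transfers (\<open>supports_transfer_grp\<close>), and the transfers supported by a
  composite \<open>x \<circ>\<^sub>i y\<close> are composites of transfers supported by \<open>x\<close> and by \<open>y\<close>
  (\<open>supports_transfer_comp\<close>): entries of \<open>x \<circ>\<^sub>i y\<close> can only meet if the entries of \<open>x\<close> that they come from
  meet, and in the inserted block, where strict columns make the latter equal, they can be cancelled
  to meeting entries of \<open>y\<close>.

  The suboperad realizes \<open>\<tau>\<close>. Disjointness of the entries in a row makes the symmetric groups act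
  freely, and two disjoint elements of \<open>M\<close> give an invariant binary operation. A fixed point for the
  graph subgroup of \<open>H/K\<close> has equal entries along the orbit of the coset \<open>K\<close>, and so supports
  \<open>K \<rightarrow> H\<close>. Conversely, a non-trivial \<open>M\<close> contains infinitely many pairwise disjoint elements
  (\<open>disjoint_sequence\<close>), which can be used as labels. Index the columns by the left cosets \<open>c\<close>
  of \<open>K\<close> in \<open>H\<close>, and let the entry in row \<open>k\<close> and column \<open>c\<close> be the label of \<open>k\<^sup>-\<^sup>1 c\<close>. This is a
  fixed point that supports only restrictions of conjugates of \<open>K \<rightarrow> H\<close>. All of these belong to \<open>\<tau>\<close> as soon as \<open>K \<rightarrow> H\<close> does (\<open>R_tau_admissible_iff\<close>).

  It remains to compare the topologies. Discrete spaces are compactly generated and weak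
  Hausdorff, so both ground categories are treated at once. The main point is that compact
  Hausdorff spaces of arbitrary type have closed Hausdorff images in weak Hausdorff spaces
  (\<open>weak_hausdorff_closedin_image\<close>, \<open>weak_hausdorff_Hausdorff_image\<close>). This gives the universal property of
  the compactly generated refinement (\<open>continuous_map_into_kify\<close>), which reduces continuity into the
  iterated refinements of products and subspaces to the continuity of coordinates. Thus the
  identification of the operad with its image in the coinduced operad is a homeomorphism in every
  arity (\<open>homeomorphic_map_ident\<close>).
\<close>

section \<open>Compactly generated weak Hausdorff spaces\<close>

lemma topspace_kify [simp]: "topspace (kify X) = topspace X"
proof
  show "topspace (kify X) \<subseteq> topspace X"
    using openin_kify[of X "topspace (kify X)"] by simp
  have "openin (kify X) (topspace X)"
    unfolding openin_kify by (auto simp: openin_subtopology)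
  then show "topspace X \<subseteq> topspace (kify X)"
    by (rule openin_subset)
qed

lemma openin_imp_openin_kify: "openin X U \<Longrightarrow> openin (kify X) U"
  unfolding openin_kify by (auto simp: openin_subset openin_subtopology)

lemma closedin_imp_closedin_kify: "closedin X A \<Longrightarrow> closedin (kify X) A"
  by (simp add: closedin_def openin_imp_openin_kify)

lemma continuous_map_into_kifyD: "continuous_map X (kify Y) f \<Longrightarrow> continuous_map X Y f"
  unfolding continuous_map by (auto simp: openin_imp_openin_kify)

lemma continuous_map_from_kify: "continuous_map X Y f \<Longrightarrow> continuous_map (kify X) Y f"
  unfolding continuous_map by (auto simp: openin_imp_openin_kify)

text \<open>The refinement only adds open sets whose traces on compact Hausdorff subspaces are open
  already, so it does not change those subspaces and, being determined by them, it is idempotent.\<close>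

lemma subtopology_kify_compact:
  assumes "compactin X L" "Hausdorff_space (subtopology X L)"
  shows "subtopology (kify X) L = subtopology X L"
  unfolding topology_eq
proof (intro allI iffI)
  fix V
  assume "openin (subtopology (kify X) L) V"
  then obtain W where W: "openin (kify X) W" "V = W \<inter> L"
    by (auto simp: openin_subtopology)
  then have "openin (subtopology X L) (L \<inter> W)"
    using assms by (simp add: openin_kify)
  then show "openin (subtopology X L) V"
    using W by (simp add: Int_commute)
next
  fix V
  assume "openin (subtopology X L) V"
  then show "openin (subtopology (kify X) L) V"
    by (auto simp: openin_subtopology intro: openin_imp_openin_kify)
qed

lemma kify_kify: "kify (kify X) = kify X"
proof -
  have "openin (kify X) U" if "openin (kify (kify X)) U" for U
    unfolding openin_kify
  proof (intro conjI allI impI)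
    show "U \<subseteq> topspace X"
      using openin_subset[OF that] by simp
    fix L assume L: "compactin X L \<and> Hausdorff_space (subtopology X L)"
    then have eq: "subtopology (kify X) L = subtopology X L"
      by (simp add: subtopology_kify_compact)
    have "compactin (kify X) L"
      using L eq by (simp add: compactin_subspace)
    then show "openin (subtopology X L) (L \<inter> U)"
      using that L eq unfolding openin_kify[of "kify X"] by auto
  qed
  then show ?thesis
    by (meson openin_imp_openin_kify topology_eq)
qed

text \<open>A point of a Hausdorff space in the closure of \<open>D\<close> is determined by the traces on \<open>D\<close> of its
  open neighbourhoods. Transported along the injection \<open>u\<close>, these traces form a set of subsets of
  \<^typ>\<open>'a\<close>, so the closure of \<open>D\<close> can be carried by subsets of \<^typ>\<open>'a set set\<close>.\<close>

lemma compact_Hausdorff_dense_copy: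
  fixes K :: "'k topology" and u :: "'k \<Rightarrow> 'a"
  assumes K: "compact_space K" "Hausdorff_space K"
    and D: "D \<subseteq> topspace K" "inj_on u D"
  obtains L :: "'a set set topology" and F
  where "compact_space L" "Hausdorff_space L" "continuous_map L K F"
    "F ` topspace L = K closure_of D"
proof -
  define E where "E x = {u ` (V \<inter> D) | V. openin K V \<and> x \<in> V}" for x
  have inj: "inj_on E (K closure_of D)"
  proof (rule inj_onI, rule ccontr)
    fix x y
    assume x: "x \<in> K closure_of D" and y: "y \<in> K closure_of D" and eq: "E x = E y" and "x \<noteq> y"
    then have "x \<in> topspace K" "y \<in> topspace K"
      by (auto simp: in_closure_of)
    with K(2) \<open>x \<noteq> y\<close> obtain V W
      where VW: "openin K V" "openin K W" "x \<in> V" "y \<in> W" "disjnt V W"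
      unfolding Hausdorff_space_def by blast
    then have "u ` (V \<inter> D) \<in> E y"
      using eq by (auto simp: E_def)
    then obtain V' where V': "openin K V'" "y \<in> V'" "u ` (V \<inter> D) = u ` (V' \<inter> D)"
      by (auto simp: E_def)
    then have *: "V \<inter> D = V' \<inter> D"
      using D(2) by (metis Int_lower2 inj_on_image_eq_iff)
    have "openin K (V' \<inter> W)" "y \<in> V' \<inter> W"
      using V' VW by auto
    then obtain d where "d \<in> D" "d \<in> V' \<inter> W"
      using y unfolding in_closure_of by blast
    then show False
      using * VW(5) by (auto simp: disjnt_iff)
  qed
  \<comment> \<open>The closure of \<open>D\<close> is moved along the injection \<open>E\<close>, by pulling its topology back along the inverse.\<close>
  define A where "A = subtopology K (K closure_of D)"
  define F where "F = inv_into (K closure_of D) E"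
  define L where "L = pullback_topology (E ` (K closure_of D)) F A"
  have top_A: "topspace A = K closure_of D"
    unfolding A_def by (rule topspace_subtopology_subset) (rule closure_of_subset_topspace)
  have FE: "F (E x) = x" if "x \<in> K closure_of D" for x
    using that inj by (simp add: F_def)
  have top_L: "topspace L = E ` (K closure_of D)"
    using FE by (auto simp: L_def topspace_pullback_topology top_A)
  have "continuous_map L A (id \<circ> F)"
    unfolding L_def by (rule continuous_map_pullback) simp
  then have F: "continuous_map L A F"
    by simp
  have "continuous_map A A id"
    by simp
  then have "continuous_map A A (F \<circ> E)"
    by (rule continuous_map_eq) (simp add: top_A FE)
  then have E: "continuous_map A L E"
    unfolding L_def by (rule continuous_map_pullback') (auto simp: top_A)
  have "homeomorphic_maps A L E F"
    using E F by (auto simp: homeomorphic_maps_def top_A top_L FE)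
  then have hom: "A homeomorphic_space L"
    by (auto simp: homeomorphic_space_def)
  have "compact_space A"
    unfolding A_def using K(1)
    by (simp add: closedin_compact_space compact_space_subtopology)
  moreover have "Hausdorff_space A"
    unfolding A_def using K(2) by (simp add: Hausdorff_space_subtopology)
  ultimately have "compact_space L" "Hausdorff_space L"
    using hom homeomorphic_compact_space homeomorphic_Hausdorff_space by blast+
  moreover have "continuous_map L K F"
    using F unfolding A_def by (rule continuous_map_into_fulltopology)
  moreover have "F ` topspace L = K closure_of D"
    by (force simp: top_L FE)
  ultimately show ?thesis
    using that by blast
qed

text \<open>Weak Hausdorffness is tested by spaces of one fixed type only, but this suffices for all compact
  Hausdorff spaces: choose one preimage for every point of the image of \<open>u\<close>. The closure of the set
  of these preimages is compact, has the same image as the whole space, and has a copy of the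
  testing type. This makes the notion usable for projections of products, where the type changes.\<close>

lemma weak_hausdorff_closedin_image:
  fixes K :: "'k topology" and X :: "'a topology"
  assumes X: "weak_hausdorff X" and K: "compact_space K" "Hausdorff_space K"
    and u: "continuous_map K X u"
  shows "closedin X (u ` topspace K)"
proof -
  define D where "D = inv_into (topspace K) u ` (u ` topspace K)"
  have D: "D \<subseteq> topspace K" "u ` D = u ` topspace K" "inj_on u D"
    by (auto simp: D_def inv_into_into f_inv_into_f image_image intro!: inj_onI)
  then obtain L :: "'a set set topology" and F
    where L: "compact_space L" "Hausdorff_space L" "continuous_map L K F"
      "F ` topspace L = K closure_of D"
    using compact_Hausdorff_dense_copy[OF K D(1,3)] by blast
  have "continuous_map L X (u \<circ> F)"
    using L(3) u by (rule continuous_map_compose)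
  then have "closedin X ((u \<circ> F) ` topspace L)"
    using X L unfolding weak_hausdorff_def by blast
  moreover have "(u \<circ> F) ` topspace L = u ` topspace K"
  proof -
    have "D \<subseteq> K closure_of D" "K closure_of D \<subseteq> topspace K"
      using D(1) by (simp_all add: closure_of_subset closure_of_subset_topspace)
    then show ?thesis
      unfolding image_comp[symmetric] L(4) using D(2) by blast
  qed
  ultimately show ?thesis
    by simp
qed

text \<open>Closed subsets of \<open>K\<close> are compact Hausdorff themselves, so \<open>u\<close> is a closed map onto its image, and
  continuous closed maps preserve normal Hausdorff spaces.\<close>

lemma weak_hausdorff_Hausdorff_image:
  assumes X: "weak_hausdorff X" and K: "compact_space K" "Hausdorff_space K"
    and u: "continuous_map K X u"
  shows "Hausdorff_space (subtopology X (u ` topspace K))"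
proof -
  have u': "continuous_map K (subtopology X (u ` topspace K)) u"
    using u by (auto simp: continuous_map_in_subtopology)
  have "closed_map K (subtopology X (u ` topspace K)) u"
    unfolding closed_map_def
  proof (intro allI impI)
    fix A assume A: "closedin K A"
    then have top: "topspace (subtopology K A) = A"
      using closedin_subset by auto
    have "compact_space (subtopology K A)" "Hausdorff_space (subtopology K A)"
      using A K by (simp_all add: closedin_compact_space compact_space_subtopology
          Hausdorff_space_subtopology)
    then have "closedin X (u ` A)"
      using weak_hausdorff_closedin_image[OF X _ _ continuous_map_from_subtopology[OF u]] top
      by metis
    then show "closedin (subtopology X (u ` topspace K)) (u ` A)"
      by (rule closedin_subset_topspace) (use A closedin_subset in blast)
  qed
  moreover have "u ` topspace K = topspace (subtopology X (u ` topspace K))"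
    using u by (auto simp: continuous_map_def)
  ultimately show ?thesis
    using normal_Hausdorff_space_closed_continuous_map_image u'
      compact_Hausdorff_or_regular_imp_normal_space K by metis
qed

text \<open>The universal property of the refinement. A compact Hausdorff subspace of \<open>X\<close> is mapped onto a
  compact Hausdorff subspace of \<open>Y\<close>, and \<open>Y\<close> and its refinement have the same open traces there.\<close>

lemma continuous_map_into_kify:
  assumes X: "kify X = X" and Y: "weak_hausdorff Y" and f: "continuous_map X Y f"
  shows "continuous_map X (kify Y) f"
  unfolding continuous_map
proof (intro conjI allI impI)
  show "f ` topspace X \<subseteq> topspace (kify Y)"
    using f by (auto simp: continuous_map_def)
  fix U assume U: "openin (kify Y) U"
  have "openin (kify X) {x \<in> topspace X. f x \<in> U}"
    unfolding openin_kify
  proof (intro conjI allI impI)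
    fix L assume L: "compactin X L \<and> Hausdorff_space (subtopology X L)"
    define K where "K = subtopology X L"
    have top: "topspace K = L"
      using L compactin_subset_topspace by (auto simp: K_def)
    have K: "compact_space K" "Hausdorff_space K" "continuous_map K Y f"
      using L f by (simp_all add: K_def compact_space_subtopology continuous_map_from_subtopology)
    have "compactin Y (f ` L)"
      using L f image_compactin by blast
    moreover have "Hausdorff_space (subtopology Y (f ` L))"
      using weak_hausdorff_Hausdorff_image[OF Y K] top by simp
    ultimately have "openin (subtopology Y (f ` L)) (f ` L \<inter> U)"
      using U by (simp add: openin_kify)
    moreover have "continuous_map K (subtopology Y (f ` L)) f"
      using K(3) top by (auto simp: continuous_map_in_subtopology)
    ultimately have "openin K {x \<in> topspace K. f x \<in> f ` L \<inter> U}"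
      by (simp only: continuous_map)
    moreover have "{x \<in> topspace K. f x \<in> f ` L \<inter> U} = L \<inter> {x \<in> topspace X. f x \<in> U}"
      using L compactin_subset_topspace[of X L] by (auto simp: top)
    ultimately show "openin (subtopology X L) (L \<inter> {x \<in> topspace X. f x \<in> U})"
      by (simp add: K_def)
  qed auto
  then show "openin X {x \<in> topspace X. f x \<in> U}"
    by (simp add: X)
qed

lemma weak_hausdorff_kify: "weak_hausdorff X \<Longrightarrow> weak_hausdorff (kify X)"
  unfolding weak_hausdorff_def
  by (meson closedin_imp_closedin_kify continuous_map_into_kifyD)

lemma weak_hausdorff_subtopology: "weak_hausdorff X \<Longrightarrow> weak_hausdorff (subtopology X S)"
  unfolding weak_hausdorff_def continuous_map_in_subtopology
  by (metis closedin_subset_topspace image_subset_iff_funcset)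

text \<open>A compact image in a product lies in the product of its projections, which is a closed
  compact Hausdorff subspace.\<close>

lemma weak_hausdorff_product_topology:
  assumes X: "\<And>i. i \<in> I \<Longrightarrow> weak_hausdorff (X i)"
  shows "weak_hausdorff (product_topology X I)"
  unfolding weak_hausdorff_def
proof (intro allI impI; elim conjE)
  fix K :: "('a \<Rightarrow> 'b) set set topology" and u
  assume K: "compact_space K" "Hausdorff_space K" and u: "continuous_map K (product_topology X I) u"
  define A where "A i = (\<lambda>k. u k i) ` topspace K" for i
  have ui: "continuous_map K (X i) (\<lambda>k. u k i)" if "i \<in> I" for i
    using u that by auto
  have clo: "closedin (X i) (A i)" and haus: "Hausdorff_space (subtopology (X i) (A i))"
    if "i \<in> I" for i
    unfolding A_def
    using weak_hausdorff_closedin_image[OF X K ui] weak_hausdorff_Hausdorff_image[OF X K ui] that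
    by auto
  define Z where "Z = subtopology (product_topology X I) (PiE I A)"
  have Z: "Z = product_topology (\<lambda>i. subtopology (X i) (A i)) I"
    by (simp add: Z_def subtopology_product_topology)
  have "Hausdorff_space Z"
    unfolding Z Hausdorff_space_product_topology using haus by blast
  moreover have "u ` topspace K \<subseteq> PiE I A"
    using continuous_map_image_subset_topspace[OF u] by (auto simp: A_def PiE_iff)
  then have "compactin Z (u ` topspace K)"
    unfolding Z_def using K(1) u
    by (auto simp: compactin_subtopology compact_space_def intro: image_compactin)
  ultimately have "closedin Z (u ` topspace K)"
    by (rule compactin_imp_closedin)
  moreover have "closedin (product_topology X I) (PiE I A)"
    using clo by (simp add: closedin_product_topology)
  ultimately show "closedin (product_topology X I) (u ` topspace K)"
    unfolding Z_def by (rule closedin_trans_full)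
qed

lemma weak_hausdorff_prod_topology:
  assumes X: "weak_hausdorff X" and Y: "weak_hausdorff Y"
  shows "weak_hausdorff (prod_topology X Y)"
  unfolding weak_hausdorff_def
proof (intro allI impI; elim conjE)
  fix K :: "('a \<times> 'b) set set topology" and u
  assume K: "compact_space K" "Hausdorff_space K" and u: "continuous_map K (prod_topology X Y) u"
  have u1: "continuous_map K X (fst \<circ> u)" and u2: "continuous_map K Y (snd \<circ> u)"
    using u by (simp_all add: continuous_map_pairwise)
  define A where "A = (fst \<circ> u) ` topspace K"
  define B where "B = (snd \<circ> u) ` topspace K"
  note A = weak_hausdorff_closedin_image[OF X K u1] weak_hausdorff_Hausdorff_image[OF X K u1]
  note B = weak_hausdorff_closedin_image[OF Y K u2] weak_hausdorff_Hausdorff_image[OF Y K u2]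
  define Z where "Z = subtopology (prod_topology X Y) (A \<times> B)"
  have "Hausdorff_space Z"
    unfolding Z_def subtopology_Times Hausdorff_space_prod_topology A_def B_def using A B by blast
  moreover have "u ` topspace K \<subseteq> A \<times> B"
    unfolding A_def B_def image_subset_iff mem_Times_iff by simp
  then have "compactin Z (u ` topspace K)"
    unfolding Z_def using K(1) u
    by (auto simp: compactin_subtopology compact_space_def intro: image_compactin)
  ultimately have "closedin Z (u ` topspace K)"
    by (rule compactin_imp_closedin)
  moreover have "closedin (prod_topology X Y) (A \<times> B)"
    using A B by (simp add: A_def B_def closedin_prod_Times_iff)
  ultimately show "closedin (prod_topology X Y) (u ` topspace K)"
    unfolding Z_def by (rule closedin_trans_full)
qed

lemma kify_discrete: "kify (discrete_topology A) = discrete_topology A"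
proof -
  have "openin (discrete_topology A) U" if "openin (kify (discrete_topology A)) U" for U
    using openin_subset[OF that] by simp
  then show ?thesis
    by (meson openin_imp_openin_kify topology_eq)
qed

text \<open>Every object of either ground category is compactly generated and weak Hausdorff, since
  discrete spaces are. So maps can be shown to be continuous in both cases at once.\<close>

lemma is_object_imp_CGWH: "is_object C X \<Longrightarrow> weak_hausdorff X \<and> kify X = X"
proof (cases C)
  case Set_cat
  assume "is_object C X"
  then have *: "X = discrete_topology (topspace X)"
    using Set_cat by simp
  have "weak_hausdorff (discrete_topology (topspace X))"
    by (auto simp: weak_hausdorff_def continuous_map_def)
  moreover have "kify (discrete_topology (topspace X)) = discrete_topology (topspace X)"
    by (rule kify_discrete)
  ultimately show ?thesis
    using * by metis
qed simp

lemma is_object_weak_hausdorff: "is_object C X \<Longrightarrow> weak_hausdorff X"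
  using is_object_imp_CGWH by blast

lemma is_object_kify_eq: "is_object C X \<Longrightarrow> kify X = X"
  using is_object_imp_CGWH by blast

lemma is_object_kify_subtopology:
  assumes "is_object C X"
  shows "is_object C (kify (subtopology X S))"
proof (cases C)
  case Set_cat
  then have "X = discrete_topology (topspace X)"
    using assms by simp
  then have "subtopology X S = discrete_topology (topspace X \<inter> S)"
    by (metis subtopology_discrete_topology)
  then show ?thesis
    by (simp add: Set_cat kify_discrete)
next
  case CGWH_cat
  then show ?thesis
    using assms by (simp add: kify_kify weak_hausdorff_kify weak_hausdorff_subtopology)
qed

lemma is_object_kify_product_topology:
  assumes "finite I" "\<And>i. i \<in> I \<Longrightarrow> is_object C (X i)"
  shows "is_object C (kify (product_topology X I))"
proof (cases C)
  case Set_cat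
  let ?T = "topspace (product_topology X I)"
  have "openin (product_topology X I) {x}" if "x \<in> ?T" for x
  proof -
    have "openin (X i) {x i}" if "i \<in> I" for i
    proof -
      have "X i = discrete_topology (topspace (X i))"
        using assms(2)[OF that] Set_cat by simp
      moreover have "x i \<in> topspace (X i)"
        using \<open>x \<in> ?T\<close> that by auto
      ultimately show ?thesis
        by (metis empty_subsetI insert_subset openin_discrete_topology)
    qed
    then have "openin (product_topology X I) (PiE I (\<lambda>i. {x i}))"
      using assms(1) by (simp add: openin_PiE)
    moreover have "PiE I (\<lambda>i. {x i}) = {x}"
      using that by (intro PiE_singleton) (auto simp: PiE_def)
    ultimately show ?thesis
      by simp
  qed
  then have "discrete_topology ?T = product_topology X I"
    by (simp only: discrete_topology_unique) blast
  then show ?thesis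
    using Set_cat kify_discrete by (metis is_object.simps(1) topspace_discrete_topology)
next
  case CGWH_cat
  then show ?thesis
    using assms by (simp add: kify_kify weak_hausdorff_kify weak_hausdorff_product_topology)
qed

lemma continuous_map_into_kify_subtopology:
  assumes "kify X = X" "weak_hausdorff Y" "continuous_map X Y f" "f \<in> topspace X \<rightarrow> S"
  shows "continuous_map X (kify (subtopology Y S)) f"
  using assms by (simp add: continuous_map_into_kify weak_hausdorff_subtopology
      continuous_map_in_subtopology)

lemma continuous_map_from_kify_subtopology:
  "continuous_map X Y f \<Longrightarrow> continuous_map (kify (subtopology X S)) Y f"
  by (simp add: continuous_map_from_kify continuous_map_from_subtopology)

lemma continuous_map_into_kify_product:
  assumes "kify X = X" "\<And>i. i \<in> I \<Longrightarrow> weak_hausdorff (Y i)"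
    and "\<And>i. i \<in> I \<Longrightarrow> continuous_map X (Y i) (\<lambda>x. f x i)"
    and "\<And>i x. i \<notin> I \<Longrightarrow> x \<in> topspace X \<Longrightarrow> f x i = undefined"
  shows "continuous_map X (kify (product_topology Y I)) f"
  using assms by (intro continuous_map_into_kify weak_hausdorff_product_topology
      continuous_map_coordinatewise_then_product) auto

lemma continuous_map_kify_product_coordinate:
  "i \<in> I \<Longrightarrow> continuous_map (kify (product_topology Y I)) (Y i) (\<lambda>x. x i)"
  by (simp add: continuous_map_from_kify)

lemma continuous_map_kify_prod:
  assumes "weak_hausdorff X'" "weak_hausdorff Y'" "continuous_map X X' f" "continuous_map Y Y' g"
  shows "continuous_map (kify (prod_topology X Y)) (kify (prod_topology X' Y'))
    (\<lambda>p. (f (fst p), g (snd p)))"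
proof (rule continuous_map_into_kify)
  show "kify (kify (prod_topology X Y)) = kify (prod_topology X Y)"
    by (rule kify_kify)
  show "weak_hausdorff (prod_topology X' Y')"
    using assms by (simp add: weak_hausdorff_prod_topology)
  have "continuous_map (prod_topology X Y) X' (f \<circ> fst)"
    "continuous_map (prod_topology X Y) Y' (g \<circ> snd)"
    using assms by (auto intro: continuous_map_compose continuous_map_fst continuous_map_snd)
  then show "continuous_map (kify (prod_topology X Y)) (prod_topology X' Y')
    (\<lambda>p. (f (fst p), g (snd p)))"
    by (intro continuous_map_from_kify) (simp add: continuous_map_paired o_def)
qed

section \<open>Suboperads and coinduced operads\<close>

context operad
begin

lemma lev_weak_hausdorff: "weak_hausdorff (op_lev P n)"
  using lev_object by (rule is_object_weak_hausdorff)

lemma lev_kify: "kify (op_lev P n) = op_lev P n"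
  using lev_object by (rule is_object_kify_eq)

lemma perm_closed: "\<sigma> permutes {1..n} \<Longrightarrow> x \<in> op_set P n \<Longrightarrow> op_perm P n \<sigma> x \<in> op_set P n"
  using continuous_map_funspace[OF perm_continuous] by auto

lemma comp_closed:
  assumes "i \<in> {1..n}" "x \<in> op_set P n" "y \<in> op_set P m"
  shows "op_comp P n m i x y \<in> op_set P (n + m - 1)"
  using continuous_map_funspace[OF comp_continuous[OF assms(1)], of m] assms by (auto simp: Pi_iff)

end

lemma (in g_operad) grp_closed:
  "g \<in> carrier G \<Longrightarrow> x \<in> op_set P n \<Longrightarrow> op_grp P n g x \<in> op_set P n"
  using continuous_map_funspace[OF grp_continuous] by auto

lemma restrict_levels_simps [simp]:
  "op_lev (restrict_levels P S) n = kify (subtopology (op_lev P n) (S n))"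
  "op_perm (restrict_levels P S) = op_perm P"
  "op_unit (restrict_levels P S) = op_unit P"
  "op_comp (restrict_levels P S) = op_comp P"
  "op_grp (restrict_levels P S) = op_grp P"
  by (simp_all add: restrict_levels_def)

text \<open>The algebraic axioms are inherited by any family of subsets that is closed under the operations.
  Continuity is inherited as well, because a continuous map into a subspace remains continuous into
  its refinement.\<close>

lemma g_suboperad_restrict_levels:
  fixes P :: "('x, 'g) g_operad_data"
  assumes P: "g_operad C G P"
    and S: "\<And>n. S n \<subseteq> op_set P n"
    and unit: "op_unit P \<in> S 1"
    and perm: "\<And>n \<sigma> x. \<sigma> permutes {1..n} \<Longrightarrow> x \<in> S n \<Longrightarrow> op_perm P n \<sigma> x \<in> S n"
    and grp: "\<And>n g x. g \<in> carrier G \<Longrightarrow> x \<in> S n \<Longrightarrow> op_grp P n g x \<in> S n"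
    and comp: "\<And>n m i x y. i \<in> {1..n} \<Longrightarrow> x \<in> S n \<Longrightarrow> y \<in> S m
      \<Longrightarrow> op_comp P n m i x y \<in> S (n + m - 1)"
  shows "g_suboperad C G (restrict_levels P S) P"
proof -
  interpret P: g_operad C G P by fact
  let ?Q = "restrict_levels P S"
  have set_Q: "topspace (op_lev P n) \<inter> S n = S n" for n
    using S[of n] by blast
  have mem: "x \<in> op_set P n" if "x \<in> S n" for x n
    using that S by blast
  have into: "continuous_map X (op_lev ?Q n) f"
    if "kify X = X" "continuous_map X (op_lev P n) f" "f \<in> topspace X \<rightarrow> S n" for X f and n :: nat
    using that by (simp add: continuous_map_into_kify_subtopology P.lev_weak_hausdorff)
  have from_Q: "continuous_map (op_lev ?Q n) (op_lev P n) f"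
    if "continuous_map (op_lev P n) (op_lev P n) f" for f and n :: nat
    using that by (simp add: continuous_map_from_kify_subtopology)
  have "g_operad C G ?Q"
  proof (intro g_operad.intro operad.intro g_operad_axioms.intro)
    fix n m i :: nat assume i: "i \<in> {1..n}"
    have "continuous_map (kify (prod_topology (op_lev ?Q n) (op_lev ?Q m)))
        (kify (prod_topology (op_lev P n) (op_lev P m))) (\<lambda>p. (id (fst p), id (snd p)))"
      by (intro continuous_map_kify_prod from_Q P.lev_weak_hausdorff) auto
    from continuous_map_compose[OF this P.comp_continuous[OF i]]
    have "continuous_map (kify (prod_topology (op_lev ?Q n) (op_lev ?Q m)))
        (op_lev P (n + m - 1)) (\<lambda>(x, y). op_comp ?Q n m i x y)"
      by (simp add: o_def case_prod_unfold)
    then show "continuous_map (kify (prod_topology (op_lev ?Q n) (op_lev ?Q m)))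
        (op_lev ?Q (n + m - 1)) (\<lambda>(x, y). op_comp ?Q n m i x y)"
      by (rule into[OF kify_kify]) (use comp[OF i] in \<open>auto simp: set_Q\<close>)
  next
    show "is_object C (op_lev ?Q n)" for n
      using P.lev_object by (simp add: is_object_kify_subtopology)
  next
    show "continuous_map (op_lev ?Q n) (op_lev ?Q n) (op_perm ?Q n \<sigma>)"
      if "\<sigma> permutes {1..n}" for n \<sigma>
      by (rule into) (use that perm P.perm_continuous from_Q in \<open>auto simp: kify_kify set_Q\<close>)
  next
    show "continuous_map (op_lev ?Q n) (op_lev ?Q n) (op_grp ?Q n g)"
      if "g \<in> carrier G" for n g
      by (rule into) (use that grp P.grp_continuous from_Q in \<open>auto simp: kify_kify set_Q\<close>)
  next
    show "group G"
      by (rule P.is_group)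
  qed (simp_all del: One_nat_def atLeastAtMost_iff
      add: set_Q unit mem P.perm_id P.perm_comp P.comp_unit_left P.comp_unit_right
      P.comp_assoc_sequential P.comp_assoc_parallel[symmetric] P.comp_equivariant P.grp_one P.grp_mult
      P.grp_perm P.grp_unit P.grp_comp)
  then show ?thesis
    using P by (simp add: g_suboperad_def set_Q S)
qed

lemma coinduced_simps:
  "op_lev (coinduced G P) n = kify (product_topology (\<lambda>_. op_lev P n) (carrier G))"
  "op_perm (coinduced G P) n \<sigma> f = (\<lambda>h\<in>carrier G. op_perm P n \<sigma> (f h))"
  "op_unit (coinduced G P) = (\<lambda>h\<in>carrier G. op_unit P)"
  "op_comp (coinduced G P) n m i f f' = (\<lambda>h\<in>carrier G. op_comp P n m i (f h) (f' h))"
  "op_grp (coinduced G P) n g f = (\<lambda>h\<in>carrier G. f (inv\<^bsub>G\<^esub> g \<otimes>\<^bsub>G\<^esub> h))"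
  by (simp_all add: coinduced_def)

lemma op_set_coinduced:
  "op_set (coinduced G P) n = carrier G \<rightarrow>\<^sub>E op_set P n"
  by (simp add: coinduced_simps)

lemma g_operad_coinduced:
  fixes G :: "('g, 'b) monoid_scheme"
  assumes P: "operad C P" and G: "group G" "finite (carrier G)"
  shows "g_operad C G (coinduced G P)"
proof -
  interpret P: operad C P by fact
  interpret group G by fact
  let ?N = "coinduced G P"
  have into: "continuous_map X (op_lev ?N n) (\<lambda>x. \<lambda>h\<in>carrier G. f x h)"
    if "kify X = X" "\<And>h. h \<in> carrier G \<Longrightarrow> continuous_map X (op_lev P n) (\<lambda>x. f x h)" for X f and n :: nat
    unfolding coinduced_simps using that
    by (intro continuous_map_into_kify_product P.lev_weak_hausdorff) auto
  have coord: "continuous_map (op_lev ?N n) (op_lev P n) (\<lambda>f. f h)" if "h \<in> carrier G" for h and n :: nat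
    unfolding coinduced_simps using that by (rule continuous_map_kify_product_coordinate)
  have lev: "kify (op_lev ?N n) = op_lev ?N n" for n
    by (simp add: coinduced_simps kify_kify)
  have mem: "f h \<in> op_set P n" if "f \<in> op_set ?N n" "h \<in> carrier G" for f h and n :: nat
    using that unfolding op_set_coinduced by auto
  have ext: "(\<lambda>h\<in>carrier G. f h) = f" if "f \<in> op_set ?N n" for f and n :: nat
    using that unfolding op_set_coinduced by auto
  show ?thesis
  proof (intro g_operad.intro operad.intro g_operad_axioms.intro)
    show "is_object C (op_lev ?N n)" for n
      unfolding coinduced_simps using G(2) P.lev_object by (rule is_object_kify_product_topology)
  next
    fix n and \<sigma> :: "nat \<Rightarrow> nat" assume \<sigma>: "\<sigma> permutes {1..n}"
    have "continuous_map (op_lev ?N n) (op_lev P n) (op_perm P n \<sigma> \<circ> (\<lambda>f. f h))"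
      if "h \<in> carrier G" for h
      using continuous_map_compose coord[OF that] P.perm_continuous[OF \<sigma>] by blast
    then show "continuous_map (op_lev ?N n) (op_lev ?N n) (op_perm ?N n \<sigma>)"
      unfolding coinduced_simps(2)[abs_def] by (intro into lev) (simp add: o_def)
  next
    fix n m i :: nat assume i: "i \<in> {1..n}"
    let ?X = "kify (prod_topology (op_lev ?N n) (op_lev ?N m))"
    have "continuous_map ?X (op_lev P (n + m - 1))
        (\<lambda>p. op_comp P n m i (fst p h) (snd p h))" if "h \<in> carrier G" for h
    proof -
      have "continuous_map ?X (kify (prod_topology (op_lev P n) (op_lev P m)))
          (\<lambda>p. (fst p h, snd p h))"
        by (intro continuous_map_kify_prod P.lev_weak_hausdorff coord that)
      from continuous_map_compose[OF this P.comp_continuous[OF i]] show ?thesis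
        by (simp add: o_def)
    qed
    then show "continuous_map ?X (op_lev ?N (n + m - 1)) (\<lambda>(x, y). op_comp ?N n m i x y)"
      unfolding coinduced_simps(4) case_prod_unfold by (intro into kify_kify)
  next
    fix n :: nat and g assume g: "g \<in> carrier G"
    then show "continuous_map (op_lev ?N n) (op_lev ?N n) (op_grp ?N n g)"
      unfolding coinduced_simps(5)[abs_def] by (intro into lev coord) simp
  next
    show "group G"
      by (rule G)
  next
    show "op_unit ?N \<in> op_set ?N 1"
      using P.unit_closed by (simp add: op_set_coinduced coinduced_simps(3))
  next
    fix n :: nat and x assume x: "x \<in> op_set ?N n"
    show "op_perm ?N n id x = x"
      using x mem[OF x] by (subst ext[OF x, symmetric])
        (auto simp: coinduced_simps(2) P.perm_id cong: restrict_cong)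
    show "op_grp ?N n \<one>\<^bsub>G\<^esub> x = x"
      using x by (subst (2) ext[OF x, symmetric]) (auto simp: coinduced_simps(5) cong: restrict_cong)
    show "op_comp ?N n 1 i x (op_unit ?N) = x" if "i \<in> {1..n}" for i
      using that x mem[OF x] by (subst (2) ext[OF x, symmetric])
        (auto simp: coinduced_simps(3,4) P.comp_unit_right[simplified] cong: restrict_cong)
    show "op_comp ?N 1 n 1 (op_unit ?N) x = x"
      using x mem[OF x] by (subst (2) ext[OF x, symmetric])
        (auto simp: coinduced_simps(3,4) P.comp_unit_left[simplified] cong: restrict_cong)
    show "op_grp ?N n (g \<otimes>\<^bsub>G\<^esub> h) x = op_grp ?N n g (op_grp ?N n h x)"
      if "g \<in> carrier G" "h \<in> carrier G" for g h
      using that by (auto simp: coinduced_simps(5) inv_mult_group m_assoc intro!: restrict_ext)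
  next
    show "op_grp ?N 1 g (op_unit ?N) = op_unit ?N" if "g \<in> carrier G" for g
      using that by (auto simp: coinduced_simps(3,5) intro!: restrict_ext)
  qed (auto simp del: One_nat_def atLeastAtMost_iff simp: coinduced_simps(2,4,5) mem P.perm_comp P.comp_assoc_sequential
      P.comp_assoc_parallel[symmetric] P.comp_equivariant intro!: restrict_ext)
qed

section \<open>Positions in a composite\<close>

text \<open>In a composite \<open>x \<circ>\<^sub>i y\<close> with \<open>y\<close> of arity \<open>m\<close>, the entry \<open>a \<noteq> i\<close> of \<open>x\<close> moves to the place
  \<open>outer_pos m i a\<close>, and the entry \<open>b\<close> of \<open>y\<close> moves to the place \<open>i + b - 1\<close>. Conversely,
  \<open>outer_index m i k\<close> is the entry of \<open>x\<close> that the \<open>k\<close>-th entry of the composite comes from. Describing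
  composites and block permutations by their effect on these places avoids truncated subtraction in
  the proofs of the operad axioms; it also covers \<open>m = 0\<close>, where the entry \<open>i\<close> disappears.\<close>

definition outer_pos :: "nat \<Rightarrow> nat \<Rightarrow> nat \<Rightarrow> nat" where
  "outer_pos m i a = (if a < i then a else a + m - 1)"

definition outer_index :: "nat \<Rightarrow> nat \<Rightarrow> nat \<Rightarrow> nat" where
  "outer_index m i k = (if k < i then k else if k < i + m then i else k + 1 - m)"

lemma outer_pos_range:
  "i \<in> {1..n} \<Longrightarrow> a \<in> {1..n} \<Longrightarrow> a \<noteq> i \<Longrightarrow> outer_pos m i a \<in> {1..n + m - 1}"
  by (auto simp: outer_pos_def)

lemma inner_pos_range: "i \<in> {1..n} \<Longrightarrow> b \<in> {1..m} \<Longrightarrow> i + b - 1 \<in> {1..n + m - 1}" for i n :: nat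
  by auto

text \<open>How the places of entries compose when a second operation is inserted, inside the first one
  or beside it.\<close>

lemma outer_pos_sequential:
  assumes "a \<noteq> i" "1 \<le> i" "j \<in> {1..m}"
  shows "outer_pos p (i - 1 + j) (outer_pos m i a) = outer_pos (m + p - 1) i a"
proof (cases "a < i")
  case False
  then have "\<not> a + m - 1 < i - 1 + j" "a + m - 1 + p - 1 = a + (m + p - 1) - 1"
    using assms by auto
  then show ?thesis
    using False by (simp only: outer_pos_def if_False)
qed (use assms in \<open>auto simp: outer_pos_def\<close>)

lemma outer_pos_sequential_inner:
  assumes "1 \<le> i" "1 \<le> b" "b \<noteq> j"
  shows "outer_pos p (i - 1 + j) (i + b - 1) = i + outer_pos p j b - 1"
proof (cases "b < j")
  case False
  then have "\<not> i + b - 1 < i - 1 + j" "i + b - 1 + p - 1 = i + (b + p - 1) - 1"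
    using assms by auto
  then show ?thesis
    using False by (simp only: outer_pos_def if_False)
qed (use assms in \<open>auto simp: outer_pos_def\<close>)

lemma outer_pos_parallel:
  assumes "a \<noteq> i" "a \<noteq> k" "i < k" "1 \<le> i"
  shows "outer_pos p (k - 1 + m) (outer_pos m i a) = outer_pos m i (outer_pos p k a)"
    and "outer_pos p k a \<noteq> i"
proof -
  consider "a < i" | "i < a" "a < k" | "k < a"
    using assms by linarith
  then have "outer_pos p (k - 1 + m) (outer_pos m i a) = outer_pos m i (outer_pos p k a)
      \<and> outer_pos p k a \<noteq> i"
  proof cases
    case 3
    then have "\<not> a < i" "\<not> a < k" "\<not> a + m - 1 < k - 1 + m" "\<not> a + p - 1 < i"
      "a + m - 1 + p - 1 = a + p - 1 + m - 1" "a + p - 1 \<noteq> i"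
      using assms by auto
    then show ?thesis
      by (simp only: outer_pos_def if_False not_False_eq_True)
  qed (use assms in \<open>auto simp: outer_pos_def\<close>)
  then show "outer_pos p (k - 1 + m) (outer_pos m i a) = outer_pos m i (outer_pos p k a)"
    and "outer_pos p k a \<noteq> i"
    by blast+
qed

lemma outer_index_outer_pos: "a \<noteq> i \<Longrightarrow> outer_index m i (outer_pos m i a) = a"
  by (auto simp: outer_pos_def outer_index_def)

lemma outer_index_inner_pos: "b \<in> {1..m} \<Longrightarrow> outer_index m i (i + b - 1) = i"
  by (auto simp: outer_index_def)

lemma comp_position_cases:
  assumes "i \<in> {1..n}" "k \<in> {1..n + m - 1}"
  obtains (outer) a where "a \<in> {1..n}" "a \<noteq> i" "k = outer_pos m i a"
  | (inner) b where "b \<in> {1..m}" "k = i + b - 1"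
proof -
  consider "k < i" | "i \<le> k" "k < i + m" | "i + m \<le> k"
    by linarith
  then show ?thesis
  proof cases
    case 1
    then show ?thesis
      using assms by (intro outer[of k]) (auto simp: outer_pos_def)
  next
    case 2
    then show ?thesis
      by (intro inner[of "k + 1 - i"]) auto
  next
    case 3
    then show ?thesis
      using assms by (intro outer[of "k + 1 - m"]) (auto simp: outer_pos_def)
  qed
qed

lemma outer_index_range:
  assumes "i \<in> {1..n}" "k \<in> {1..n + m - 1}"
  shows "outer_index m i k \<in> {1..n}"
  using assms by (auto simp: outer_index_def)

lemma outer_index_eqD:
  assumes "i \<in> {1..n}" "k \<in> {1..n + m - 1}" "l \<in> {1..n + m - 1}"
    and "outer_index m i k = outer_index m i l" "outer_index m i k \<noteq> i"
  shows "k = l"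
  using assms by (auto simp: outer_index_def split: if_splits)

lemma outer_index_eq_self:
  assumes "i \<in> {1..n}" "k \<in> {1..n + m - 1}" "outer_index m i k = i"
  obtains b where "b \<in> {1..m}" "k = i + b - 1"
  using assms(1,2) by (rule comp_position_cases) (use assms(3) outer_index_outer_pos that in auto)

lemma block_perm_outer_pos:
  assumes "\<sigma> permutes {1..n}" "i \<in> {1..n}" "a \<in> {1..n}" "a \<noteq> i"
  shows "block_perm n m i \<sigma> \<tau> (outer_pos m i a) = outer_pos m (\<sigma> i) (\<sigma> a)"
  using outer_pos_range[OF assms(2-4), of m] assms(2-4)
  by (auto simp: block_perm_def outer_pos_def Let_def)

lemma block_perm_inner_pos:
  assumes "i \<in> {1..n}" "b \<in> {1..m}"
  shows "block_perm n m i \<sigma> \<tau> (i + b - 1) = \<sigma> i + \<tau> b - 1"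
  using inner_pos_range[OF assms] assms by (auto simp: block_perm_def Let_def)

lemma block_perm_permutes:
  assumes \<sigma>: "\<sigma> permutes {1..n}" and \<tau>: "\<tau> permutes {1..m}" and i: "i \<in> {1..n}"
  shows "block_perm n m i \<sigma> \<tau> permutes {1..n + m - 1}"
proof (rule bij_imp_permutes)
  let ?\<rho> = "block_perm n m i \<sigma> \<tau>" and ?N = "{1..n + m - 1}"
  have \<sigma>i: "\<sigma> i \<in> {1..n}"
    using \<sigma> i by (simp only: permutes_in_image)
  have \<sigma>a: "\<sigma> a \<in> {1..n}" "\<sigma> a \<noteq> \<sigma> i" if "a \<in> {1..n}" "a \<noteq> i" for a
    using that \<sigma> permutes_inj[OF \<sigma>] by (simp_all only: permutes_in_image inj_eq not_False_eq_True)
  have \<tau>b: "\<tau> b \<in> {1..m}" if "b \<in> {1..m}" for b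
    using that \<tau> by (simp only: permutes_in_image)
  have "?\<rho> ` ?N \<subseteq> ?N"
  proof clarify
    fix k assume "k \<in> ?N"
    with i show "?\<rho> k \<in> ?N"
    proof (cases rule: comp_position_cases)
      case (outer a)
      then show ?thesis
        using block_perm_outer_pos[OF \<sigma> i] outer_pos_range[OF \<sigma>i] \<sigma>a by metis
    next
      case (inner b)
      then show ?thesis
        using block_perm_inner_pos[OF i] inner_pos_range[OF \<sigma>i] \<tau>b by metis
    qed
  qed
  moreover have "inj_on ?\<rho> ?N"
  proof (rule inj_onI)
    fix k l assume k: "k \<in> ?N" and l: "l \<in> ?N" and eq: "?\<rho> k = ?\<rho> l"
    have outer: "outer_index m (\<sigma> i) (?\<rho> (outer_pos m i a)) = \<sigma> a" if "a \<in> {1..n}" "a \<noteq> i" for a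
      using block_perm_outer_pos[OF \<sigma> i that] outer_index_outer_pos \<sigma>a[OF that] by metis
    have inner: "outer_index m (\<sigma> i) (?\<rho> (i + b - 1)) = \<sigma> i" if "b \<in> {1..m}" for b
      using block_perm_inner_pos[OF i that] outer_index_inner_pos \<tau>b[OF that] by metis
    from i k show "k = l"
    proof (cases rule: comp_position_cases)
      case (outer a)
      note a = this
      from i l show ?thesis
      proof (cases rule: comp_position_cases)
        case (outer a')
        then have "\<sigma> a = \<sigma> a'"
          using a eq \<open>\<And>a. a \<in> {1..n} \<Longrightarrow> a \<noteq> i \<Longrightarrow> _ = \<sigma> a\<close> by metis
        then show ?thesis
          using a outer permutes_inj[OF \<sigma>] by (simp add: inj_eq)
      next
        case (inner b)
        then have "\<sigma> a = \<sigma> i"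
          using a eq \<open>\<And>a. a \<in> {1..n} \<Longrightarrow> a \<noteq> i \<Longrightarrow> _ = \<sigma> a\<close>
            \<open>\<And>b. b \<in> {1..m} \<Longrightarrow> _ = \<sigma> i\<close> by metis
        then show ?thesis
          using a \<sigma>a by blast
      qed
    next
      case (inner b)
      note b = this
      from i l show ?thesis
      proof (cases rule: comp_position_cases)
        case (outer a)
        then have "\<sigma> a = \<sigma> i"
          using b eq \<open>\<And>a. a \<in> {1..n} \<Longrightarrow> a \<noteq> i \<Longrightarrow> _ = \<sigma> a\<close>
            \<open>\<And>b. b \<in> {1..m} \<Longrightarrow> _ = \<sigma> i\<close> by metis
        then show ?thesis
          using outer \<sigma>a by blast
      next
        case (inner b')
        then have "\<sigma> i + \<tau> b - 1 = \<sigma> i + \<tau> b' - 1"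
          using b eq block_perm_inner_pos[OF i] by metis
        then have "\<tau> b = \<tau> b'"
          using \<sigma>i \<tau>b[OF b(1)] \<tau>b[OF inner(1)] unfolding atLeastAtMost_iff by linarith
        then show ?thesis
          using b inner permutes_inj[OF \<tau>] by (simp add: inj_eq)
      qed
    qed
  qed
  ultimately show "bij_betw ?\<rho> ?N ?N"
    by (simp add: bij_betw_def endo_inj_surj)
qed (auto simp: block_perm_def)

section \<open>The operad of functions into a monoid\<close>

locale imonoid_group = G: group G + M: intersection_monoid C M
  for C :: ground and G :: "('g, 'b) monoid_scheme" and M :: "('m, 'z) imonoid_scheme" +
  assumes finite_G: "finite (carrier G)"
begin

abbreviation \<O> :: "('g \<times> nat \<Rightarrow> 'm, 'g) g_operad_data" where
  "\<O> \<equiv> O_operad G M"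

lemma O_lev: "op_lev \<O> n = kify (product_topology (\<lambda>_. mtop M) (carrier G \<times> {1..n}))"
  by (simp add: O_operad_def)

lemma O_set: "op_set \<O> n = carrier G \<times> {1..n} \<rightarrow>\<^sub>E carrier M"
  by (simp add: O_lev M.topspace_mtop)

lemma O_mem: "x \<in> op_set \<O> n \<Longrightarrow> g \<in> carrier G \<Longrightarrow> i \<in> {1..n} \<Longrightarrow> x (g, i) \<in> carrier M"
  by (auto simp: O_set PiE_iff)

lemma O_unit: "g \<in> carrier G \<Longrightarrow> op_unit \<O> (g, 1) = \<one>\<^bsub>M\<^esub>"
  by (simp add: O_operad_def)

lemma O_perm_apply:
  "g \<in> carrier G \<Longrightarrow> i \<in> {1..n} \<Longrightarrow> op_perm \<O> n \<sigma> x (g, i) = x (g, inv_into UNIV \<sigma> i)"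
  by (simp add: O_operad_def)

lemma O_perm_apply_image:
  assumes "\<sigma> permutes {1..n}" "g \<in> carrier G" "i \<in> {1..n}"
  shows "op_perm \<O> n \<sigma> x (g, \<sigma> i) = x (g, i)"
  using O_perm_apply[of g "\<sigma> i" n \<sigma> x] assms permutes_in_image[OF assms(1)]
    permutes_inverses(2)[OF assms(1)] by simp

lemma O_grp_apply:
  "h \<in> carrier G \<Longrightarrow> i \<in> {1..n} \<Longrightarrow> op_grp \<O> n g x (h, i) = x (inv\<^bsub>G\<^esub> g \<otimes>\<^bsub>G\<^esub> h, i)"
  by (simp add: O_operad_def)

lemma O_comp_outer:
  assumes "g \<in> carrier G" "i \<in> {1..n}" "a \<in> {1..n}" "a \<noteq> i"
  shows "op_comp \<O> n m i x y (g, outer_pos m i a) = x (g, a)"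
proof -
  have "op_comp \<O> n m i x y (g, outer_pos m i a)
    = (let k = outer_pos m i a in if k < i then x (g, k)
        else if k < i + m then x (g, i) \<otimes>\<^bsub>M\<^esub> y (g, k + 1 - i) else x (g, k + 1 - m))"
    using outer_pos_range[OF assms(2-4), of m] assms(1) by (simp add: O_operad_def)
  then show ?thesis
    using assms by (auto simp: outer_pos_def Let_def)
qed

lemma O_comp_inner:
  assumes "g \<in> carrier G" "i \<in> {1..n}" "b \<in> {1..m}"
  shows "op_comp \<O> n m i x y (g, i + b - 1) = x (g, i) \<otimes>\<^bsub>M\<^esub> y (g, b)"
proof -
  have "op_comp \<O> n m i x y (g, i + b - 1)
    = (let k = i + b - 1 in if k < i then x (g, k)
        else if k < i + m then x (g, i) \<otimes>\<^bsub>M\<^esub> y (g, k + 1 - i) else x (g, k + 1 - m))"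
    using inner_pos_range[OF assms(2,3)] assms(1) by (simp add: O_operad_def)
  then show ?thesis
    using assms by (auto simp: Let_def)
qed

lemma O_unit_closed: "op_unit \<O> \<in> op_set \<O> 1"
  by (simp add: O_set) (simp add: O_operad_def)

lemma O_perm_closed:
  assumes "\<sigma> permutes {1..n}" "x \<in> op_set \<O> n"
  shows "op_perm \<O> n \<sigma> x \<in> op_set \<O> n"
  using assms O_mem[OF assms(2)] permutes_in_image[OF permutes_inv[OF assms(1)]]
  unfolding O_set by (auto simp: O_operad_def)

lemma O_grp_closed:
  assumes "g \<in> carrier G" "x \<in> op_set \<O> n"
  shows "op_grp \<O> n g x \<in> op_set \<O> n"
  using assms O_mem[OF assms(2)] unfolding O_set by (auto simp: O_operad_def)

lemma O_comp_closed:
  assumes i: "i \<in> {1..n}" and x: "x \<in> op_set \<O> n" and y: "y \<in> op_set \<O> m"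
  shows "op_comp \<O> n m i x y \<in> op_set \<O> (n + m - 1)"
  unfolding O_set
proof (rule PiE_I)
  fix q assume "q \<in> carrier G \<times> {1..n + m - 1}"
  then obtain g k where q: "q = (g, k)" and g: "g \<in> carrier G" and k: "k \<in> {1..n + m - 1}"
    by auto
  from i k show "op_comp \<O> n m i x y q \<in> carrier M"
  proof (cases rule: comp_position_cases)
    case (outer a)
    then show ?thesis
      using q g i x O_mem by (simp only: not_False_eq_True O_comp_outer)
  next
    case (inner b)
    then show ?thesis
      using q g i x y O_mem M.m_closed by (simp only: O_comp_inner)
  qed
qed (auto simp: O_operad_def)

lemma O_eqI:
  assumes "x \<in> op_set \<O> n" "y \<in> op_set \<O> n"
    and "\<And>g i. g \<in> carrier G \<Longrightarrow> i \<in> {1..n} \<Longrightarrow> x (g, i) = y (g, i)"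
  shows "x = y"
  using assms unfolding O_set by (intro PiE_ext) auto

lemma O_comp_assoc_sequential:
  assumes i: "i \<in> {1..n}" and j: "j \<in> {1..m}"
    and x: "x \<in> op_set \<O> n" and y: "y \<in> op_set \<O> m" and z: "z \<in> op_set \<O> p"
  shows "op_comp \<O> (n + m - 1) p (i - 1 + j) (op_comp \<O> n m i x y) z
    = op_comp \<O> n (m + p - 1) i x (op_comp \<O> m p j y z)" (is "?l = ?r")
proof (rule O_eqI)
  have ij: "i - 1 + j \<in> {1..n + m - 1}"
    using i j by auto
  have N: "n + m - 1 + p - 1 = n + (m + p - 1) - 1"
    using i j by auto
  show "?l \<in> op_set \<O> (n + m - 1 + p - 1)"
    by (intro O_comp_closed ij i x y z)
  show "?r \<in> op_set \<O> (n + m - 1 + p - 1)"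
    unfolding N by (intro O_comp_closed i j x y z)
  fix g k assume g: "g \<in> carrier G" and kN: "k \<in> {1..n + m - 1 + p - 1}"
  from ij kN show "?l (g, k) = ?r (g, k)"
  proof (cases rule: comp_position_cases)
    case (outer a)
    note a = this
    from i a(1) show ?thesis
    proof (cases rule: comp_position_cases)
      case (outer a')
      then have k: "k = outer_pos (m + p - 1) i a'"
        using a i j outer_pos_sequential[of a' i j m p] by simp
      have "?l (g, k) = x (g, a')"
        using a outer g i ij by (simp only: not_False_eq_True O_comp_outer)
      also have "\<dots> = ?r (g, k)"
        using k outer g i by (simp only: not_False_eq_True O_comp_outer)
      finally show ?thesis .
    next
      case (inner b)
      then have b: "b \<noteq> j"
        using a i by auto
      have k: "k = i + outer_pos p j b - 1"
        using a i j inner b outer_pos_sequential_inner[of i b j p] by simp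
      have "?l (g, k) = x (g, i) \<otimes>\<^bsub>M\<^esub> y (g, b)"
        using a inner g i ij by (simp only: not_False_eq_True O_comp_outer O_comp_inner)
      also have "\<dots> = ?r (g, k)"
        using k inner(1) b g i j outer_pos_range[OF j inner(1) b]
        by (simp only: not_False_eq_True O_comp_inner O_comp_outer)
      finally show ?thesis .
    qed
  next
    case (inner c)
    have k: "k = i + (j + c - 1) - 1"
      using inner i j by auto
    have "i - 1 + j = i + j - 1"
      using i by auto
    then have xy: "op_comp \<O> n m i x y (g, i - 1 + j) = x (g, i) \<otimes>\<^bsub>M\<^esub> y (g, j)"
      using g i j by (simp only: O_comp_inner)
    have "?l (g, k) = x (g, i) \<otimes>\<^bsub>M\<^esub> y (g, j) \<otimes>\<^bsub>M\<^esub> z (g, c)"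
      using inner g ij by (simp only: O_comp_inner xy)
    also have "\<dots> = x (g, i) \<otimes>\<^bsub>M\<^esub> (y (g, j) \<otimes>\<^bsub>M\<^esub> z (g, c))"
      using inner g i j x y z O_mem by (simp only: M.m_assoc)
    also have "\<dots> = ?r (g, k)"
      using k inner(1) g i j inner_pos_range[OF j inner(1)] by (simp only: O_comp_inner)
    finally show ?thesis .
  qed
qed

lemma O_comp_assoc_parallel:
  assumes i: "i \<in> {1..n}" and k: "k \<in> {1..n}" and ik: "i < k"
    and x: "x \<in> op_set \<O> n" and y: "y \<in> op_set \<O> m" and z: "z \<in> op_set \<O> p"
  shows "op_comp \<O> (n + m - 1) p (k - 1 + m) (op_comp \<O> n m i x y) z
    = op_comp \<O> (n + p - 1) m i (op_comp \<O> n p k x z) y" (is "?l = ?r")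
proof (rule O_eqI)
  have k': "k - 1 + m = outer_pos m i k" "outer_pos m i k \<in> {1..n + m - 1}"
    using ik k outer_pos_range[OF i k] by (auto simp: outer_pos_def)
  have i': "i = outer_pos p k i" "i \<in> {1..n + p - 1}"
    using ik k i by (auto simp: outer_pos_def)
  have N: "n + m - 1 + p - 1 = n + p - 1 + m - 1"
    using i by auto
  show "?l \<in> op_set \<O> (n + m - 1 + p - 1)"
    unfolding k'(1) by (intro O_comp_closed k' i x y z)
  show "?r \<in> op_set \<O> (n + m - 1 + p - 1)"
    unfolding N by (intro O_comp_closed k i i' x y z)
  have xz_i: "op_comp \<O> n p k x z (g, i) = x (g, i)" if "g \<in> carrier G" for g
    using O_comp_outer[OF that k i, of p x z] ik i'(1) by simp
  have xy_k: "op_comp \<O> n m i x y (g, outer_pos m i k) = x (g, k)" if "g \<in> carrier G" for g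
    using O_comp_outer[OF that i k, of m x y] ik by simp
  fix g l assume g: "g \<in> carrier G" and lN: "l \<in> {1..n + m - 1 + p - 1}"
  from k'(2) lN show "?l (g, l) = ?r (g, l)"
  proof (cases rule: comp_position_cases)
    case (outer a)
    note a = this
    from i a(1) show ?thesis
    proof (cases rule: comp_position_cases)
      case (outer a')
      have a': "a' \<noteq> k"
        using a outer by auto
      have l: "l = outer_pos m i (outer_pos p k a')" "outer_pos p k a' \<noteq> i"
        using a outer ik i a' outer_pos_parallel(1)[of a' i k p m, unfolded k'(1)]
          outer_pos_parallel(2)[of a' i k p] by simp_all
      have "?l (g, l) = x (g, a')"
        using a outer g i k'(2) unfolding k'(1) by (simp only: not_False_eq_True O_comp_outer)
      also have "\<dots> = ?r (g, l)"
        using l outer a' g i'(2) k outer_pos_range[OF k outer(1) a'] by (simp only: not_False_eq_True O_comp_outer)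
      finally show ?thesis .
    next
      case (inner b)
      have l: "l = i + b - 1"
        using a inner ik by (auto simp: outer_pos_def)
      have "?l (g, l) = x (g, i) \<otimes>\<^bsub>M\<^esub> y (g, b)"
        using a inner g i k'(2) unfolding k'(1) by (simp only: not_False_eq_True O_comp_outer O_comp_inner)
      also have "\<dots> = ?r (g, l)"
        using l inner g i'(2) by (simp only: O_comp_inner xz_i)
      finally show ?thesis .
    qed
  next
    case (inner c)
    have l: "l = outer_pos m i (k + c - 1)" "k + c - 1 \<noteq> i"
      using inner ik by (auto simp: outer_pos_def)
    have "?l (g, l) = x (g, k) \<otimes>\<^bsub>M\<^esub> z (g, c)"
      using inner g k'(2) unfolding k'(1) by (simp only: O_comp_inner xy_k)
    also have "\<dots> = ?r (g, l)"
      using l inner g i'(2) k inner_pos_range[OF k inner(1)]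
      by (simp only: not_False_eq_True O_comp_outer O_comp_inner)
    finally show ?thesis .
  qed
qed

lemma O_comp_equivariant:
  assumes i: "i \<in> {1..n}" and \<sigma>: "\<sigma> permutes {1..n}" and \<tau>: "\<tau> permutes {1..m}"
    and x: "x \<in> op_set \<O> n" and y: "y \<in> op_set \<O> m"
  shows "op_perm \<O> (n + m - 1) (block_perm n m i \<sigma> \<tau>) (op_comp \<O> n m i x y)
    = op_comp \<O> n m (\<sigma> i) (op_perm \<O> n \<sigma> x) (op_perm \<O> m \<tau> y)" (is "?l = ?r")
proof (rule O_eqI)
  let ?\<rho> = "block_perm n m i \<sigma> \<tau>"
  have \<rho>: "?\<rho> permutes {1..n + m - 1}"
    using \<sigma> \<tau> i by (rule block_perm_permutes)
  have \<sigma>i: "\<sigma> i \<in> {1..n}"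
    using \<sigma> i by (simp only: permutes_in_image)
  show "?l \<in> op_set \<O> (n + m - 1)" "?r \<in> op_set \<O> (n + m - 1)"
    by (intro O_comp_closed O_perm_closed \<rho> \<sigma> \<tau> i \<sigma>i x y)+
  fix g k assume g: "g \<in> carrier G" and "k \<in> {1..n + m - 1}"
  then obtain l where k: "k = ?\<rho> l" and l: "l \<in> {1..n + m - 1}"
    using permutes_image[OF \<rho>] by blast
  have "?l (g, k) = op_comp \<O> n m i x y (g, l)"
    using k g l \<rho> by (simp only: O_perm_apply_image)
  also have "\<dots> = ?r (g, k)"
    using i l
  proof (cases rule: comp_position_cases)
    case (outer a)
    have a: "\<sigma> a \<in> {1..n}" "\<sigma> a \<noteq> \<sigma> i"
      using outer \<sigma> permutes_inj[OF \<sigma>] by (simp_all only: permutes_in_image inj_eq not_False_eq_True)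
    have "k = outer_pos m (\<sigma> i) (\<sigma> a)"
      using outer k i \<sigma> by (simp only: not_False_eq_True block_perm_outer_pos)
    then show ?thesis
      using outer g i \<sigma>i a \<sigma> by (simp only: not_False_eq_True O_comp_outer O_perm_apply_image)
  next
    case (inner b)
    have "\<tau> b \<in> {1..m}"
      using inner \<tau> by (simp only: permutes_in_image)
    moreover have "k = \<sigma> i + \<tau> b - 1"
      using inner k i by (simp only: block_perm_inner_pos)
    ultimately show ?thesis
      using inner g i \<sigma>i \<sigma> \<tau> by (simp only: O_comp_inner O_perm_apply_image)
  qed
  finally show "?l (g, k) = ?r (g, k)" .
qed

lemma mtop_weak_hausdorff: "weak_hausdorff (mtop M)"
  using M.mtop_object by (rule is_object_weak_hausdorff)

lemma O_lev_kify: "kify (op_lev \<O> n) = op_lev \<O> n"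
  by (simp add: O_lev kify_kify)

lemma O_coordinate:
  "g \<in> carrier G \<Longrightarrow> i \<in> {1..n} \<Longrightarrow> continuous_map (op_lev \<O> n) (mtop M) (\<lambda>x. x (g, i))"
  unfolding O_lev by (rule continuous_map_kify_product_coordinate) simp

lemma continuous_map_into_O:
  assumes "kify X = X" "f \<in> topspace X \<rightarrow> op_set \<O> n"
    and "\<And>g i. g \<in> carrier G \<Longrightarrow> i \<in> {1..n} \<Longrightarrow> continuous_map X (mtop M) (\<lambda>x. f x (g, i))"
  shows "continuous_map X (op_lev \<O> n) f"
  unfolding O_lev
proof (rule continuous_map_into_kify_product)
  show "f x q = undefined" if "q \<notin> carrier G \<times> {1..n}" "x \<in> topspace X" for q x
  proof -
    have "f x \<in> carrier G \<times> {1..n} \<rightarrow>\<^sub>E carrier M"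
      using that(2) assms(2) unfolding O_set by blast
    then show ?thesis
      using that(1) by (rule PiE_arb)
  qed
qed (use assms mtop_weak_hausdorff in auto)

lemma O_comp_continuous:
  assumes i: "i \<in> {1..n}"
  shows "continuous_map (kify (prod_topology (op_lev \<O> n) (op_lev \<O> m)))
    (op_lev \<O> (n + m - 1)) (\<lambda>(x, y). op_comp \<O> n m i x y)"
proof (rule continuous_map_into_O[OF kify_kify])
  let ?X = "kify (prod_topology (op_lev \<O> n) (op_lev \<O> m))"
  show "(\<lambda>(x, y). op_comp \<O> n m i x y) \<in> topspace ?X \<rightarrow> op_set \<O> (n + m - 1)"
    using O_comp_closed[OF i] by auto
  fix g k assume g: "g \<in> carrier G" and k: "k \<in> {1..n + m - 1}"
  from i k show "continuous_map ?X (mtop M) (\<lambda>p. (case p of (x, y) \<Rightarrow> op_comp \<O> n m i x y) (g, k))"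
  proof (cases rule: comp_position_cases)
    case (outer a)
    have "continuous_map ?X (mtop M) ((\<lambda>x. x (g, a)) \<circ> fst)"
      by (intro continuous_map_from_kify continuous_map_compose[OF continuous_map_fst O_coordinate]
          g outer)
    then show ?thesis
      using outer g i by (simp only: not_False_eq_True o_def case_prod_unfold O_comp_outer)
  next
    case (inner b)
    have "continuous_map ?X (kify (prod_topology (mtop M) (mtop M)))
        (\<lambda>p. (fst p (g, i), snd p (g, b)))"
      by (intro continuous_map_kify_prod mtop_weak_hausdorff O_coordinate g i inner)
    from continuous_map_compose[OF this M.mult_continuous] show ?thesis
      using inner g i by (simp only: o_def case_prod_unfold O_comp_inner fst_conv snd_conv)
  qed
qed

lemma g_operad_O: "g_operad C G \<O>"
proof (intro g_operad.intro operad.intro g_operad_axioms.intro)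
  show "is_object C (op_lev \<O> n)" for n
    unfolding O_lev using finite_G M.mtop_object by (intro is_object_kify_product_topology) auto
next
  fix n and \<sigma> :: "nat \<Rightarrow> nat" assume \<sigma>: "\<sigma> permutes {1..n}"
  show "continuous_map (op_lev \<O> n) (op_lev \<O> n) (op_perm \<O> n \<sigma>)"
    by (rule continuous_map_into_O[OF O_lev_kify])
      (use \<sigma> O_perm_closed permutes_in_image[OF permutes_inv[OF \<sigma>]] in
        \<open>auto simp only: O_perm_apply intro!: O_coordinate\<close>)
next
  fix n :: nat and g assume g: "g \<in> carrier G"
  show "continuous_map (op_lev \<O> n) (op_lev \<O> n) (op_grp \<O> n g)"
    by (rule continuous_map_into_O[OF O_lev_kify])
      (use g O_grp_closed in \<open>auto simp only: O_grp_apply intro!: O_coordinate G.m_closed G.inv_closed\<close>)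
next
  show "op_perm \<O> n id x = x" if "x \<in> op_set \<O> n" for n x
    by (rule O_eqI[OF O_perm_closed that]) (use that in \<open>simp_all add: permutes_id O_perm_apply\<close>)
next
  fix n \<sigma> \<tau> x
  assume \<sigma>: "\<sigma> permutes {1..n}" and \<tau>: "\<tau> permutes {1..n}" and x: "x \<in> op_set \<O> n"
  show "op_perm \<O> n (\<sigma> \<circ> \<tau>) x = op_perm \<O> n \<sigma> (op_perm \<O> n \<tau> x)" (is "?l = ?r")
  proof (rule O_eqI)
    have \<sigma>\<tau>: "\<sigma> \<circ> \<tau> permutes {1..n}"
      using \<tau> \<sigma> by (rule permutes_compose)
    show "?l \<in> op_set \<O> n" "?r \<in> op_set \<O> n"
      by (intro O_perm_closed \<sigma>\<tau> \<sigma> \<tau> x)+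
    fix g k assume g: "g \<in> carrier G" and "k \<in> {1..n}"
    then obtain l where k: "k = (\<sigma> \<circ> \<tau>) l" and l: "l \<in> {1..n}"
      using permutes_image[OF \<sigma>\<tau>] by blast
    have "\<tau> l \<in> {1..n}"
      using l \<tau> by (simp only: permutes_in_image)
    then have "?r (g, k) = x (g, l)"
      unfolding k o_apply using g l \<sigma> \<tau> by (simp only: O_perm_apply_image)
    then show "?l (g, k) = ?r (g, k)"
      unfolding k using g l \<sigma>\<tau> by (simp only: O_perm_apply_image)
  qed
next
  fix m y assume y: "y \<in> op_set \<O> m"
  have "op_comp \<O> 1 m 1 (op_unit \<O>) y (g, k) = y (g, k)" if "g \<in> carrier G" "k \<in> {1..m}" for g k
    using O_comp_inner[of g 1 1 k m "op_unit \<O>" y] that O_unit O_mem[OF y that] by simp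
  then show "op_comp \<O> 1 m 1 (op_unit \<O>) y = y"
    using O_comp_closed[OF _ O_unit_closed y, of 1] y by (intro O_eqI[of _ m]) auto
next
  fix n i x assume i: "i \<in> {1..n}" and x: "x \<in> op_set \<O> n"
  have "op_comp \<O> n 1 i x (op_unit \<O>) (g, k) = x (g, k)" if "g \<in> carrier G" "k \<in> {1..n}" for g k
  proof (cases "k = i")
    case True
    then show ?thesis
      using O_comp_inner[of g i n 1 1 x "op_unit \<O>"] that i O_unit O_mem[OF x that] by simp
  next
    case False
    then show ?thesis
      using O_comp_outer[of g i n k 1 x "op_unit \<O>"] that i by (simp add: outer_pos_def split: if_splits)
  qed
  then show "op_comp \<O> n 1 i x (op_unit \<O>) = x"
    using O_comp_closed[OF i x O_unit_closed] x by (intro O_eqI[of _ n]) auto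
next
  show "op_grp \<O> n \<one>\<^bsub>G\<^esub> x = x" if "x \<in> op_set \<O> n" for n x
    by (rule O_eqI[OF O_grp_closed that]) (use that in \<open>simp_all add: O_grp_apply\<close>)
next
  fix g h n x assume g: "g \<in> carrier G" and h: "h \<in> carrier G" and x: "x \<in> op_set \<O> n"
  show "op_grp \<O> n (g \<otimes>\<^bsub>G\<^esub> h) x = op_grp \<O> n g (op_grp \<O> n h x)"
    by (rule O_eqI[of _ n])
      (use g h x in \<open>simp_all del: atLeastAtMost_iff
        add: O_grp_closed O_grp_apply G.inv_mult_group G.m_assoc\<close>)
next
  fix g \<sigma> n x assume g: "g \<in> carrier G" and \<sigma>: "\<sigma> permutes {1..n}" and x: "x \<in> op_set \<O> n"
  show "op_grp \<O> n g (op_perm \<O> n \<sigma> x) = op_perm \<O> n \<sigma> (op_grp \<O> n g x)"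
    by (rule O_eqI[of _ n])
      (use g \<sigma> x permutes_in_image[OF permutes_inv[OF \<sigma>]] in \<open>simp_all del: atLeastAtMost_iff
        add: O_grp_closed O_perm_closed O_grp_apply O_perm_apply\<close>)
next
  fix g assume g: "g \<in> carrier G"
  show "op_grp \<O> 1 g (op_unit \<O>) = op_unit \<O>"
  proof (rule O_eqI)
    show "op_grp \<O> 1 g (op_unit \<O>) (h, i) = op_unit \<O> (h, i)" if "h \<in> carrier G" "i \<in> {1..1}" for h i
      using that g O_unit by (simp add: O_grp_apply)
  qed (intro O_grp_closed O_unit_closed g)+
next
  fix g i n m x y
  assume g: "g \<in> carrier G" and i: "i \<in> {1..n}" and x: "x \<in> op_set \<O> n" and y: "y \<in> op_set \<O> m"
  show "op_grp \<O> (n + m - 1) g (op_comp \<O> n m i x y)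
    = op_comp \<O> n m i (op_grp \<O> n g x) (op_grp \<O> m g y)" (is "?l = ?r")
  proof (rule O_eqI)
    show "?l \<in> op_set \<O> (n + m - 1)" "?r \<in> op_set \<O> (n + m - 1)"
      by (intro O_grp_closed O_comp_closed g i x y)+
    fix h k assume h: "h \<in> carrier G" and k: "k \<in> {1..n + m - 1}"
    have gh: "inv\<^bsub>G\<^esub> g \<otimes>\<^bsub>G\<^esub> h \<in> carrier G"
      using g h by simp
    have "?l (h, k) = op_comp \<O> n m i x y (inv\<^bsub>G\<^esub> g \<otimes>\<^bsub>G\<^esub> h, k)"
      using h k by (rule O_grp_apply)
    also have "\<dots> = ?r (h, k)"
      using i k
    proof (cases rule: comp_position_cases)
      case (outer a)
      then show ?thesis
        using h gh i by (simp only: not_False_eq_True O_comp_outer O_grp_apply)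
    next
      case (inner b)
      then show ?thesis
        using h gh i by (simp only: O_comp_inner O_grp_apply)
    qed
    finally show "?l (h, k) = ?r (h, k)" .
  qed
qed (use O_unit_closed O_comp_continuous O_comp_assoc_sequential O_comp_assoc_parallel
    O_comp_equivariant G.is_group in auto)

end

section \<open>Disjoint entries and strict columns\<close>

context imonoid_group
begin

abbreviation \<R> :: "('g \<times> nat \<Rightarrow> 'm, 'g) g_operad_data" where
  "\<R> \<equiv> R_operad G M"

lemma R_set:
  "op_set \<R> n = {x \<in> op_set \<O> n. sigma_disjoint G M n x \<and> strict_columns G M n x}"
  by (auto simp: R_operad_def)

lemma R_imp_O: "x \<in> op_set \<R> n \<Longrightarrow> x \<in> op_set \<O> n"
  by (simp add: R_set)

lemma R_sigma_disjointD:
  "x \<in> op_set \<R> n \<Longrightarrow> meets M (x (g, i)) (x (g, j)) \<Longrightarrow> g \<in> carrier G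
    \<Longrightarrow> i \<in> {1..n} \<Longrightarrow> j \<in> {1..n} \<Longrightarrow> i = j"
  unfolding R_set sigma_disjoint_def by blast

lemma R_strict_columnsD:
  "x \<in> op_set \<R> n \<Longrightarrow> meets M (x (g, i)) (x (h, i)) \<Longrightarrow> g \<in> carrier G \<Longrightarrow> h \<in> carrier G
    \<Longrightarrow> i \<in> {1..n} \<Longrightarrow> x (g, i) = x (h, i)"
  unfolding R_set strict_columns_def by blast

text \<open>Every entry of \<open>x \<circ>\<^sub>i y\<close> is a right multiple of the entry of \<open>x\<close> that it comes from, so meeting
  entries of the composite come from meeting entries of \<open>x\<close>.\<close>

lemma comp_meets_outer:
  assumes i: "i \<in> {1..n}" and x: "x \<in> op_set \<O> n" and y: "y \<in> op_set \<O> m"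
    and g: "g \<in> carrier G" "h \<in> carrier G" and k: "k \<in> {1..n + m - 1}" "l \<in> {1..n + m - 1}"
    and meets: "meets M (op_comp \<O> n m i x y (g, k)) (op_comp \<O> n m i x y (h, l))"
  shows "meets M (x (g, outer_index m i k)) (x (h, outer_index m i l))"
proof -
  have factor: "\<exists>w\<in>carrier M. op_comp \<O> n m i x y (g, k) = x (g, outer_index m i k) \<otimes>\<^bsub>M\<^esub> w"
    if "g \<in> carrier G" "k \<in> {1..n + m - 1}" for g k
    using i that(2)
  proof (cases rule: comp_position_cases)
    case (outer a)
    then show ?thesis
      using that(1) i O_mem[OF x that(1) outer(1)]
      by (intro bexI[of _ "\<one>\<^bsub>M\<^esub>"])
        (simp_all only: O_comp_outer outer_index_outer_pos M.r_one M.one_closed not_False_eq_True)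
  next
    case (inner b)
    then show ?thesis
      using that(1) i O_mem[OF y that(1) inner(1)]
      by (intro bexI[of _ "y (g, b)"]) (simp_all only: O_comp_inner outer_index_inner_pos)
  qed
  obtain v w where "v \<in> carrier M" "w \<in> carrier M"
    "op_comp \<O> n m i x y (g, k) = x (g, outer_index m i k) \<otimes>\<^bsub>M\<^esub> v"
    "op_comp \<O> n m i x y (h, l) = x (h, outer_index m i l) \<otimes>\<^bsub>M\<^esub> w"
    using factor[OF g(1) k(1)] factor[OF g(2) k(2)] by blast
  moreover have "x (g, outer_index m i k) \<in> carrier M" "x (h, outer_index m i l) \<in> carrier M"
    using O_mem x g k outer_index_range[OF i] by blast+
  ultimately show ?thesis
    using meets M.meets_prefix by metis
qed

text \<open>In the inserted block, the common value of \<open>x\<close> is a left factor of both entries, and can be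
  cancelled.\<close>

lemma comp_meets_inner:
  assumes i: "i \<in> {1..n}" and x: "x \<in> op_set \<O> n" and y: "y \<in> op_set \<O> m"
    and g: "g \<in> carrier G" "h \<in> carrier G" and b: "b \<in> {1..m}" "c \<in> {1..m}"
    and eq: "x (g, i) = x (h, i)"
    and meets: "meets M (op_comp \<O> n m i x y (g, i + b - 1)) (op_comp \<O> n m i x y (h, i + c - 1))"
  shows "meets M (y (g, b)) (y (h, c))"
proof (rule M.meets_cancel)
  show "meets M (x (h, i) \<otimes>\<^bsub>M\<^esub> y (g, b)) (x (h, i) \<otimes>\<^bsub>M\<^esub> y (h, c))"
    using meets eq g b i by (simp only: O_comp_inner)
qed (use O_mem x y g b i in blast)+

text \<open>If two entries of a composite meet, then so do the entries of \<open>x\<close> that they come from. For two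
  entries in one row, disjointness of \<open>x\<close> forces these to be the same; for two entries in one
  column, strictness of \<open>x\<close> forces them to be equal. In the inserted block they can therefore be
  cancelled, and the hypothesis on \<open>y\<close> applies.\<close>

lemma g_suboperad_R: "g_suboperad C G \<R> \<O>"
  unfolding R_operad_def
proof (rule g_suboperad_restrict_levels[OF g_operad_O])
  let ?S = "\<lambda>n. {x \<in> op_set \<O> n. sigma_disjoint G M n x \<and> strict_columns G M n x}"
  have S: "x \<in> op_set \<R> n" if "x \<in> ?S n" for x n
    using that unfolding R_set .
  show "?S n \<subseteq> op_set \<O> n" for n
    by blast
  show "op_unit \<O> \<in> ?S 1"
    using O_unit_closed O_unit by (auto simp: sigma_disjoint_def strict_columns_def)
  show "op_perm \<O> n \<sigma> x \<in> ?S n" if \<sigma>: "\<sigma> permutes {1..n}" and x: "x \<in> ?S n" for n \<sigma> x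
  proof -
    have "inv_into UNIV \<sigma> i \<in> {1..n}" if "i \<in> {1..n}" for i
      using that permutes_in_image[OF permutes_inv[OF \<sigma>]] by blast
    moreover have "inv_into UNIV \<sigma> i \<noteq> inv_into UNIV \<sigma> j" if "i \<noteq> j" for i j
      using that permutes_inj[OF permutes_inv[OF \<sigma>]] by (simp add: inj_eq)
    ultimately show ?thesis
      using x O_perm_closed[OF \<sigma>]
      by (simp del: atLeastAtMost_iff add: sigma_disjoint_def strict_columns_def O_perm_apply)
  qed
  show "op_grp \<O> n g x \<in> ?S n" if "g \<in> carrier G" "x \<in> ?S n" for n g x
    using that O_grp_closed[OF that(1)]
    by (simp del: atLeastAtMost_iff add: sigma_disjoint_def strict_columns_def O_grp_apply)
  fix n m i x y assume i: "i \<in> {1..n}" and "x \<in> ?S n" "y \<in> ?S m"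
  then have x: "x \<in> op_set \<R> n" and y: "y \<in> op_set \<R> m"
    using S by blast+
  note xO = R_imp_O[OF x] and yO = R_imp_O[OF y]
  let ?z = "op_comp \<O> n m i x y"
  have "sigma_disjoint G M (n + m - 1) ?z"
    unfolding sigma_disjoint_def
  proof (intro ballI impI notI)
    fix g k l assume g: "g \<in> carrier G" and k: "k \<in> {1..n + m - 1}" and l: "l \<in> {1..n + m - 1}"
      and "k \<noteq> l" and meets: "meets M (?z (g, k)) (?z (g, l))"
    have eq: "outer_index m i k = outer_index m i l"
      using R_sigma_disjointD[OF x comp_meets_outer[OF i xO yO g g k l meets] g]
        outer_index_range[OF i] k l by blast
    then have "outer_index m i k = i"
      using outer_index_eqD[OF i k l] \<open>k \<noteq> l\<close> by blast
    then obtain b c where b: "b \<in> {1..m}" "k = i + b - 1" and c: "c \<in> {1..m}" "l = i + c - 1"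
      using outer_index_eq_self[OF i k] outer_index_eq_self[OF i l] eq by metis
    have "meets M (y (g, b)) (y (g, c))"
      using comp_meets_inner[OF i xO yO g g b(1) c(1)] meets b c by blast
    then show False
      using R_sigma_disjointD[OF y _ g b(1) c(1)] b c \<open>k \<noteq> l\<close> by blast
  qed
  moreover have "strict_columns G M (n + m - 1) ?z"
    unfolding strict_columns_def
  proof (intro ballI disjCI)
    fix k g h assume k: "k \<in> {1..n + m - 1}" and g: "g \<in> carrier G" and h: "h \<in> carrier G"
      and "\<not> \<not> meets M (?z (g, k)) (?z (h, k))"
    then have meets: "meets M (?z (g, k)) (?z (h, k))"
      by blast
    have eq: "x (g, outer_index m i k) = x (h, outer_index m i k)"
      using R_strict_columnsD[OF x comp_meets_outer[OF i xO yO g h k k meets] g h]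
        outer_index_range[OF i k] by blast
    from i k show "?z (g, k) = ?z (h, k)"
    proof (cases rule: comp_position_cases)
      case (outer a)
      then show ?thesis
        using eq g h i by (simp only: O_comp_outer outer_index_outer_pos not_False_eq_True)
    next
      case (inner b)
      then have xi: "x (g, i) = x (h, i)"
        using eq by (simp only: outer_index_inner_pos)
      then have "meets M (y (g, b)) (y (h, b))"
        using comp_meets_inner[OF i xO yO g h inner(1) inner(1)] meets inner by blast
      then have "y (g, b) = y (h, b)"
        using R_strict_columnsD[OF y _ g h inner(1)] by blast
      then show ?thesis
        using xi inner g h i by (simp only: O_comp_inner)
    qed
  qed
  ultimately show "?z \<in> ?S (n + m - 1)"
    using O_comp_closed[OF i xO yO] by blast
qed

end

section \<open>Supported transfers\<close>

definition maximal_subgroup_in :: "('g, 'b) monoid_scheme \<Rightarrow> 'g set \<Rightarrow> 'g set \<Rightarrow> bool" where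
  "maximal_subgroup_in G K A \<longleftrightarrow>
     subgroup K G \<and> K \<subseteq> A \<and> (\<forall>L. subgroup L G \<and> L \<subseteq> A \<and> K \<subseteq> L \<longrightarrow> L = K)"

lemma maximal_subgroup_in_self: "subgroup A G \<Longrightarrow> maximal_subgroup_in G K A \<longleftrightarrow> K = A"
  unfolding maximal_subgroup_in_def by blast

lemma maximal_subgroup_in_extend:
  assumes "finite A" "subgroup K G" "K \<subseteq> A"
  obtains L where "maximal_subgroup_in G L A" "K \<subseteq> L"
proof -
  let ?F = "{L. subgroup L G \<and> L \<subseteq> A}"
  have "finite ?F"
    using assms(1) by simp
  moreover have "K \<in> ?F"
    using assms by blast
  ultimately obtain L where "L \<in> ?F" "K \<subseteq> L" "\<forall>L'\<in>?F. L \<subseteq> L' \<longrightarrow> L = L'"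
    using finite_has_maximal2[of ?F K] by blast
  then have "maximal_subgroup_in G L A"
    by (auto simp: maximal_subgroup_in_def)
  then show ?thesis
    using \<open>K \<subseteq> L\<close> by (rule that)
qed

lemma (in group) mult_inv_cancel:
  assumes "g \<in> carrier G" "z \<in> carrier G"
  shows "g \<otimes> (inv g \<otimes> z) = z" "inv g \<otimes> (g \<otimes> z) = z"
  using assms by (simp_all add: m_assoc[symmetric])

lemma (in group) subgroup_conjugate:
  assumes "subgroup H G" "g \<in> carrier G"
  shows "subgroup ((\<lambda>h. inv g \<otimes> h \<otimes> g) ` H) G"
proof -
  have "(\<lambda>h. inv g \<otimes> h \<otimes> g) \<in> hom G G"
    using assms(2) by (intro homI) (simp_all add: m_assoc mult_inv_cancel)
  then show ?thesis
    using assms(1) group_hom.subgroup_img_is_subgroup[of G G] is_group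
    by (auto simp: group_hom_def group_hom_axioms_def)
qed

lemma (in group) unconjugate:
  assumes "A \<subseteq> carrier G" "g \<in> carrier G"
  shows "(\<lambda>h. inv (inv g) \<otimes> h \<otimes> inv g) ` (\<lambda>h. inv g \<otimes> h \<otimes> g) ` A = A"
proof -
  have "inv (inv g) \<otimes> (inv g \<otimes> h \<otimes> g) \<otimes> inv g = h" if "h \<in> A" for h
  proof -
    have "h \<in> carrier G"
      using that assms(1) by blast
    then show ?thesis
      using assms(2) by (simp add: m_assoc mult_inv_cancel)
  qed
  then have "(\<lambda>h. inv (inv g) \<otimes> h \<otimes> inv g) ` (\<lambda>h. inv g \<otimes> h \<otimes> g) ` A = (\<lambda>h. h) ` A"
    unfolding image_image by (rule image_cong[OF refl])
  then show ?thesis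
    by simp
qed

lemma (in group) maximal_subgroup_in_conjugate:
  assumes K: "maximal_subgroup_in G K A" and A: "A \<subseteq> carrier G" and g: "g \<in> carrier G"
  shows "maximal_subgroup_in G ((\<lambda>k. inv g \<otimes> k \<otimes> g) ` K) ((\<lambda>a. inv g \<otimes> a \<otimes> g) ` A)"
proof -
  let ?c = "\<lambda>k. inv g \<otimes> k \<otimes> g" and ?d = "\<lambda>k. inv (inv g) \<otimes> k \<otimes> inv g"
  have sub: "subgroup K G" "K \<subseteq> A" and max: "\<And>L. subgroup L G \<Longrightarrow> L \<subseteq> A \<Longrightarrow> K \<subseteq> L \<Longrightarrow> L = K"
    using K unfolding maximal_subgroup_in_def by blast+
  have KG: "K \<subseteq> carrier G"
    using sub(1) by (rule subgroup.subset)
  have "L = ?c ` K" if L: "subgroup L G" "L \<subseteq> ?c ` A" "?c ` K \<subseteq> L" for L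
  proof -
    have LG: "L \<subseteq> carrier G"
      using L(1) by (rule subgroup.subset)
    have "?d ` L = K"
    proof (rule max)
      show "subgroup (?d ` L) G"
        using L(1) g by (intro subgroup_conjugate) auto
      show "?d ` L \<subseteq> A" "K \<subseteq> ?d ` L"
        using image_mono[OF L(2), of ?d] image_mono[OF L(3), of ?d]
          unconjugate[OF A g] unconjugate[OF KG g] by simp_all
    qed
    moreover have "?c ` ?d ` L = L"
      using unconjugate[OF LG inv_closed[OF g]] g by simp
    ultimately show ?thesis
      by simp
  qed
  moreover have "?c ` K \<subseteq> ?c ` A"
    using sub(2) by (rule image_mono)
  ultimately show ?thesis
    unfolding maximal_subgroup_in_def using subgroup_conjugate[OF sub(1) g] by blast
qed

context imonoid_group
begin

text \<open>The domain of a twist map is a right coset \<open>H g\<close>. Translating it back to \<open>H\<close> turns the twist map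
  into a function \<open>a\<close> on the subgroup itself; the translating element in the definition of the
  structured transfer is the inverse of \<open>g\<close>.\<close>

lemma supports_transfer_iff:
  "supports_transfer G M n x K H \<longleftrightarrow>
    (\<exists>a i. \<exists>g\<in>carrier G. subgroup H G \<and> a ` H \<subseteq> {1..n} \<and>
      maximal_subgroup_in G K {h \<in> H. a h = i} \<and>
      (\<forall>h1\<in>H. \<forall>h2\<in>H. meets M (x (h1 \<otimes>\<^bsub>G\<^esub> g, a h1)) (x (h2 \<otimes>\<^bsub>G\<^esub> g, a h2))))"
    (is "?lhs \<longleftrightarrow> ?rhs")
proof
  assume ?lhs
  then obtain S \<alpha> i where S: "S \<subseteq> carrier G" "\<alpha> ` S \<subseteq> {1..n}"
    and tr: "structures_transfer G S \<alpha> i K H"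
    and meets: "\<And>g1 g2. g1 \<in> S \<Longrightarrow> g2 \<in> S \<Longrightarrow> meets M (x (g1, \<alpha> g1)) (x (g2, \<alpha> g2))"
    unfolding supports_transfer_def twist_map_def by blast
  from tr obtain g where H: "subgroup H G" and g: "g \<in> carrier G" "S #>\<^bsub>G\<^esub> g = H"
    and K: "maximal_subgroup_in G K ({s \<in> S. \<alpha> s = i} #>\<^bsub>G\<^esub> g)"
    unfolding structures_transfer_def maximal_subgroup_in_def Let_def by blast
  have from_H: "h \<otimes>\<^bsub>G\<^esub> inv\<^bsub>G\<^esub> g \<in> S" "h = h \<otimes>\<^bsub>G\<^esub> inv\<^bsub>G\<^esub> g \<otimes>\<^bsub>G\<^esub> g" if "h \<in> H" for h
  proof -
    obtain s where "s \<in> S" "h = s \<otimes>\<^bsub>G\<^esub> g"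
      using \<open>h \<in> H\<close> g(2) unfolding r_coset_def by blast
    then show "h \<otimes>\<^bsub>G\<^esub> inv\<^bsub>G\<^esub> g \<in> S" "h = h \<otimes>\<^bsub>G\<^esub> inv\<^bsub>G\<^esub> g \<otimes>\<^bsub>G\<^esub> g"
      using S g(1) by (auto simp: G.m_assoc subset_iff)
  qed
  have to_H: "s \<otimes>\<^bsub>G\<^esub> g \<in> H" "s \<otimes>\<^bsub>G\<^esub> g \<otimes>\<^bsub>G\<^esub> inv\<^bsub>G\<^esub> g = s" if "s \<in> S" for s
    using that S g by (auto simp: r_coset_def G.m_assoc subset_iff)
  have "{s \<in> S. \<alpha> s = i} #>\<^bsub>G\<^esub> g = {h \<in> H. \<alpha> (h \<otimes>\<^bsub>G\<^esub> inv\<^bsub>G\<^esub> g) = i}"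
  proof
    show "{s \<in> S. \<alpha> s = i} #>\<^bsub>G\<^esub> g \<subseteq> {h \<in> H. \<alpha> (h \<otimes>\<^bsub>G\<^esub> inv\<^bsub>G\<^esub> g) = i}"
      using to_H unfolding r_coset_def by auto
    show "{h \<in> H. \<alpha> (h \<otimes>\<^bsub>G\<^esub> inv\<^bsub>G\<^esub> g) = i} \<subseteq> {s \<in> S. \<alpha> s = i} #>\<^bsub>G\<^esub> g"
      using from_H unfolding r_coset_def by blast
  qed
  then show ?rhs
    using H K g(1) S(2) from_H meets
    by (intro exI[of _ "\<lambda>h. \<alpha> (h \<otimes>\<^bsub>G\<^esub> inv\<^bsub>G\<^esub> g)"] exI[of _ i] bexI[of _ "inv\<^bsub>G\<^esub> g"]) auto
next
  assume ?rhs
  then obtain a i g where g: "g \<in> carrier G" and H: "subgroup H G" and a: "a ` H \<subseteq> {1..n}"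
    and K: "maximal_subgroup_in G K {h \<in> H. a h = i}"
    and meets: "\<And>h1 h2. h1 \<in> H \<Longrightarrow> h2 \<in> H
      \<Longrightarrow> meets M (x (h1 \<otimes>\<^bsub>G\<^esub> g, a h1)) (x (h2 \<otimes>\<^bsub>G\<^esub> g, a h2))"
    by blast
  have HG: "h \<in> carrier G" if "h \<in> H" for h
    using that H subgroup.mem_carrier by metis
  have hg: "h \<otimes>\<^bsub>G\<^esub> g \<otimes>\<^bsub>G\<^esub> inv\<^bsub>G\<^esub> g = h" if "h \<in> H" for h
    using HG[OF that] g by (simp add: G.m_assoc)
  define S where "S = (\<lambda>h. h \<otimes>\<^bsub>G\<^esub> g) ` H"
  define \<alpha> where "\<alpha> s = a (s \<otimes>\<^bsub>G\<^esub> inv\<^bsub>G\<^esub> g)" for s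
  have \<alpha>: "\<alpha> (h \<otimes>\<^bsub>G\<^esub> g) = a h" if "h \<in> H" for h
    using hg[OF that] by (simp add: \<alpha>_def)
  have SH: "S #>\<^bsub>G\<^esub> inv\<^bsub>G\<^esub> g = H"
    using hg by (auto simp: S_def r_coset_def)
  have A: "{s \<in> S. \<alpha> s = i} #>\<^bsub>G\<^esub> inv\<^bsub>G\<^esub> g = {h \<in> H. a h = i}"
    using hg \<alpha> by (auto simp: S_def r_coset_def)
  have "\<one>\<^bsub>G\<^esub> \<in> {h \<in> H. a h = i}"
    using K subgroup.one_closed unfolding maximal_subgroup_in_def by blast
  then have "i \<in> \<alpha> ` S"
    using \<alpha> unfolding S_def by (metis (mono_tags, lifting) image_eqI mem_Collect_eq)
  then have "structures_transfer G S \<alpha> i K H"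
    unfolding structures_transfer_def using H K g SH A
    by (auto simp: Let_def maximal_subgroup_in_def intro!: bexI[of _ "inv\<^bsub>G\<^esub> g"])
  moreover have "twist_map G n S \<alpha>"
    unfolding twist_map_def
  proof (intro conjI bexI)
    show "subgroup (S #>\<^bsub>G\<^esub> inv\<^bsub>G\<^esub> g) G"
      unfolding SH by (rule H)
  qed (use g HG a \<alpha> in \<open>auto simp: S_def\<close>)
  moreover have "meets M (x (s1, \<alpha> s1)) (x (s2, \<alpha> s2))" if "s1 \<in> S" "s2 \<in> S" for s1 s2
    using that meets \<alpha> by (auto simp: S_def)
  ultimately show ?lhs
    unfolding supports_transfer_def by blast
qed

lemma supports_transferI:
  assumes "g \<in> carrier G" "subgroup H G" "\<And>h. h \<in> H \<Longrightarrow> a h \<in> {1..n}"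
    and "maximal_subgroup_in G K {h \<in> H. a h = i}"
    and "\<And>h1 h2. h1 \<in> H \<Longrightarrow> h2 \<in> H
      \<Longrightarrow> meets M (x (h1 \<otimes>\<^bsub>G\<^esub> g, a h1)) (x (h2 \<otimes>\<^bsub>G\<^esub> g, a h2))"
  shows "supports_transfer G M n x K H"
  unfolding supports_transfer_iff using assms by blast

lemma supports_transferE:
  assumes "supports_transfer G M n x K H"
  obtains a i g where "g \<in> carrier G" "subgroup H G" "\<And>h. h \<in> H \<Longrightarrow> a h \<in> {1..n}"
    "maximal_subgroup_in G K {h \<in> H. a h = i}"
    "\<And>h1 h2. h1 \<in> H \<Longrightarrow> h2 \<in> H
      \<Longrightarrow> meets M (x (h1 \<otimes>\<^bsub>G\<^esub> g, a h1)) (x (h2 \<otimes>\<^bsub>G\<^esub> g, a h2))"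
  using assms unfolding supports_transfer_iff by blast

text \<open>This is why transitivity of transfer systems makes elements with transfers in \<open>\<tau>\<close> composable. Let
  \<open>a\<close> be the function on \<open>H\<close> that supports \<open>K \<rightarrow> H\<close> in the composite. Followed by \<^const>\<open>outer_index\<close>, it
  picks meeting entries of \<open>x\<close>, and supports a transfer \<open>L \<rightarrow> H\<close> in \<open>x\<close> with \<open>L\<close> containing \<open>K\<close>. If this takes
  place in a column other than \<open>i\<close>, then no information is lost and \<open>K = L\<close>. Otherwise, \<open>a\<close> stays in the
  inserted block on \<open>L\<close>. Since column \<open>i\<close> of \<open>x\<close> is strict, its meeting entries are equal there, and they
  can be cancelled; so \<open>a\<close> also picks meeting entries of \<open>y\<close> and supports \<open>K \<rightarrow> L\<close> in \<open>y\<close>.\<close>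

lemma supports_transfer_comp:
  assumes i: "i \<in> {1..n}" and x: "x \<in> op_set \<R> n" and y: "y \<in> op_set \<R> m"
    and "supports_transfer G M (n + m - 1) (op_comp \<O> n m i x y) K H"
  obtains L where "supports_transfer G M n x L H" "K = L \<or> supports_transfer G M m y K L"
proof -
  let ?z = "op_comp \<O> n m i x y"
  note xO = R_imp_O[OF x] and yO = R_imp_O[OF y]
  obtain a p g where g: "g \<in> carrier G" and H: "subgroup H G"
    and a: "\<And>h. h \<in> H \<Longrightarrow> a h \<in> {1..n + m - 1}"
    and K: "maximal_subgroup_in G K {h \<in> H. a h = p}"
    and meets: "\<And>h1 h2. h1 \<in> H \<Longrightarrow> h2 \<in> H
      \<Longrightarrow> meets M (?z (h1 \<otimes>\<^bsub>G\<^esub> g, a h1)) (?z (h2 \<otimes>\<^bsub>G\<^esub> g, a h2))"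
    using assms(4) by (rule supports_transferE) blast
  have HG: "H \<subseteq> carrier G"
    using H by (rule subgroup.subset)
  have K': "subgroup K G" "K \<subseteq> {h \<in> H. a h = p}"
    and K_max: "\<And>L. subgroup L G \<Longrightarrow> L \<subseteq> {h \<in> H. a h = p} \<Longrightarrow> K \<subseteq> L \<Longrightarrow> L = K"
    using K unfolding maximal_subgroup_in_def by blast+
  have p: "p \<in> {1..n + m - 1}"
    using K' subgroup.one_closed a by blast
  define b where "b h = outer_index m i (a h)" for h
  define j where "j = outer_index m i p"
  have "finite {h \<in> H. b h = j}"
    using HG finite_G by (simp add: finite_subset)
  moreover have "K \<subseteq> {h \<in> H. b h = j}"
    using K'(2) by (auto simp: b_def j_def)
  ultimately obtain L where L: "maximal_subgroup_in G L {h \<in> H. b h = j}" and KL: "K \<subseteq> L"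
    using maximal_subgroup_in_extend K'(1) by blast
  have L': "subgroup L G" "L \<subseteq> {h \<in> H. b h = j}"
    using L unfolding maximal_subgroup_in_def by blast+
  have hg: "h \<otimes>\<^bsub>G\<^esub> g \<in> carrier G" if "h \<in> H" for h
    using that HG g by auto
  have x_meets: "meets M (x (h1 \<otimes>\<^bsub>G\<^esub> g, b h1)) (x (h2 \<otimes>\<^bsub>G\<^esub> g, b h2))" if "h1 \<in> H" "h2 \<in> H" for h1 h2
    unfolding b_def using that by (intro comp_meets_outer[OF i xO yO] hg a meets)
  have "supports_transfer G M n x L H"
    proof (rule supports_transferI[OF g H _ L])
    show "b h \<in> {1..n}" if "h \<in> H" for h
      unfolding b_def using i a[OF that] by (rule outer_index_range)
  qed (rule x_meets)
  moreover have "K = L \<or> supports_transfer G M m y K L"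
  proof (cases "j = i")
    case False
    have "L \<subseteq> {h \<in> H. a h = p}"
      using L'(2) False outer_index_eqD[OF i a p] by (auto simp: b_def j_def)
    then show ?thesis
      using K_max[OF L'(1) _ KL] by blast
  next
    case True
    define c where "c h = a h + 1 - i" for h
    have c: "c h \<in> {1..m}" "a h = i + c h - 1" if "h \<in> L" for h
    proof -
      have h: "h \<in> H" "outer_index m i (a h) = i"
        using that L'(2) True by (auto simp: b_def)
      obtain d where "d \<in> {1..m}" "a h = i + d - 1"
        using outer_index_eq_self[OF i a[OF h(1)] h(2)] by blast
      then show "c h \<in> {1..m}" "a h = i + c h - 1"
        by (auto simp: c_def)
    qed
    have "{h \<in> L. c h = p + 1 - i} = {h \<in> H. a h = p} \<inter> L"
    proof -
      obtain d where "d \<in> {1..m}" "p = i + d - 1"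
        using outer_index_eq_self[OF i p] True j_def by metis
      then have "i \<le> p"
        by auto
      moreover have "i \<le> a h" if "h \<in> L" for h
        using c[OF that] by auto
      ultimately have "c h = p + 1 - i \<longleftrightarrow> a h = p" if "h \<in> L" for h
        using that by (fastforce simp: c_def)
      then show ?thesis
        using L'(2) by blast
    qed
    then have "maximal_subgroup_in G K {h \<in> L. c h = p + 1 - i}"
      using K' K_max KL unfolding maximal_subgroup_in_def by simp
    moreover have "meets M (y (h1 \<otimes>\<^bsub>G\<^esub> g, c h1)) (y (h2 \<otimes>\<^bsub>G\<^esub> g, c h2))"
      if h: "h1 \<in> L" "h2 \<in> L" for h1 h2
    proof -
      have H12: "h1 \<in> H" "h2 \<in> H" "b h1 = i" "b h2 = i"
        using h L'(2) True by auto
      have "x (h1 \<otimes>\<^bsub>G\<^esub> g, i) = x (h2 \<otimes>\<^bsub>G\<^esub> g, i)"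
        using x_meets[OF H12(1,2)] H12 hg i R_strict_columnsD[OF x] by metis
      moreover have "meets M (?z (h1 \<otimes>\<^bsub>G\<^esub> g, i + c h1 - 1)) (?z (h2 \<otimes>\<^bsub>G\<^esub> g, i + c h2 - 1))"
        using meets[OF H12(1,2)] c(2)[OF h(1)] c(2)[OF h(2)] by metis
      ultimately show ?thesis
        using comp_meets_inner[OF i xO yO hg[OF H12(1)] hg[OF H12(2)] c(1)[OF h(1)] c(1)[OF h(2)]]
        by blast
    qed
    ultimately have "supports_transfer G M m y K L"
      using supports_transferI[OF g L'(1), where a = c] c(1) by blast
    then show ?thesis ..
  qed
  ultimately show ?thesis
    using that by blast
qed

text \<open>Acting by \<open>g\<close> translates the coset \<open>H g'\<close> to \<open>g\<^sup>-\<^sup>1 H g'\<close>, which is a right coset of the conjugate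
  \<open>g\<^sup>-\<^sup>1 H g\<close>.\<close>

lemma supports_transfer_grp:
  assumes g: "g \<in> carrier G" and "supports_transfer G M n (op_grp \<O> n g x) K H"
  shows "supports_transfer G M n x ((\<lambda>k. inv\<^bsub>G\<^esub> g \<otimes>\<^bsub>G\<^esub> k \<otimes>\<^bsub>G\<^esub> g) ` K)
    ((\<lambda>h. inv\<^bsub>G\<^esub> g \<otimes>\<^bsub>G\<^esub> h \<otimes>\<^bsub>G\<^esub> g) ` H)"
proof -
  let ?c = "\<lambda>k. inv\<^bsub>G\<^esub> g \<otimes>\<^bsub>G\<^esub> k \<otimes>\<^bsub>G\<^esub> g"
  obtain a p g' where g': "g' \<in> carrier G" and H: "subgroup H G"
    and a: "\<And>h. h \<in> H \<Longrightarrow> a h \<in> {1..n}"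
    and K: "maximal_subgroup_in G K {h \<in> H. a h = p}"
    and meets: "\<And>h1 h2. h1 \<in> H \<Longrightarrow> h2 \<in> H \<Longrightarrow> meets M (op_grp \<O> n g x (h1 \<otimes>\<^bsub>G\<^esub> g', a h1))
      (op_grp \<O> n g x (h2 \<otimes>\<^bsub>G\<^esub> g', a h2))"
    using assms(2) by (rule supports_transferE) blast
  have HG: "h \<in> carrier G" if "h \<in> H" for h
    using that H subgroup.mem_carrier by metis
  have cinv: "g \<otimes>\<^bsub>G\<^esub> ?c h \<otimes>\<^bsub>G\<^esub> inv\<^bsub>G\<^esub> g = h" if "h \<in> H" for h
    using HG[OF that] g by (simp add: G.m_assoc G.mult_inv_cancel)
  define a' where "a' h = a (g \<otimes>\<^bsub>G\<^esub> h \<otimes>\<^bsub>G\<^esub> inv\<^bsub>G\<^esub> g)" for h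
  have a': "a' (?c h) = a h" if "h \<in> H" for h
    unfolding a'_def cinv[OF that] ..
  show ?thesis
  proof (rule supports_transferI)
    show "inv\<^bsub>G\<^esub> g \<otimes>\<^bsub>G\<^esub> g' \<in> carrier G"
      using g g' by simp
    show "subgroup (?c ` H) G"
      using H g by (rule G.subgroup_conjugate)
    show "a' h \<in> {1..n}" if "h \<in> ?c ` H" for h
      using that a a' by force
    have "{h \<in> ?c ` H. a' h = p} = ?c ` {h \<in> H. a h = p}"
      using a' by auto
    then show "maximal_subgroup_in G (?c ` K) {h \<in> ?c ` H. a' h = p}"
      using G.maximal_subgroup_in_conjugate[OF K _ g] HG by auto
    have *: "x (?c h \<otimes>\<^bsub>G\<^esub> (inv\<^bsub>G\<^esub> g \<otimes>\<^bsub>G\<^esub> g'), a' (?c h)) = op_grp \<O> n g x (h \<otimes>\<^bsub>G\<^esub> g', a h)"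
      if h: "h \<in> H" for h
    proof -
      have "?c h \<otimes>\<^bsub>G\<^esub> (inv\<^bsub>G\<^esub> g \<otimes>\<^bsub>G\<^esub> g') = inv\<^bsub>G\<^esub> g \<otimes>\<^bsub>G\<^esub> (h \<otimes>\<^bsub>G\<^esub> g')"
        using HG[OF h] g g' by (simp add: G.m_assoc G.mult_inv_cancel)
      then show ?thesis
        using a' h a HG g' by (simp del: atLeastAtMost_iff add: O_grp_apply)
    qed
    show "meets M (x (h1 \<otimes>\<^bsub>G\<^esub> (inv\<^bsub>G\<^esub> g \<otimes>\<^bsub>G\<^esub> g'), a' h1)) (x (h2 \<otimes>\<^bsub>G\<^esub> (inv\<^bsub>G\<^esub> g \<otimes>\<^bsub>G\<^esub> g'), a' h2))"
      if "h1 \<in> ?c ` H" "h2 \<in> ?c ` H" for h1 h2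
      using that meets * by force
  qed
qed

lemma supports_transfer_perm:
  assumes \<sigma>: "\<sigma> permutes {1..n}" and "supports_transfer G M n (op_perm \<O> n \<sigma> x) K H"
  shows "supports_transfer G M n x K H"
proof -
  obtain a p g where g: "g \<in> carrier G" and H: "subgroup H G"
    and a: "\<And>h. h \<in> H \<Longrightarrow> a h \<in> {1..n}"
    and K: "maximal_subgroup_in G K {h \<in> H. a h = p}"
    and meets: "\<And>h1 h2. h1 \<in> H \<Longrightarrow> h2 \<in> H \<Longrightarrow> meets M (op_perm \<O> n \<sigma> x (h1 \<otimes>\<^bsub>G\<^esub> g, a h1))
      (op_perm \<O> n \<sigma> x (h2 \<otimes>\<^bsub>G\<^esub> g, a h2))"
    using assms(2) by (rule supports_transferE) blast
  let ?a = "\<lambda>h. inv_into UNIV \<sigma> (a h)"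
  have \<sigma>': "inv_into UNIV \<sigma> permutes {1..n}"
    using \<sigma> by (rule permutes_inv)
  have hg: "h \<otimes>\<^bsub>G\<^esub> g \<in> carrier G" if "h \<in> H" for h
    using that H g subgroup.mem_carrier by fastforce
  have "{h \<in> H. ?a h = inv_into UNIV \<sigma> p} = {h \<in> H. a h = p}"
    using permutes_inj[OF \<sigma>'] by (auto simp: inj_eq)
  then have "maximal_subgroup_in G K {h \<in> H. ?a h = inv_into UNIV \<sigma> p}"
    using K by simp
  moreover have "?a h \<in> {1..n}" if "h \<in> H" for h
    using a[OF that] \<sigma>' by (simp only: permutes_in_image)
  moreover have "meets M (x (h1 \<otimes>\<^bsub>G\<^esub> g, ?a h1)) (x (h2 \<otimes>\<^bsub>G\<^esub> g, ?a h2))"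
    if "h1 \<in> H" "h2 \<in> H" for h1 h2
    using meets[OF that] that a hg by (simp only: O_perm_apply)
  ultimately show ?thesis
    using g H by (intro supports_transferI)
qed

text \<open>The functions on \<open>H\<close> that pick meeting entries are constant here, and then \<open>H\<close> itself is the
  maximal subgroup on which they are constant.\<close>

lemma supports_transfer_constant:
  assumes "supports_transfer G M n x K H"
    and const: "\<And>g h i j. g \<in> carrier G \<Longrightarrow> h \<in> carrier G \<Longrightarrow> i \<in> {1..n} \<Longrightarrow> j \<in> {1..n}
      \<Longrightarrow> meets M (x (g, i)) (x (h, j)) \<Longrightarrow> i = j"
  shows "subgroup H G \<and> K = H"
proof -
  obtain a p g where g: "g \<in> carrier G" and H: "subgroup H G"
    and a: "\<And>h. h \<in> H \<Longrightarrow> a h \<in> {1..n}"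
    and K: "maximal_subgroup_in G K {h \<in> H. a h = p}"
    and meets: "\<And>h1 h2. h1 \<in> H \<Longrightarrow> h2 \<in> H
      \<Longrightarrow> meets M (x (h1 \<otimes>\<^bsub>G\<^esub> g, a h1)) (x (h2 \<otimes>\<^bsub>G\<^esub> g, a h2))"
    using assms(1) by (rule supports_transferE) blast
  have hg: "h \<otimes>\<^bsub>G\<^esub> g \<in> carrier G" if "h \<in> H" for h
    using that H g subgroup.mem_carrier by fastforce
  have "a h1 = a h2" if "h1 \<in> H" "h2 \<in> H" for h1 h2
    using const[OF hg hg a a meets] that by blast
  moreover have "\<one>\<^bsub>G\<^esub> \<in> {h \<in> H. a h = p}"
    using K subgroup.one_closed unfolding maximal_subgroup_in_def by blast
  ultimately have "{h \<in> H. a h = p} = H"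
    by auto
  then show ?thesis
    using K H maximal_subgroup_in_self by metis
qed

abbreviation R\<tau> :: "('g set \<Rightarrow> 'g set \<Rightarrow> bool) \<Rightarrow> ('g \<times> nat \<Rightarrow> 'm, 'g) g_operad_data" where
  "R\<tau> \<tau> \<equiv> R_tau_operad G M \<tau>"

lemma R_tau_set:
  "op_set (R\<tau> \<tau>) n = {x \<in> op_set \<R> n. \<forall>K H. supports_transfer G M n x K H \<longrightarrow> \<tau> K H}"
  by (auto simp: R_tau_operad_def)

lemma R_tau_simps:
  "op_perm (R\<tau> \<tau>) = op_perm \<O>" "op_unit (R\<tau> \<tau>) = op_unit \<O>"
  "op_comp (R\<tau> \<tau>) = op_comp \<O>" "op_grp (R\<tau> \<tau>) = op_grp \<O>"
  by (simp_all add: R_tau_operad_def R_operad_def)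

lemma g_suboperad_R_tau:
  assumes \<tau>: "transfer_system G \<tau>"
  shows "g_suboperad C G (R\<tau> \<tau>) \<R>"
proof -
  have R: "g_operad C G \<R>"
    using g_suboperad_R unfolding g_suboperad_def by blast
  interpret R: g_operad C G \<R>
    by (rule R)
  have ops: "op_perm \<R> = op_perm \<O>" "op_unit \<R> = op_unit \<O>" "op_comp \<R> = op_comp \<O>"
    "op_grp \<R> = op_grp \<O>"
    by (simp_all add: R_operad_def)
  have refl: "\<tau> H H" if "subgroup H G" for H
    using \<tau> that unfolding transfer_system_def by blast
  have trans: "\<tau> L H" if "\<tau> L K" "\<tau> K H" for L K H
    using \<tau> that unfolding transfer_system_def by blast
  have conj: "\<tau> ((\<lambda>k. inv\<^bsub>G\<^esub> g \<otimes>\<^bsub>G\<^esub> k \<otimes>\<^bsub>G\<^esub> g) ` K) ((\<lambda>h. inv\<^bsub>G\<^esub> g \<otimes>\<^bsub>G\<^esub> h \<otimes>\<^bsub>G\<^esub> g) ` H)"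
    if "\<tau> K H" "g \<in> carrier G" for K H g
    using \<tau> that unfolding transfer_system_def by blast
  show ?thesis
    unfolding R_tau_operad_def
  proof (rule g_suboperad_restrict_levels[OF R])
    let ?S = "\<lambda>n. {x \<in> op_set \<R> n. \<forall>K H. supports_transfer G M n x K H \<longrightarrow> \<tau> K H}"
    show "?S n \<subseteq> op_set \<R> n" for n
      by blast
    have "\<tau> K H" if "supports_transfer G M 1 (op_unit \<O>) K H" for K H
      using supports_transfer_constant[OF that] refl by fastforce
    then show "op_unit \<R> \<in> ?S 1"
      using R.unit_closed unfolding ops by blast
    show "op_perm \<R> n \<sigma> x \<in> ?S n" if "\<sigma> permutes {1..n}" "x \<in> ?S n" for n \<sigma> x
      using that R.perm_closed supports_transfer_perm unfolding ops by blast
    show "op_grp \<R> n g x \<in> ?S n" if g: "g \<in> carrier G" and x: "x \<in> ?S n" for n g x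
    proof -
      have "\<tau> K H" if "supports_transfer G M n (op_grp \<O> n g x) K H" for K H
      proof -
        have "subgroup H G" "K \<subseteq> H"
          using that by (auto elim!: supports_transferE simp: maximal_subgroup_in_def)
        then have sub: "K \<subseteq> carrier G" "H \<subseteq> carrier G"
          using subgroup.subset by blast+
        have unconj: "(\<lambda>h. inv\<^bsub>G\<^esub> (inv\<^bsub>G\<^esub> g) \<otimes>\<^bsub>G\<^esub> h \<otimes>\<^bsub>G\<^esub> inv\<^bsub>G\<^esub> g) ` (\<lambda>h. inv\<^bsub>G\<^esub> g \<otimes>\<^bsub>G\<^esub> h \<otimes>\<^bsub>G\<^esub> g) ` A = A"
          if "A \<subseteq> carrier G" for A
          using that g by (rule G.unconjugate)
        have "\<tau> ((\<lambda>k. inv\<^bsub>G\<^esub> g \<otimes>\<^bsub>G\<^esub> k \<otimes>\<^bsub>G\<^esub> g) ` K) ((\<lambda>h. inv\<^bsub>G\<^esub> g \<otimes>\<^bsub>G\<^esub> h \<otimes>\<^bsub>G\<^esub> g) ` H)"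
          using supports_transfer_grp[OF g that] x by blast
        from conj[OF this G.inv_closed[OF g]] show ?thesis
          unfolding unconj[OF sub(1)] unconj[OF sub(2)] .
      qed
      then show ?thesis
        using R.grp_closed[OF g] x unfolding ops by blast
    qed
    show "op_comp \<R> n m i x y \<in> ?S (n + m - 1)"
      if i: "i \<in> {1..n}" and x: "x \<in> ?S n" and y: "y \<in> ?S m" for n m i x y
    proof -
      have "\<tau> K H" if supp: "supports_transfer G M (n + m - 1) (op_comp \<O> n m i x y) K H" for K H
      proof -
        obtain L where "supports_transfer G M n x L H" "K = L \<or> supports_transfer G M m y K L"
          by (rule supports_transfer_comp[OF i _ _ supp]) (use x y in blast)+
        then show ?thesis
          using x y trans by blast
      qed
      then show ?thesis
        using R.comp_closed[OF i] x y unfolding ops by blast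
    qed
  qed
qed

end

section \<open>Fixed points and admissible sets\<close>

lemma action_perm_apply:
  assumes "bij_betw e T {1..card T}" "c \<in> T"
  shows "action_perm T a e h (e c) = e (a h c)"
  using assms bij_betw_apply[OF assms] by (simp add: action_perm_def bij_betw_inv_into_left)

lemma action_perm_permutes:
  assumes e: "bij_betw e T {1..card T}" and a: "bij_betw (a h) T T"
  shows "action_perm T a e h permutes {1..card T}"
proof (rule bij_imp_permutes)
  have "bij_betw (e \<circ> (a h \<circ> inv_into T e)) {1..card T} {1..card T}"
    using bij_betw_trans[OF bij_betw_trans[OF bij_betw_inv_into[OF e] a] e] by simp
  then show "bij_betw (action_perm T a e h) {1..card T} {1..card T}"
    by (rule bij_betw_cong[THEN iffD1, rotated]) (simp add: action_perm_def)
qed (auto simp: action_perm_def)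

context group
begin

lemma lcos_cancel:
  assumes "c \<subseteq> carrier G" "h \<in> carrier G"
  shows "inv h <# (h <# c) = c" "h <# (inv h <# c) = c"
  using assms by (simp_all add: lcos_m_assoc lcos_mult_one)

lemma lcos_subset:
  assumes "subgroup H G" "h \<in> H" "c \<subseteq> H"
  shows "h <# c \<subseteq> H"
  using assms subgroup.m_closed by (fastforce simp: l_coset_def)

lemma bij_betw_left_cosets:
  assumes H: "subgroup H G" and K: "subgroup K G" "K \<subseteq> H" and h: "h \<in> H"
  shows "bij_betw (\<lambda>c. h <# c) {h <# K | h. h \<in> H} {h <# K | h. h \<in> H}"
proof -
  let ?T = "{h <# K | h. h \<in> H}"
  have HG: "h \<in> carrier G" if "h \<in> H" for h
    using that H subgroup.mem_carrier by metis
  have KG: "K \<subseteq> carrier G"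
    using K(1) by (rule subgroup.subset)
  have TG: "c \<subseteq> carrier G" if "c \<in> ?T" for c
    using that HG KG l_coset_subset_G by blast
  have closed: "h <# c \<in> ?T" if "h \<in> H" and c: "c \<in> ?T" for h c
  proof -
    obtain k where k: "k \<in> H" "c = k <# K"
      using c by blast
    have "h <# c = (h \<otimes> k) <# K"
      using k HG[OF \<open>h \<in> H\<close>] HG[OF k(1)] KG by (simp add: lcos_m_assoc)
    then show ?thesis
      using subgroup.m_closed[OF H \<open>h \<in> H\<close> k(1)] by blast
  qed
  have ih: "inv h \<in> H"
    using H h by (rule subgroup.m_inv_closed)
  show ?thesis
    by (rule bij_betw_byWitness[where f' = "\<lambda>c. inv h <# c"])
      (use closed h ih TG HG lcos_cancel in \<open>auto simp del: mem_Collect_eq\<close>)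
qed

lemma lcos_eq_self_iff:
  assumes K: "subgroup K G" and "h \<in> carrier G" "k \<in> carrier G"
  shows "h <# (k <# K) = k <# K \<longleftrightarrow> inv k \<otimes> h \<otimes> k \<in> K"
proof
  have KG: "K \<subseteq> carrier G"
    using K by (rule subgroup.subset)
  have k1: "k \<in> k <# K"
    using assms(3) subgroup.one_closed[OF K] by (force simp: l_coset_def)
  show "inv k \<otimes> h \<otimes> k \<in> K" if "h <# (k <# K) = k <# K"
  proof -
    have "h \<otimes> k \<in> k <# K"
      using that k1 unfolding l_coset_def by blast
    then obtain u where "u \<in> K" "h \<otimes> k = k \<otimes> u"
      by (auto simp: l_coset_def)
    then show ?thesis
      using assms KG by (simp add: m_assoc mult_inv_cancel subset_iff)
  qed
  assume *: "inv k \<otimes> h \<otimes> k \<in> K"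
  have "h <# (k <# K) = (k \<otimes> (inv k \<otimes> h \<otimes> k)) <# K"
    using assms KG by (simp add: lcos_m_assoc m_assoc mult_inv_cancel)
  also have "\<dots> = k <# ((inv k \<otimes> h \<otimes> k) <# K)"
    using assms KG by (simp add: lcos_m_assoc)
  also have "\<dots> = k <# K"
    using coset_join3[OF _ K *] assms by simp
  finally show "h <# (k <# K) = k <# K" .
qed

end

context imonoid_group
begin

lemma O_fixed_iff:
  assumes \<sigma>: "\<sigma> permutes {1..n}" and h: "h \<in> carrier G" and x: "x \<in> op_set \<O> n"
  shows "op_grp \<O> n h (op_perm \<O> n \<sigma> x) = x \<longleftrightarrow>
    (\<forall>k\<in>carrier G. \<forall>i\<in>{1..n}. x (h \<otimes>\<^bsub>G\<^esub> k, \<sigma> i) = x (k, i))" (is "?y = x \<longleftrightarrow> ?rhs")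
proof -
  have y: "?y (h \<otimes>\<^bsub>G\<^esub> k, \<sigma> i) = x (k, i)" if "k \<in> carrier G" "i \<in> {1..n}" for k i
  proof -
    have "\<sigma> i \<in> {1..n}"
      using that(2) \<sigma> by (simp only: permutes_in_image)
    then have "?y (h \<otimes>\<^bsub>G\<^esub> k, \<sigma> i) = op_perm \<O> n \<sigma> x (inv\<^bsub>G\<^esub> h \<otimes>\<^bsub>G\<^esub> (h \<otimes>\<^bsub>G\<^esub> k), \<sigma> i)"
      using h that(1) by (simp only: O_grp_apply G.m_closed)
    then show ?thesis
      using that h \<sigma> by (simp only: G.mult_inv_cancel O_perm_apply_image)
  qed
  show ?thesis
  proof
    assume "?y = x"
    then show ?rhs
      using y by metis
  next
    assume rhs: ?rhs
    show "?y = x"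
    proof (rule O_eqI)
      show "?y \<in> op_set \<O> n"
        by (intro O_grp_closed O_perm_closed h \<sigma> x)
      show "x \<in> op_set \<O> n"
        by (rule x)
      fix g j assume g: "g \<in> carrier G" and j: "j \<in> {1..n}"
      obtain i where i: "i \<in> {1..n}" "j = \<sigma> i"
        using j permutes_image[OF \<sigma>] by blast
      have "g = h \<otimes>\<^bsub>G\<^esub> (inv\<^bsub>G\<^esub> h \<otimes>\<^bsub>G\<^esub> g)" "inv\<^bsub>G\<^esub> h \<otimes>\<^bsub>G\<^esub> g \<in> carrier G"
        using g h by (simp_all add: G.mult_inv_cancel)
      then show "?y (g, j) = x (g, j)"
        using y rhs i by metis
    qed
  qed
qed

text \<open>For disjoint \<open>a\<close> and \<open>b\<close>, the elements \<open>b\<^sup>k a\<close> are pairwise disjoint: if \<open>b\<^sup>k a\<close> and \<open>b\<^sup>l a\<close> with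
  \<open>k < l\<close> met, then cancelling \<open>b\<^sup>k\<close> would show that \<open>a\<close> meets a right multiple of \<open>b\<close>, and so \<open>b\<close>.\<close>

lemma disjoint_sequence:
  assumes "\<not> trivial_imonoid M"
  obtains s :: "nat \<Rightarrow> 'm"
  where "\<And>k. s k \<in> carrier M" "\<And>k l. meets M (s k) (s l) \<Longrightarrow> k = l"
proof -
  obtain a b where a: "a \<in> carrier M" and b: "b \<in> carrier M" and ab: "\<not> meets M a b"
    using assms unfolding trivial_imonoid_def by blast
  define s where "s k = (b [^]\<^bsub>M\<^esub> (k::nat)) \<otimes>\<^bsub>M\<^esub> a" for k
  have s: "s k \<in> carrier M" for k
    using a b by (simp add: s_def)
  have "\<not> meets M (s k) (s l)" if "k < l" for k l
  proof
    assume "meets M (s k) (s l)"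
    moreover obtain d where d: "l = k + Suc d"
      using less_imp_Suc_add[OF \<open>k < l\<close>] by auto
    have "s l = b [^]\<^bsub>M\<^esub> k \<otimes>\<^bsub>M\<^esub> (b [^]\<^bsub>M\<^esub> Suc d \<otimes>\<^bsub>M\<^esub> a)"
      using a b by (simp only: s_def d M.nat_pow_mult[symmetric] M.m_assoc M.nat_pow_closed)
    ultimately have "meets M a (b [^]\<^bsub>M\<^esub> Suc d \<otimes>\<^bsub>M\<^esub> a)"
      using M.meets_cancel[of "b [^]\<^bsub>M\<^esub> k" a "b [^]\<^bsub>M\<^esub> Suc d \<otimes>\<^bsub>M\<^esub> a"] a b by (simp add: s_def)
    moreover have "b [^]\<^bsub>M\<^esub> Suc d \<otimes>\<^bsub>M\<^esub> a = b \<otimes>\<^bsub>M\<^esub> (b [^]\<^bsub>M\<^esub> d \<otimes>\<^bsub>M\<^esub> a)"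
      using a b by (simp only: M.nat_pow_Suc2 M.m_assoc M.nat_pow_closed)
    ultimately have "meets M (a \<otimes>\<^bsub>M\<^esub> \<one>\<^bsub>M\<^esub>) (b \<otimes>\<^bsub>M\<^esub> (b [^]\<^bsub>M\<^esub> d \<otimes>\<^bsub>M\<^esub> a))"
      using a by simp
    then have "meets M a b"
      by (rule M.meets_prefix[OF a b M.one_closed, rotated]) (use a b in simp)
    then show False
      using ab by blast
  qed
  then have "k = l" if "meets M (s k) (s l)" for k l
    using that M.meets_sym s by (metis linorder_neqE_nat)
  then show ?thesis
    using that s by blast
qed

text \<open>The value of \<open>x\<close> at the entries \<open>\<sigma> i\<close> and \<open>i\<close> of a row is the same, so these entries meet.\<close>

lemma R_perm_free:
  assumes x: "x \<in> op_set \<R> n" and \<sigma>: "\<sigma> permutes {1..n}" and fixed: "op_perm \<O> n \<sigma> x = x"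
  shows "\<sigma> = id"
proof
  fix i
  show "\<sigma> i = id i"
  proof (cases "i \<in> {1..n}")
    case True
    then have \<sigma>i: "\<sigma> i \<in> {1..n}"
      using \<sigma> by (simp only: permutes_in_image)
    have "x (\<one>\<^bsub>G\<^esub>, \<sigma> i) = x (\<one>\<^bsub>G\<^esub>, i)"
      using O_perm_apply_image[OF \<sigma> G.one_closed True, of x] fixed by simp
    then have "meets M (x (\<one>\<^bsub>G\<^esub>, \<sigma> i)) (x (\<one>\<^bsub>G\<^esub>, i))"
      using M.meets_refl O_mem[OF R_imp_O[OF x] G.one_closed True] by simp
    then show ?thesis
      using R_sigma_disjointD[OF x _ G.one_closed \<sigma>i True] by simp
  qed (use \<sigma> permutes_not_in in fastforce)
qed

lemma R_tau_fixed_binary: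
  assumes \<tau>: "transfer_system G \<tau>" and M: "\<not> trivial_imonoid M"
  obtains x where "x \<in> op_set (R\<tau> \<tau>) 2" "\<And>h. h \<in> carrier G \<Longrightarrow> op_grp \<O> 2 h (op_perm \<O> 2 id x) = x"
proof -
  obtain s :: "nat \<Rightarrow> 'm" where s: "\<And>k. s k \<in> carrier M" "\<And>k l. meets M (s k) (s l) \<Longrightarrow> k = l"
    using disjoint_sequence[OF M] by blast
  define x where "x = (\<lambda>(g, i)\<in>carrier G \<times> {1..2}. s i)"
  have x_apply: "x (g, i) = s i" if "g \<in> carrier G" "i \<in> {1..2}" for g i
    using that by (simp add: x_def)
  have xO: "x \<in> op_set \<O> 2"
    unfolding O_set x_def using s by auto
  then have xR: "x \<in> op_set \<R> 2"
    using s unfolding R_set sigma_disjoint_def strict_columns_def by (auto simp: x_apply)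
  have "\<tau> K H" if "supports_transfer G M 2 x K H" for K H
  proof -
    have "subgroup H G \<and> K = H"
      by (rule supports_transfer_constant[OF that]) (simp add: x_apply s(2))
    then show ?thesis
      using \<tau> unfolding transfer_system_def by blast
  qed
  then have "x \<in> op_set (R\<tau> \<tau>) 2"
    using xR by (simp add: R_tau_set)
  moreover have "op_grp \<O> 2 h (op_perm \<O> 2 id x) = x" if "h \<in> carrier G" for h
    using that by (subst O_fixed_iff[OF permutes_id that xO]) (simp add: x_apply)
  ultimately show ?thesis
    using that by blast
qed

text \<open>A fixed point \<open>x\<close> of the graph subgroup of \<open>H/K\<close> is constant on the orbits of \<open>H\<close>. Along the orbit
  of the coset \<open>K\<close> in the row of the unit, the function \<open>h \<mapsto> h K\<close> therefore picks equal entries,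
  and it takes the value \<open>K\<close> exactly on \<open>K\<close>. So \<open>x\<close> supports \<open>K \<rightarrow> H\<close>.

  Conversely, let the entry of \<open>x\<close> in row \<open>k\<close> and column \<open>c\<close>, a left coset of \<open>K\<close> in \<open>H\<close>, be the member
  with index \<open>k\<^sup>-\<^sup>1 c\<close> of a family of pairwise disjoint elements. This is invariant under \<open>H\<close>, and two
  entries meet only if their indices agree. A function on a subgroup \<open>H'\<close> that picks meeting
  entries must then have the form \<open>h \<mapsto> h c\<close> for a fixed coset \<open>c = k K\<close> in \<open>H\<close>. Hence \<open>H'\<close> is contained
  in \<open>H\<close>, and the function takes the value \<open>c\<close> on the subgroup \<open>k K k\<^sup>-\<^sup>1 \<inter> H'\<close>. So all
  transfers that \<open>x\<close> supports arise from \<open>K \<rightarrow> H\<close> by conjugation and restriction.\<close>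

lemma R_tau_admissible_iff:
  assumes \<tau>: "transfer_system G \<tau>" and M: "\<not> trivial_imonoid M"
    and K: "subgroup K G" and H: "subgroup H G" and KH: "K \<subseteq> H"
  shows "admissible (R\<tau> \<tau>) H {h <#\<^bsub>G\<^esub> K | h. h \<in> H} (\<lambda>h c. h <#\<^bsub>G\<^esub> c) \<longleftrightarrow> \<tau> K H"
proof -
  define T where "T = {h <#\<^bsub>G\<^esub> K | h. h \<in> H}"
  let ?a = "\<lambda>h c. h <#\<^bsub>G\<^esub> c"
  have HG: "h \<in> carrier G" if "h \<in> H" for h
    using that H subgroup.mem_carrier by metis
  have one_H: "\<one>\<^bsub>G\<^esub> \<in> H"
    using H by (rule subgroup.one_closed)
  have bij: "bij_betw (?a h) T T" if "h \<in> H" for h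
    unfolding T_def using H K KH that by (rule G.bij_betw_left_cosets)
  have KT: "K \<in> T"
    using one_H G.lcos_mult_one[OF subgroup.subset[OF K]] unfolding T_def by force
  have TH: "c \<subseteq> H" if "c \<in> T" for c
    using that G.lcos_subset[OF H] KH unfolding T_def by blast
  then have TG: "c \<subseteq> carrier G" if "c \<in> T" for c
    using that HG by blast
  have finite_T: "finite T"
    using H finite_G subgroup.subset[OF H] unfolding T_def by (simp add: finite_subset)
  have perm: "action_perm T ?a e h permutes {1..card T}"
    if "bij_betw e T {1..card T}" "h \<in> H" for e h
    using that bij by (intro action_perm_permutes)
  have fixed_iff: "op_grp \<O> (card T) h (op_perm \<O> (card T) (action_perm T ?a e h) x) = x \<longleftrightarrow>
      (\<forall>k\<in>carrier G. \<forall>c\<in>T. x (h \<otimes>\<^bsub>G\<^esub> k, e (h <#\<^bsub>G\<^esub> c)) = x (k, e c))"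
    if e: "bij_betw e T {1..card T}" and h: "h \<in> H" and x: "x \<in> op_set \<O> (card T)" for e h x
  proof -
    have "(\<forall>i\<in>{1..card T}. x (h \<otimes>\<^bsub>G\<^esub> k, action_perm T ?a e h i) = x (k, i)) \<longleftrightarrow>
        (\<forall>c\<in>T. x (h \<otimes>\<^bsub>G\<^esub> k, e (h <#\<^bsub>G\<^esub> c)) = x (k, e c))" for k
      unfolding bij_betw_imp_surj_on[OF e, symmetric] ball_simps(9)
      by (intro ball_cong) (simp_all add: action_perm_apply[OF e])
    then show ?thesis
      unfolding O_fixed_iff[OF perm[OF e h] HG[OF h] x] by simp
  qed
  have "admissible (R\<tau> \<tau>) H T ?a \<longleftrightarrow> \<tau> K H"
  proof
    assume "admissible (R\<tau> \<tau>) H T ?a"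
    then obtain e x where e: "bij_betw e T {1..card T}" and x: "x \<in> op_set (R\<tau> \<tau>) (card T)"
      and fixed: "\<And>h. h \<in> H
        \<Longrightarrow> op_grp \<O> (card T) h (op_perm \<O> (card T) (action_perm T ?a e h) x) = x"
      unfolding admissible_def R_tau_simps by blast
    have xO: "x \<in> op_set \<O> (card T)"
      using x by (simp add: R_tau_set R_set)
    have hK: "h <#\<^bsub>G\<^esub> K \<in> T" if "h \<in> H" for h
      using that by (auto simp: T_def)
    have const: "x (h \<otimes>\<^bsub>G\<^esub> \<one>\<^bsub>G\<^esub>, e (h <#\<^bsub>G\<^esub> K)) = x (\<one>\<^bsub>G\<^esub>, e K)" if "h \<in> H" for h
      using fixed[OF that] fixed_iff[OF e that xO] KT by blast
    have K_eq: "{h \<in> H. e (h <#\<^bsub>G\<^esub> K) = e K} = K"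
    proof -
      have "e (h <#\<^bsub>G\<^esub> K) = e K \<longleftrightarrow> h \<in> K" if h: "h \<in> H" for h
      proof -
        have "e (h <#\<^bsub>G\<^esub> K) = e K \<longleftrightarrow> h <#\<^bsub>G\<^esub> K = K"
          using inj_on_eq_iff[OF bij_betw_imp_inj_on[OF e] hK[OF h] KT] .
        also have "\<dots> \<longleftrightarrow> h \<in> K"
          using G.lcos_eq_self_iff[OF K HG[OF h] G.one_closed] HG[OF h]
            G.lcos_mult_one[OF subgroup.subset[OF K]] by simp
        finally show ?thesis .
      qed
      then show ?thesis
        using KH by blast
    qed
    have "supports_transfer G M (card T) x K H"
    proof (rule supports_transferI)
      show "\<one>\<^bsub>G\<^esub> \<in> carrier G" "subgroup H G"
        using H by simp_all
      show "e (h <#\<^bsub>G\<^esub> K) \<in> {1..card T}" if "h \<in> H" for h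
        using e hK[OF that] by (rule bij_betw_apply)
      show "maximal_subgroup_in G K {h \<in> H. e (h <#\<^bsub>G\<^esub> K) = e K}"
        unfolding K_eq using K by (simp add: maximal_subgroup_in_self)
      have "x (\<one>\<^bsub>G\<^esub>, e K) \<in> carrier M"
        using O_mem[OF xO G.one_closed] bij_betw_apply[OF e KT] by blast
      then show "meets M (x (h1 \<otimes>\<^bsub>G\<^esub> \<one>\<^bsub>G\<^esub>, e (h1 <#\<^bsub>G\<^esub> K))) (x (h2 \<otimes>\<^bsub>G\<^esub> \<one>\<^bsub>G\<^esub>, e (h2 <#\<^bsub>G\<^esub> K)))"
        if "h1 \<in> H" "h2 \<in> H" for h1 h2
        unfolding const[OF that(1)] const[OF that(2)] by (rule M.meets_refl)
    qed
    then show "\<tau> K H"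
      using x by (simp add: R_tau_set)
  next
    assume KH\<tau>: "\<tau> K H"
    obtain s :: "nat \<Rightarrow> 'm" where s: "\<And>k. s k \<in> carrier M" "\<And>k l. meets M (s k) (s l) \<Longrightarrow> k = l"
      using disjoint_sequence[OF M] by blast
    obtain e where e: "bij_betw e T {1..card T}"
      using finite_T ex_bij_betw_finite_nat[OF finite_T] bij_betw_iff_card[of T "{1..card T}"] by auto
    obtain idx :: "'g set \<Rightarrow> nat" where idx: "inj_on idx (Pow (carrier G))"
      using finite_G finite_imp_inj_to_nat_seg[of "Pow (carrier G)"] by auto
    define d where "d = inv_into T e"
    have d: "d i \<in> T" "e (d i) = i" if "i \<in> {1..card T}" for i
      using that e bij_betw_apply[OF bij_betw_inv_into[OF e]] bij_betw_inv_into_right[OF e]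
      unfolding d_def by blast+
    have de: "d (e c) = c" if "c \<in> T" for c
      using that e unfolding d_def by (rule bij_betw_inv_into_left[rotated])
    \<comment> \<open>The index is a subset of \<open>G\<close>, not just a coset in \<open>H\<close>, so that it also separates the rows of
      different right cosets of \<open>H\<close>.\<close>
    define x where "x = (\<lambda>(k, i)\<in>carrier G \<times> {1..card T}. s (idx (inv\<^bsub>G\<^esub> k <#\<^bsub>G\<^esub> d i)))"
    have x_apply: "x (k, i) = s (idx (inv\<^bsub>G\<^esub> k <#\<^bsub>G\<^esub> d i))" if "k \<in> carrier G" "i \<in> {1..card T}" for k i
      using that by (simp add: x_def)
    have x_meets: "inv\<^bsub>G\<^esub> k <#\<^bsub>G\<^esub> d i = inv\<^bsub>G\<^esub> l <#\<^bsub>G\<^esub> d j"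
      if "meets M (x (k, i)) (x (l, j))" "k \<in> carrier G" "l \<in> carrier G"
        "i \<in> {1..card T}" "j \<in> {1..card T}" for k l i j
    proof -
      have "idx (inv\<^bsub>G\<^esub> k <#\<^bsub>G\<^esub> d i) = idx (inv\<^bsub>G\<^esub> l <#\<^bsub>G\<^esub> d j)"
        using that s(2) by (simp only: x_apply)
      moreover have "inv\<^bsub>G\<^esub> k <#\<^bsub>G\<^esub> d i \<in> Pow (carrier G)" "inv\<^bsub>G\<^esub> l <#\<^bsub>G\<^esub> d j \<in> Pow (carrier G)"
        unfolding Pow_iff by (intro G.l_coset_subset_G G.inv_closed TG d(1) that(2-5))+
      ultimately show ?thesis
        using idx by (meson inj_onD)
    qed
    have xO: "x \<in> op_set \<O> (card T)"
      unfolding O_set x_def using s by auto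
    have xR: "x \<in> op_set \<R> (card T)"
      unfolding R_set
    proof (intro CollectI conjI xO)
      show "sigma_disjoint G M (card T) x"
        unfolding sigma_disjoint_def
      proof (intro ballI impI notI)
        fix g i j assume g: "g \<in> carrier G" and i: "i \<in> {1..card T}" and j: "j \<in> {1..card T}"
          and "i \<noteq> j" and meets: "meets M (x (g, i)) (x (g, j))"
        have "g <#\<^bsub>G\<^esub> (inv\<^bsub>G\<^esub> g <#\<^bsub>G\<^esub> d i) = g <#\<^bsub>G\<^esub> (inv\<^bsub>G\<^esub> g <#\<^bsub>G\<^esub> d j)"
          using x_meets[OF meets g g i j] by (rule arg_cong)
        then have "d i = d j"
          unfolding G.lcos_cancel(2)[OF TG[OF d(1)[OF i]] g] G.lcos_cancel(2)[OF TG[OF d(1)[OF j]] g] .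
        then show False
          using d(2)[OF i] d(2)[OF j] \<open>i \<noteq> j\<close> by simp
      qed
      show "strict_columns G M (card T) x"
        unfolding strict_columns_def
      proof (intro ballI disjCI)
        fix i g h assume i: "i \<in> {1..card T}" and g: "g \<in> carrier G" and h: "h \<in> carrier G"
          and "\<not> \<not> meets M (x (g, i)) (x (h, i))"
        then show "x (g, i) = x (h, i)"
          using x_meets[OF _ g h i i] by (simp only: x_apply not_not)
      qed
    qed
    have "\<tau> K' H'" if supp: "supports_transfer G M (card T) x K' H'" for K' H'
    proof -
      obtain a p g where g: "g \<in> carrier G" and H': "subgroup H' G"
        and a: "\<And>h. h \<in> H' \<Longrightarrow> a h \<in> {1..card T}"
        and K': "maximal_subgroup_in G K' {h \<in> H'. a h = p}"
        and meets: "\<And>h1 h2. h1 \<in> H' \<Longrightarrow> h2 \<in> H'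
          \<Longrightarrow> meets M (x (h1 \<otimes>\<^bsub>G\<^esub> g, a h1)) (x (h2 \<otimes>\<^bsub>G\<^esub> g, a h2))"
        using supp by (rule supports_transferE) blast
      have HG': "h \<in> carrier G" if "h \<in> H'" for h
        using that H' subgroup.mem_carrier by metis
      have one_H': "\<one>\<^bsub>G\<^esub> \<in> H'"
        using H' by (rule subgroup.one_closed)
      define c where "c = d (a \<one>\<^bsub>G\<^esub>)"
      have c: "c \<in> T"
        unfolding c_def using a[OF one_H'] by (rule d)
      have dc: "d (a h) = h <#\<^bsub>G\<^esub> c" if h: "h \<in> H'" for h
      proof -
        have hG: "h \<in> carrier G" and hg: "h \<otimes>\<^bsub>G\<^esub> g \<in> carrier G"
          using h HG' g by auto
        have "inv\<^bsub>G\<^esub> (h \<otimes>\<^bsub>G\<^esub> g) <#\<^bsub>G\<^esub> d (a h) = inv\<^bsub>G\<^esub> (\<one>\<^bsub>G\<^esub> \<otimes>\<^bsub>G\<^esub> g) <#\<^bsub>G\<^esub> d (a \<one>\<^bsub>G\<^esub>)"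
          using x_meets[OF meets[OF h one_H'] hg _ a[OF h] a[OF one_H']] g by simp
        then have "(h \<otimes>\<^bsub>G\<^esub> g) <#\<^bsub>G\<^esub> (inv\<^bsub>G\<^esub> (h \<otimes>\<^bsub>G\<^esub> g) <#\<^bsub>G\<^esub> d (a h))
            = (h \<otimes>\<^bsub>G\<^esub> g) <#\<^bsub>G\<^esub> (inv\<^bsub>G\<^esub> g <#\<^bsub>G\<^esub> c)"
          using g by (simp add: c_def)
        also have "\<dots> = h <#\<^bsub>G\<^esub> c"
          using hG hg g TG[OF c] by (simp add: G.lcos_m_assoc G.m_assoc)
        finally show ?thesis
          using G.lcos_cancel(2)[OF TG[OF d(1)[OF a[OF h]]] hg] by simp
      qed
      obtain k where k: "k \<in> H" "c = k <#\<^bsub>G\<^esub> K"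
        using c unfolding T_def by blast
      have kc: "k \<in> c"
        using k HG subgroup.one_closed[OF K] by (force simp: l_coset_def)
      \<comment> \<open>For \<open>h\<close> in \<open>H'\<close>, the cosets \<open>c\<close> and \<open>h c\<close> both consist of elements of \<open>H\<close>.\<close>
      have H'H: "H' \<subseteq> H"
      proof
        fix h assume h: "h \<in> H'"
        have "h \<otimes>\<^bsub>G\<^esub> k \<in> h <#\<^bsub>G\<^esub> c"
          using kc unfolding l_coset_def by blast
        then have "h \<otimes>\<^bsub>G\<^esub> k \<in> H"
          using dc[OF h] TH[OF d(1)[OF a[OF h]]] by auto
        then have "h \<otimes>\<^bsub>G\<^esub> k \<otimes>\<^bsub>G\<^esub> inv\<^bsub>G\<^esub> k \<in> H"
          using H k(1) by (simp add: subgroup.m_closed subgroup.m_inv_closed)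
        then show "h \<in> H"
          using HG'[OF h] HG[OF k(1)] by (simp add: G.m_assoc)
      qed
      let ?c = "\<lambda>h. inv\<^bsub>G\<^esub> (inv\<^bsub>G\<^esub> k) \<otimes>\<^bsub>G\<^esub> h \<otimes>\<^bsub>G\<^esub> inv\<^bsub>G\<^esub> k"
      have kG: "k \<in> carrier G"
        using k(1) by (rule HG)
      have KG: "K \<subseteq> carrier G"
        using K by (rule subgroup.subset)
      have cH: "?c ` H = H"
      proof -
        have "h \<in> ?c ` H" if "h \<in> H" for h
        proof
          show "inv\<^bsub>G\<^esub> k \<otimes>\<^bsub>G\<^esub> h \<otimes>\<^bsub>G\<^esub> k \<in> H"
            using H k(1) that by (simp add: subgroup.m_closed subgroup.m_inv_closed)
          show "h = ?c (inv\<^bsub>G\<^esub> k \<otimes>\<^bsub>G\<^esub> h \<otimes>\<^bsub>G\<^esub> k)"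
            using HG[OF that] kG by (simp add: G.m_assoc G.mult_inv_cancel)
        qed
        moreover have "?c h \<in> H" if "h \<in> H" for h
          using H k(1) kG that by (simp add: subgroup.m_closed subgroup.m_inv_closed)
        ultimately show ?thesis
          by blast
      qed
      have cK: "h \<in> ?c ` K \<longleftrightarrow> inv\<^bsub>G\<^esub> k \<otimes>\<^bsub>G\<^esub> h \<otimes>\<^bsub>G\<^esub> k \<in> K" if h: "h \<in> carrier G" for h
      proof
        assume "h \<in> ?c ` K"
        then obtain u where "u \<in> K" "h = ?c u"
          by blast
        then show "inv\<^bsub>G\<^esub> k \<otimes>\<^bsub>G\<^esub> h \<otimes>\<^bsub>G\<^esub> k \<in> K"
          using KG kG by (simp add: G.m_assoc G.mult_inv_cancel subset_iff)
      next
        assume "inv\<^bsub>G\<^esub> k \<otimes>\<^bsub>G\<^esub> h \<otimes>\<^bsub>G\<^esub> k \<in> K"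
        moreover have "h = ?c (inv\<^bsub>G\<^esub> k \<otimes>\<^bsub>G\<^esub> h \<otimes>\<^bsub>G\<^esub> k)"
          using h kG by (simp add: G.m_assoc G.mult_inv_cancel)
        ultimately show "h \<in> ?c ` K"
          by (rule rev_image_eqI)
      qed
      have "\<one>\<^bsub>G\<^esub> \<in> {h \<in> H'. a h = p}"
        using K' subgroup.one_closed unfolding maximal_subgroup_in_def by blast
      then have p: "p = a \<one>\<^bsub>G\<^esub>"
        by simp
      have "a h = p \<longleftrightarrow> h \<in> ?c ` K" if h: "h \<in> H'" for h
      proof -
        have "a h = p \<longleftrightarrow> d (a h) = c"
          unfolding p c_def using d(2)[OF a[OF h]] d(2)[OF a[OF one_H']] by metis
        also have "\<dots> \<longleftrightarrow> h \<in> ?c ` K"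
          unfolding dc[OF h] k(2) cK[OF HG'[OF h]]
          using K HG'[OF h] kG by (rule G.lcos_eq_self_iff)
        finally show ?thesis .
      qed
      then have "{h \<in> H'. a h = p} = ?c ` K \<inter> H'"
        by blast
      moreover have "subgroup (?c ` K \<inter> H') G"
        using G.subgroup_conjugate[OF K G.inv_closed[OF kG]] H' by (rule G.subgroups_Inter_pair)
      ultimately have "K' = ?c ` K \<inter> H'"
        using K' maximal_subgroup_in_self by metis
      moreover have "\<tau> (?c ` K) (?c ` H)"
        using \<tau> KH\<tau> G.inv_closed[OF kG] unfolding transfer_system_def by blast
      then have "\<tau> (?c ` K \<inter> H') H'"
        using \<tau> H' H'H unfolding transfer_system_def cH by blast
      ultimately show ?thesis
        by simp
    qed
    then have "x \<in> op_set (R\<tau> \<tau>) (card T)"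
      using xR by (simp add: R_tau_set)
    moreover have "op_grp \<O> (card T) h (op_perm \<O> (card T) (action_perm T ?a e h) x) = x"
      if h: "h \<in> H" for h
      unfolding fixed_iff[OF e h xO]
    proof (intro ballI)
      fix k c assume k: "k \<in> carrier G" and c: "c \<in> T"
      have hc: "h <#\<^bsub>G\<^esub> c \<in> T"
        using bij[OF h] c by (rule bij_betw_apply)
      have "inv\<^bsub>G\<^esub> (h \<otimes>\<^bsub>G\<^esub> k) <#\<^bsub>G\<^esub> (h <#\<^bsub>G\<^esub> c) = inv\<^bsub>G\<^esub> k <#\<^bsub>G\<^esub> c"
        using k HG[OF h] TG[OF c] by (simp add: G.lcos_m_assoc G.inv_mult_group G.m_assoc)
      then show "x (h \<otimes>\<^bsub>G\<^esub> k, e (h <#\<^bsub>G\<^esub> c)) = x (k, e c)"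
        using k HG[OF h] bij_betw_apply[OF e] c hc
        by (simp del: atLeastAtMost_iff add: x_apply de)
    qed
    ultimately show "admissible (R\<tau> \<tau>) H T ?a"
      unfolding admissible_def R_tau_simps using e by blast
  qed
  then show ?thesis
    unfolding T_def .
qed

lemma R_tau_realizes:
  assumes \<tau>: "transfer_system G \<tau>" and M: "\<not> trivial_imonoid M"
  shows "realizes G (R\<tau> \<tau>) \<tau>"
proof -
  have "\<sigma> = id" if "x \<in> op_set (R\<tau> \<tau>) n" "\<sigma> permutes {1..n}" "op_perm (R\<tau> \<tau>) n \<sigma> x = x" for n \<sigma> x
    using that R_perm_free unfolding R_tau_simps R_tau_set by blast
  moreover have "\<exists>x\<in>op_set (R\<tau> \<tau>) 2. \<forall>h\<in>H. op_grp (R\<tau> \<tau>) 2 h (op_perm (R\<tau> \<tau>) 2 id x) = x"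
    if "subgroup H G" for H
    using R_tau_fixed_binary[OF \<tau> M] subgroup.mem_carrier[OF that] unfolding R_tau_simps by metis
  ultimately show ?thesis
    unfolding realizes_def using R_tau_admissible_iff[OF \<tau> M] by blast
qed

end

section \<open>Comparison with the coinduced operad\<close>

lemma realizes_g_operad_iso:
  assumes P: "g_operad C G P" and iso: "g_operad_iso G \<phi> P Q" and real: "realizes G P \<tau>"
  shows "realizes G Q \<tau>"
proof -
  interpret P: g_operad C G P by fact
  have hom: "homeomorphic_map (op_lev P n) (op_lev Q n) (\<phi> n)" for n
    using iso unfolding g_operad_iso_def by blast
  have surj: "\<phi> n ` op_set P n = op_set Q n" for n
    using hom by (rule homeomorphic_imp_surjective_map)
  have inj: "inj_on (\<phi> n) (op_set P n)" for n
    using hom by (rule homeomorphic_imp_injective_map)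
  have perm: "\<phi> n (op_perm P n \<sigma> x) = op_perm Q n \<sigma> (\<phi> n x)"
    if "x \<in> op_set P n" "\<sigma> permutes {1..n}" for n \<sigma> x
    using iso that unfolding g_operad_iso_def by blast
  have grp: "\<phi> n (op_grp P n g x) = op_grp Q n g (\<phi> n x)"
    if "x \<in> op_set P n" "g \<in> carrier G" for n g x
    using iso that unfolding g_operad_iso_def by blast
  have fixed_iff: "op_grp Q n g (op_perm Q n \<sigma> (\<phi> n x)) = \<phi> n x \<longleftrightarrow> op_grp P n g (op_perm P n \<sigma> x) = x"
    if "x \<in> op_set P n" "\<sigma> permutes {1..n}" "g \<in> carrier G" for n \<sigma> g x
  proof -
    have "op_grp Q n g (op_perm Q n \<sigma> (\<phi> n x)) = \<phi> n (op_grp P n g (op_perm P n \<sigma> x))"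
      using that by (simp only: grp perm P.perm_closed)
    moreover have "op_grp P n g (op_perm P n \<sigma> x) \<in> op_set P n"
      using that by (intro P.grp_closed P.perm_closed)
    ultimately show ?thesis
      using inj_on_eq_iff[OF inj _ that(1)] by metis
  qed
  have "\<sigma> = id" if "y \<in> op_set Q n" "\<sigma> permutes {1..n}" "op_perm Q n \<sigma> y = y" for n \<sigma> y
  proof -
    obtain x where x: "x \<in> op_set P n" "y = \<phi> n x"
      using \<open>y \<in> op_set Q n\<close> surj by blast
    have "op_perm P n \<sigma> x = x"
      using that(3) x perm[OF x(1) that(2)] P.perm_closed[OF that(2) x(1)]
        inj_on_eq_iff[OF inj _ x(1)] by metis
    then show ?thesis
      using real x(1) that(2) unfolding realizes_def by blast
  qed
  moreover have "\<exists>y\<in>op_set Q 2. \<forall>h\<in>H. op_grp Q 2 h (op_perm Q 2 id y) = y" if "subgroup H G" for H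
  proof -
    obtain x where "x \<in> op_set P 2" "\<forall>h\<in>H. op_grp P 2 h (op_perm P 2 id x) = x"
      using real \<open>subgroup H G\<close> unfolding realizes_def by blast
    then show ?thesis
      using fixed_iff[OF _ permutes_id] surj[of 2] subgroup.mem_carrier[OF \<open>subgroup H G\<close>] by blast
  qed
  moreover have "admissible Q H {h <#\<^bsub>G\<^esub> K | h. h \<in> H} (\<lambda>h c. h <#\<^bsub>G\<^esub> c) \<longleftrightarrow> \<tau> K H"
    if "subgroup K G" "subgroup H G" "K \<subseteq> H" for K H
  proof -
    let ?T = "{h <#\<^bsub>G\<^esub> K | h. h \<in> H}" and ?a = "\<lambda>h c. h <#\<^bsub>G\<^esub> c"
    have "(\<exists>y\<in>op_set Q (card ?T). \<forall>h\<in>H.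
          op_grp Q (card ?T) h (op_perm Q (card ?T) (action_perm ?T ?a e h) y) = y) \<longleftrightarrow>
        (\<exists>x\<in>op_set P (card ?T). \<forall>h\<in>H.
          op_grp P (card ?T) h (op_perm P (card ?T) (action_perm ?T ?a e h) x) = x)"
      if e: "bij_betw e ?T {1..card ?T}" for e
    proof -
      have "action_perm ?T ?a e h permutes {1..card ?T}" if "h \<in> H" for h
        using e P.bij_betw_left_cosets[OF \<open>subgroup H G\<close> \<open>subgroup K G\<close> \<open>K \<subseteq> H\<close> that]
        by (rule action_perm_permutes)
      then show ?thesis
        unfolding surj[of "card ?T", symmetric] bex_simps(7)
        by (intro bex_cong ball_cong refl)
          (simp only: fixed_iff subgroup.mem_carrier[OF \<open>subgroup H G\<close>])
    qed
    then have "admissible Q H ?T ?a \<longleftrightarrow> admissible P H ?T ?a"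
      unfolding admissible_def by (intro ex_cong1 conj_cong refl)
    then show ?thesis
      using real that unfolding realizes_def by blast
  qed
  ultimately show ?thesis
    unfolding realizes_def by blast
qed

text \<open>The intersection operad of \<open>M\<close> is the case of the one-element group. This locale is separate from
  \<^locale>\<open>imonoid_group\<close> so that the one-element group can be made an instance of the latter.\<close>

locale coinduced_intersection_operad = imonoid_group C G M
  for C :: ground and G :: "('g, 'b) monoid_scheme" and M :: "('m, 'z) imonoid_scheme"
begin

sublocale pt: imonoid_group C "singleton_group ()" M
  by (intro imonoid_group.intro imonoid_group_axioms.intro singleton_group M.intersection_monoid_axioms)
    simp

abbreviation \<N> :: "('g \<Rightarrow> unit \<times> nat \<Rightarrow> 'm, 'g) g_operad_data" where
  "\<N> \<equiv> coinduced G pt.\<R>"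

lemma pt_R_ops:
  "op_perm pt.\<R> = op_perm pt.\<O>" "op_unit pt.\<R> = op_unit pt.\<O>" "op_comp pt.\<R> = op_comp pt.\<O>"
  by (simp_all add: R_operad_def)

lemma operad_pt_R: "operad C pt.\<R>"
  using pt.g_suboperad_R unfolding g_suboperad_def g_operad_def by blast

lemma g_operad_N: "g_operad C G \<N>"
  using operad_pt_R G.is_group finite_G by (rule g_operad_coinduced)

lemma N_set: "op_set \<N> n = carrier G \<rightarrow>\<^sub>E op_set pt.\<R> n"
  by (rule op_set_coinduced)

lemma N_imp_pt_O: "f \<in> op_set \<N> n \<Longrightarrow> h \<in> carrier G \<Longrightarrow> f h \<in> op_set pt.\<O> n"
  unfolding N_set by (rule pt.R_imp_O) (rule PiE_mem)

lemma ident_apply: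
  "h \<in> carrier G \<Longrightarrow> i \<in> {1..n} \<Longrightarrow> coinduced_ident G n x h ((), i) = x (h, i)"
  by (simp add: coinduced_ident_def)

lemma ident_closed:
  assumes x: "x \<in> op_set \<R> n"
  shows "coinduced_ident G n x \<in> op_set \<N> n"
  unfolding N_set
proof (rule PiE_I)
  fix h assume h: "h \<in> carrier G"
  have mem: "x (h, i) \<in> carrier M" if "i \<in> {1..n}" for i
    using O_mem[OF R_imp_O[OF x] h that] .
  have O: "coinduced_ident G n x h \<in> op_set pt.\<O> n"
    unfolding pt.O_set using h mem by (auto simp: coinduced_ident_def)
  have "sigma_disjoint (singleton_group ()) M n (coinduced_ident G n x h)"
    unfolding sigma_disjoint_def
    using h R_sigma_disjointD[OF x _ h] by (simp del: atLeastAtMost_iff add: ident_apply) blast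
  then show "coinduced_ident G n x h \<in> op_set pt.\<R> n"
    unfolding pt.R_set using O by (simp add: strict_columns_def)
qed (simp add: coinduced_ident_def)

lemma N_eqI:
  assumes f: "f \<in> op_set \<N> n" and f': "f' \<in> op_set \<N> n"
    and eq: "\<And>h i. h \<in> carrier G \<Longrightarrow> i \<in> {1..n} \<Longrightarrow> f h ((), i) = f' h ((), i)"
  shows "f = f'"
proof (rule PiE_ext)
  show "f \<in> carrier G \<rightarrow>\<^sub>E op_set pt.\<R> n" "f' \<in> carrier G \<rightarrow>\<^sub>E op_set pt.\<R> n"
    using f f' unfolding N_set .
  fix h assume h: "h \<in> carrier G"
  show "f h = f' h"
    by (rule pt.O_eqI[OF N_imp_pt_O[OF f h] N_imp_pt_O[OF f' h]]) (use eq[OF h] in simp)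
qed

lemma ident_unit: "coinduced_ident G 1 (op_unit \<O>) = op_unit \<N>"
proof -
  interpret N: g_operad C G \<N>
    by (rule g_operad_N)
  have "op_unit \<O> \<in> op_set \<R> 1"
    using operad.unit_closed[of C \<R>] g_suboperad_R by (simp add: g_suboperad_def g_operad_def)
  then show ?thesis
  proof (intro N_eqI[OF ident_closed N.unit_closed])
    fix h i assume "h \<in> carrier G" "i \<in> {1..1 :: nat}"
    then show "coinduced_ident G 1 (op_unit \<O>) h ((), i) = op_unit \<N> h ((), i)"
      using O_unit pt.O_unit by (simp add: ident_apply coinduced_simps pt_R_ops)
  qed
qed

lemma ident_perm:
  assumes \<sigma>: "\<sigma> permutes {1..n}" and x: "x \<in> op_set \<R> n"
  shows "coinduced_ident G n (op_perm \<O> n \<sigma> x) = op_perm \<N> n \<sigma> (coinduced_ident G n x)"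
proof (rule N_eqI)
  interpret R: g_operad C G \<R>
    using g_suboperad_R by (simp add: g_suboperad_def)
  interpret N: g_operad C G \<N>
    by (rule g_operad_N)
  show "coinduced_ident G n (op_perm \<O> n \<sigma> x) \<in> op_set \<N> n"
    using R.perm_closed[OF \<sigma> x] by (intro ident_closed) (simp add: R_operad_def)
  show "op_perm \<N> n \<sigma> (coinduced_ident G n x) \<in> op_set \<N> n"
    by (intro N.perm_closed \<sigma> ident_closed x)
  fix h i assume h: "h \<in> carrier G" and i: "i \<in> {1..n}"
  have "inv_into UNIV \<sigma> i \<in> {1..n}"
    using i permutes_inv[OF \<sigma>] by (simp only: permutes_in_image)
  then show "coinduced_ident G n (op_perm \<O> n \<sigma> x) h ((), i)
    = op_perm \<N> n \<sigma> (coinduced_ident G n x) h ((), i)"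
    using h i by (simp del: atLeastAtMost_iff
        add: ident_apply coinduced_simps pt_R_ops O_perm_apply pt.O_perm_apply)
qed

lemma ident_grp:
  assumes g: "g \<in> carrier G" and x: "x \<in> op_set \<R> n"
  shows "coinduced_ident G n (op_grp \<O> n g x) = op_grp \<N> n g (coinduced_ident G n x)"
proof (rule N_eqI)
  interpret R: g_operad C G \<R>
    using g_suboperad_R by (simp add: g_suboperad_def)
  interpret N: g_operad C G \<N>
    by (rule g_operad_N)
  show "coinduced_ident G n (op_grp \<O> n g x) \<in> op_set \<N> n"
    using R.grp_closed[OF g x] by (intro ident_closed) (simp add: R_operad_def)
  show "op_grp \<N> n g (coinduced_ident G n x) \<in> op_set \<N> n"
    by (intro N.grp_closed g ident_closed x)
qed (use g in \<open>simp del: atLeastAtMost_iff add: ident_apply coinduced_simps O_grp_apply\<close>)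

lemma ident_comp:
  assumes i: "i \<in> {1..n}" and x: "x \<in> op_set \<R> n" and y: "y \<in> op_set \<R> m"
  shows "coinduced_ident G (n + m - 1) (op_comp \<O> n m i x y)
    = op_comp \<N> n m i (coinduced_ident G n x) (coinduced_ident G m y)" (is "?l = ?r")
proof (rule N_eqI)
  interpret R: g_operad C G \<R>
    using g_suboperad_R by (simp add: g_suboperad_def)
  interpret N: g_operad C G \<N>
    by (rule g_operad_N)
  show "?l \<in> op_set \<N> (n + m - 1)"
    using R.comp_closed[OF i x y] by (intro ident_closed) (simp add: R_operad_def)
  show "?r \<in> op_set \<N> (n + m - 1)"
    by (intro N.comp_closed i ident_closed x y)
  fix h k assume h: "h \<in> carrier G" and k: "k \<in> {1..n + m - 1}"
  have r: "?r h = op_comp pt.\<O> n m i (coinduced_ident G n x h) (coinduced_ident G m y h)"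
    using h by (simp add: coinduced_simps pt_R_ops)
  have l: "?l h ((), k) = op_comp \<O> n m i x y (h, k)"
    using h k by (rule ident_apply)
  from i k show "?l h ((), k) = ?r h ((), k)"
  proof (cases rule: comp_position_cases)
    case (outer a)
    then have "?r h ((), k) = coinduced_ident G n x h ((), a)"
      using i unfolding r by (simp del: atLeastAtMost_iff add: pt.O_comp_outer)
    then show ?thesis
      unfolding l using outer h i by (simp del: atLeastAtMost_iff add: ident_apply O_comp_outer)
  next
    case (inner b)
    have "?r h ((), i + b - 1)
        = coinduced_ident G n x h ((), i) \<otimes>\<^bsub>M\<^esub> coinduced_ident G m y h ((), b)"
      unfolding r by (rule pt.O_comp_inner) (use i inner in auto)
    then show ?thesis
      unfolding l using inner h i by (simp only: ident_apply O_comp_inner)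
  qed
qed

definition unident :: "nat \<Rightarrow> ('g \<Rightarrow> unit \<times> nat \<Rightarrow> 'm) \<Rightarrow> 'g \<times> nat \<Rightarrow> 'm" where
  "unident n f = (\<lambda>(h, i)\<in>carrier G \<times> {1..n}. f h ((), i))"

lemma unident_ident:
  assumes "x \<in> op_set \<O> n"
  shows "unident n (coinduced_ident G n x) = x"
proof (rule O_eqI)
  show "unident n (coinduced_ident G n x) \<in> op_set \<O> n"
    using O_mem[OF assms] unfolding O_set
    by (auto simp del: atLeastAtMost_iff simp: unident_def ident_apply)
qed (use assms in \<open>simp_all del: atLeastAtMost_iff add: unident_def ident_apply\<close>)

definition N\<tau> :: "('g set \<Rightarrow> 'g set \<Rightarrow> bool) \<Rightarrow> ('g \<Rightarrow> unit \<times> nat \<Rightarrow> 'm, 'g) g_operad_data" where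
  "N\<tau> \<tau> = restrict_levels \<N> (\<lambda>n. coinduced_ident G n ` op_set (R\<tau> \<tau>) n)"

context
  fixes \<tau>
  assumes \<tau>: "transfer_system G \<tau>"
begin

lemma R_tau_imp_R: "x \<in> op_set (R\<tau> \<tau>) n \<Longrightarrow> x \<in> op_set \<R> n"
  by (simp add: R_tau_set)

lemma g_operad_R_tau: "g_operad C G (R\<tau> \<tau>)"
  using g_suboperad_R_tau[OF \<tau>] by (simp add: g_suboperad_def)

lemma g_suboperad_N_tau: "g_suboperad C G (N\<tau> \<tau>) \<N>"
  unfolding N\<tau>_def
proof (rule g_suboperad_restrict_levels[OF g_operad_N])
  interpret R\<tau>: g_operad C G "R\<tau> \<tau>"
    by (rule g_operad_R_tau)
  let ?S = "\<lambda>n. coinduced_ident G n ` op_set (R\<tau> \<tau>) n"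
  show "?S n \<subseteq> op_set \<N> n" for n
    using R_tau_imp_R ident_closed by blast
  show "op_unit \<N> \<in> ?S 1"
    unfolding ident_unit[symmetric] using R\<tau>.unit_closed unfolding R_tau_simps by (rule imageI)
  show "op_perm \<N> n \<sigma> f \<in> ?S n" if \<sigma>: "\<sigma> permutes {1..n}" and "f \<in> ?S n" for n \<sigma> f
  proof -
    obtain x where x: "x \<in> op_set (R\<tau> \<tau>) n" "f = coinduced_ident G n x"
      using \<open>f \<in> ?S n\<close> by blast
    show ?thesis
      unfolding x(2) ident_perm[OF \<sigma> R_tau_imp_R[OF x(1)], symmetric]
      using R\<tau>.perm_closed[OF \<sigma> x(1)] unfolding R_tau_simps by (rule imageI)
  qed
  show "op_grp \<N> n g f \<in> ?S n" if g: "g \<in> carrier G" and "f \<in> ?S n" for n g f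
  proof -
    obtain x where x: "x \<in> op_set (R\<tau> \<tau>) n" "f = coinduced_ident G n x"
      using \<open>f \<in> ?S n\<close> by blast
    show ?thesis
      unfolding x(2) ident_grp[OF g R_tau_imp_R[OF x(1)], symmetric]
      using R\<tau>.grp_closed[OF g x(1)] unfolding R_tau_simps by (rule imageI)
  qed
  show "op_comp \<N> n m i f f' \<in> ?S (n + m - 1)"
    if i: "i \<in> {1..n}" and "f \<in> ?S n" "f' \<in> ?S m" for n m i f f'
  proof -
    obtain x y where x: "x \<in> op_set (R\<tau> \<tau>) n" "f = coinduced_ident G n x"
      and y: "y \<in> op_set (R\<tau> \<tau>) m" "f' = coinduced_ident G m y"
      using \<open>f \<in> ?S n\<close> \<open>f' \<in> ?S m\<close> by blast
    show ?thesis
      unfolding x(2) y(2) ident_comp[OF i R_tau_imp_R[OF x(1)] R_tau_imp_R[OF y(1)], symmetric]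
      using R\<tau>.comp_closed[OF i x(1) y(1)] unfolding R_tau_simps by (rule imageI)
  qed
qed

text \<open>Both topologies are iterated refinements of subspaces and products. By the universal property of
  the refinement, continuity into either of them can be tested on the coordinates with values in
  \<open>M\<close>, and coordinates are continuous on both.\<close>

lemma homeomorphic_map_ident:
  "homeomorphic_map (op_lev (R\<tau> \<tau>) n) (op_lev (N\<tau> \<tau>) n) (coinduced_ident G n)"
proof (rule homeomorphic_maps_imp_map)
  interpret R\<tau>: g_operad C G "R\<tau> \<tau>"
    by (rule g_operad_R_tau)
  interpret R: g_operad C G \<R>
    using g_suboperad_R by (simp add: g_suboperad_def)
  interpret N: g_operad C G \<N>
    by (rule g_operad_N)
  interpret N\<tau>: g_operad C G "N\<tau> \<tau>"
    using g_suboperad_N_tau by (simp add: g_suboperad_def)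
  let ?S = "coinduced_ident G n ` op_set (R\<tau> \<tau>) n"
  have N_lev: "op_lev (N\<tau> \<tau>) n = kify (subtopology (op_lev \<N> n) ?S)"
    by (simp add: N\<tau>_def)
  \<comment> \<open>Named, since rewriting with equations for the levels would loop if these sets were the
    underlying sets of the same levels.\<close>
  define R_n R\<tau>_n pt_n where "R_n = op_set \<R> n" and "R\<tau>_n = op_set (R\<tau> \<tau>) n"
    and "pt_n = op_set pt.\<R> n"
  have R_lev: "op_lev \<R> n = kify (subtopology (op_lev \<O> n) R_n)"
    using g_suboperad_R unfolding g_suboperad_def R_n_def by blast
  have R\<tau>_lev: "op_lev (R\<tau> \<tau>) n = kify (subtopology (op_lev \<R> n) R\<tau>_n)"
    using g_suboperad_R_tau[OF \<tau>] unfolding g_suboperad_def R\<tau>_n_def by blast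
  have pt_lev: "op_lev pt.\<R> n = kify (subtopology (op_lev pt.\<O> n) pt_n)"
    using pt.g_suboperad_R unfolding g_suboperad_def pt_n_def by blast
  have S: "?S \<subseteq> op_set \<N> n"
    using R_tau_imp_R ident_closed by blast
  have N_set_eq: "op_set (N\<tau> \<tau>) n = ?S"
    unfolding N_lev using S by auto
  have un: "unident n (coinduced_ident G n x) = x" if "x \<in> op_set (R\<tau> \<tau>) n" for x
    using R_imp_O[OF R_tau_imp_R[OF that]] by (rule unident_ident)
  have ident_cont: "continuous_map (op_lev (R\<tau> \<tau>) n) (op_lev (N\<tau> \<tau>) n) (coinduced_ident G n)"
    unfolding N_lev
  proof (rule continuous_map_into_kify_subtopology[OF R\<tau>.lev_kify N.lev_weak_hausdorff])
    have "continuous_map (op_lev (R\<tau> \<tau>) n) (op_lev pt.\<R> n) (\<lambda>x. coinduced_ident G n x h)"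
      if h: "h \<in> carrier G" for h
      unfolding pt_lev
    proof (rule continuous_map_into_kify_subtopology[OF R\<tau>.lev_kify])
      show "weak_hausdorff (op_lev pt.\<O> n)"
        using operad.lev_weak_hausdorff pt.g_operad_O unfolding g_operad_def by blast
      show *: "(\<lambda>x. coinduced_ident G n x h) \<in> op_set (R\<tau> \<tau>) n \<rightarrow> pt_n"
        unfolding pt_n_def using ident_closed[OF R_tau_imp_R] h unfolding N_set by auto
      show "continuous_map (op_lev (R\<tau> \<tau>) n) (op_lev pt.\<O> n) (\<lambda>x. coinduced_ident G n x h)"
      proof (rule pt.continuous_map_into_O[OF R\<tau>.lev_kify])
        show "(\<lambda>x. coinduced_ident G n x h) \<in> op_set (R\<tau> \<tau>) n \<rightarrow> op_set pt.\<O> n"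
          using * pt.R_imp_O unfolding pt_n_def by blast
        fix g i assume "i \<in> {1..n}"
        then have "continuous_map (op_lev (R\<tau> \<tau>) n) (mtop M) (\<lambda>x. x (h, i))"
          unfolding R\<tau>_lev R_lev by (intro continuous_map_from_kify_subtopology O_coordinate h)
        then show "continuous_map (op_lev (R\<tau> \<tau>) n) (mtop M)
            (\<lambda>x. coinduced_ident G n x h (g, i))"
          using h \<open>i \<in> {1..n}\<close> by (simp del: atLeastAtMost_iff add: ident_apply)
      qed
    qed
    then show "continuous_map (op_lev (R\<tau> \<tau>) n) (op_lev \<N> n) (coinduced_ident G n)"
      unfolding coinduced_simps
      by (intro continuous_map_into_kify_product R\<tau>.lev_kify operad.lev_weak_hausdorff[OF operad_pt_R])
        (auto simp: coinduced_ident_def)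
  qed auto
  have unident_cont: "continuous_map (op_lev (N\<tau> \<tau>) n) (op_lev (R\<tau> \<tau>) n) (unident n)"
    unfolding R\<tau>_lev
  proof (rule continuous_map_into_kify_subtopology[OF N\<tau>.lev_kify R.lev_weak_hausdorff])
    show *: "unident n \<in> op_set (N\<tau> \<tau>) n \<rightarrow> R\<tau>_n"
      unfolding N_set_eq R\<tau>_n_def using un by auto
    show "continuous_map (op_lev (N\<tau> \<tau>) n) (op_lev \<R> n) (unident n)"
      unfolding R_lev
    proof (rule continuous_map_into_kify_subtopology[OF N\<tau>.lev_kify])
      show "weak_hausdorff (op_lev \<O> n)"
        using operad.lev_weak_hausdorff g_operad_O unfolding g_operad_def by blast
      show "unident n \<in> op_set (N\<tau> \<tau>) n \<rightarrow> R_n"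
        using * R_tau_imp_R unfolding R\<tau>_n_def R_n_def by blast
      show "continuous_map (op_lev (N\<tau> \<tau>) n) (op_lev \<O> n) (unident n)"
      proof (rule continuous_map_into_O[OF N\<tau>.lev_kify])
        show "unident n \<in> op_set (N\<tau> \<tau>) n \<rightarrow> op_set \<O> n"
          using * R_tau_imp_R R_imp_O unfolding R\<tau>_n_def by blast
        fix h i assume h: "h \<in> carrier G" and i: "i \<in> {1..n}"
        have "continuous_map (op_lev \<N> n) (op_lev pt.\<R> n) (\<lambda>f. f h)"
          unfolding coinduced_simps using h by (rule continuous_map_kify_product_coordinate)
        moreover have "continuous_map (op_lev pt.\<R> n) (mtop M) (\<lambda>x. x ((), i))"
          unfolding pt_lev using i
          by (intro continuous_map_from_kify_subtopology pt.O_coordinate) auto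
        ultimately have "continuous_map (op_lev \<N> n) (mtop M) ((\<lambda>x. x ((), i)) \<circ> (\<lambda>f. f h))"
          by (rule continuous_map_compose)
        then have "continuous_map (op_lev (N\<tau> \<tau>) n) (mtop M) (\<lambda>f. f h ((), i))"
          unfolding N_lev o_def by (rule continuous_map_from_kify_subtopology)
        then show "continuous_map (op_lev (N\<tau> \<tau>) n) (mtop M) (\<lambda>f. unident n f (h, i))"
          using h i by (simp add: unident_def)
      qed
    qed
  qed
  show "homeomorphic_maps (op_lev (R\<tau> \<tau>) n) (op_lev (N\<tau> \<tau>) n) (coinduced_ident G n) (unident n)"
    unfolding homeomorphic_maps_def using ident_cont unident_cont un by (auto simp: N_set_eq)
qed

lemma g_operad_iso_ident: "g_operad_iso G (coinduced_ident G) (R\<tau> \<tau>) (N\<tau> \<tau>)"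
  unfolding g_operad_iso_def R_tau_simps
  using homeomorphic_map_ident ident_unit ident_perm ident_grp ident_comp R_tau_imp_R
  by (auto simp del: atLeastAtMost_iff One_nat_def simp: N\<tau>_def)

end

end

theorem theorem1:
  fixes C :: ground
    and G :: "('g, 'b) monoid_scheme"
    and M :: "'m imonoid"
    and P :: "(unit \<times> nat \<Rightarrow> 'm, unit) g_operad_data"
    and \<tau> :: "'g set \<Rightarrow> 'g set \<Rightarrow> bool"
  assumes "group G" and "finite (carrier G)"
    and "intersection_operad C P M"
    and "\<not> trivial_imonoid M"
    and "transfer_system G \<tau>"
  shows "\<exists>N. g_suboperad C G N (coinduced G P)
    \<and> g_operad_iso G (coinduced_ident G) (R_tau_operad G M \<tau>) N
    \<and> realizes G N \<tau>"
proof -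
  have M: "intersection_monoid C M" and P: "P = R_operad (singleton_group ()) M"
    using assms(3) by (simp_all add: intersection_operad_def)
  interpret coinduced_intersection_operad C G M
    using assms(1,2) M
    by (intro coinduced_intersection_operad.intro imonoid_group.intro imonoid_group_axioms.intro)
  have "realizes G (N\<tau> \<tau>) \<tau>"
    using g_operad_R_tau[OF assms(5)] g_operad_iso_ident[OF assms(5)]
      R_tau_realizes[OF assms(5,4)] by (rule realizes_g_operad_iso)
  then show ?thesis
    unfolding P using g_suboperad_N_tau[OF assms(5)] g_operad_iso_ident[OF assms(5)] by blast
qed

end
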